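(* Let $(\mathcal C,\iota)$ be a Q-structure. Then there is a model structure on $\mathcal C$ whose cofibrations are the maps in $cof(\mathcal I)$, whose fibrations are the maps in $rlp(\mathcal J)$, and whose weak equivalences are the maps that are $n$-connected for all nonnegative integers $n$.
   Context: Write $I=[0,1]$. Let $\Box$ be the full subcategory of the category $\mathsf{Top}$ of topological spaces on all cubes $I^n$ and their boundaries $\partial I^n$, $n\ge 0$ ($I^0=*$ is a point, $\partial I^0=\emptyset$), and let $\Box_{\le 2}$ be the full subcategory on $*,I,I^2,\emptyset,\partial I,\partial I^2$. For $k\in\{0,1\}$ let $e_k:*\to I$ be the inclusion of the endpoint $k$; the same symbol denotes the inclusion $*\to\partial I$. An embedding means a faithful functor. A category with intervals is a bicomplete category $\mathcal C$ with an embedding $\iota:\Box_{\le 2}\to\mathcal C$ such that: (S1) $\iota\emptyset$ is initial and $\iota *$ is terminal; (S2) $\iota I^2\cong\iota I\times\iota I$ (product in $\mathcal C$); (S3) $\iota$ preserves a pushout square in $\Box_{\le 2}$ expressing $I$ as the pushout of $I\xleftarrow{e_1}*\xrightarrow{e_0}I$ with legs $a:I\to I$ (from the $e_1$ copy) and $b:I\to I$ (from the $e_0$ copy), so $ae_1=be_0$, such that $a(0)=0$ and $b(1)=1$, and $X\times -$ preserves this pushout for all $X\in\mathcal C$; (S4) $\emptyset\times X\cong\emptyset$ for all $X\in\mathcal C$. Objects and maps of $\Box$ are identified with their images under $\iota$. For $X\in\mathcal C$, $e_k$ also denotes $\mathrm{id}_X\times e_k: X\to X\times I$. Let $\mathcal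 I=\{i_n:\partial I^n\hookrightarrow I^n\}_{n\ge 0}$ and $\mathcal J=\{j_n:I^n\times\{0\}\hookrightarrow I^n\times I\}_{n\ge 0}$ be the (images under $\iota$ of the) subspace inclusions. For a class $\mathcal K$ of maps, $cell(\mathcal K)$ is the class of transfinite compositions of pushouts of coproducts of maps in $\mathcal K$, $cof(\mathcal K)$ is the closure of $cell(\mathcal K)$ under retracts, and $rlp(\mathcal K)$ is the class of maps with the right lifting property against $\mathcal K$. The pushout product of $f:X\to Y$ and $g:A\to B$ is the induced map $f\hat\times g:(Y\times A)\coprod_{X\times A}(X\times B)\to Y\times B$; for classes, $\mathcal K\hat\times\mathcal L=\{k\hat\times l: k\in\mathcal K,\ l\in\mathcal L\}$. An object $A$ is exponentiable if $-\times A$ has a right adjoint. A Q-structure is a pair $(\mathcal C,\iota)$ with $\mathcal C$ bicomplete and $\iota:\Box\to\mathcal C$ an embedding such that: (Q1) the restriction of $\iota$ to $\Box_{\le 2}$ makes $\mathcal C$ a category with intervals; (Q2) for all $X\in\mathcal C$, $X\times\partial I$ is a coproduct $X\coprod X$ with inclusions $\mathrm{id}_X\times e_k$, $k=0,1$; (Q3) $\mathcal I\hat\times\mathcal I\subseteq cof(\mathcal I)$ and $\mathcal I\hat\times\mathcal J\subseteq cof(\mathcal J)$; (Q4) $\mathcal J\subseteq cof(\mathcal I)$ and $\{\emptyset\to\partial I^n\}\subseteq cof(\mathcal I)$; (Q5) $\partial I^n$ and $I^n$ are exponentiable in $\mathcal C$ for all $n\ge 0$; (Q6) $\partial I^n$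 and $I^n$ are small relative to maps in $cell(\mathcal I)$ and $cell(\mathcal J)$ respectively, for all $n\ge 0$. A homotopy from $f:X\to Y$ to $g:X\to Y$ is a map $H:X\times I\to Y$ with $He_0=f$, $He_1=g$. If $i:A\to X$ satisfies $fi=gi$, the homotopy is relative to $A$ if $H(i\times\mathrm{id}_I)=fi\pi_A$, where $\pi_A:A\times I\to A$ is the projection; one writes $f\sim g$ rel $A$. A map $f:X\to Y$ is $n$-compressible if for every $u:\partial I^n\to X$ and $v:I^n\to Y$ with $fu=vi_n$ there is $h:I^n\to X$ with $hi_n=u$ and $fh\sim v$ rel $\partial I^n$. It is $n$-connected if it is $k$-compressible for all $0\le k\le n$. *)

theory Defs
  imports "HOL-Analysis.Analysis"
begin

section \<open>Size\<close>

text \<open>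
  The set/class distinction is expressed by an explicit Grothendieck universe, represented by a
  type \<open>'u\<close> of inaccessible cardinality.  A set (over any type) is small if it has fewer elements
  than \<open>'u\<close>.  Hence every small index set, small category and small ordinal has a copy
  carried by a subset of \<open>'u\<close>, and quantifying over such copies quantifies over all of them.
\<close>

definition small :: "'u itself \<Rightarrow> 'a set \<Rightarrow> bool" where
  "small (_ :: 'u itself) A \<longleftrightarrow> A \<prec> (UNIV :: 'u set)"

definition grothendieck_universe :: "'u itself \<Rightarrow> bool" where
  "grothendieck_universe U \<longleftrightarrow>
     small U (UNIV :: nat set) \<and>
     (\<forall>A :: 'u set. small U A \<longrightarrow> small U (Pow A)) \<and>
     (\<forall>(S :: 'u set) (F :: 'u \<Rightarrow> 'u set).
        small U S \<and> (\<forall>s\<in>S. small U (F s)) \<longrightarrow> small U (\<Union>s\<in>S. F s))"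


section \<open>Categories\<close>

record ('o, 'm) category =
  Ob :: "'o set"
  Arr :: "'m set"
  Dom :: "'m \<Rightarrow> 'o"
  Cod :: "'m \<Rightarrow> 'o"
  Idt :: "'o \<Rightarrow> 'm"
  Comp :: "'m \<Rightarrow> 'm \<Rightarrow> 'm"  (infixr \<open>\<cdot>\<index>\<close> 70)

definition hom :: "('o, 'm) category \<Rightarrow> 'o \<Rightarrow> 'o \<Rightarrow> 'm set" where
  "hom C X Y = {f \<in> Arr C. Dom C f = X \<and> Cod C f = Y}"

locale category =
  fixes C :: "('o, 'm) category"
  assumes Dom_in: "f \<in> Arr C \<Longrightarrow> Dom C f \<in> Ob C"
    and Cod_in: "f \<in> Arr C \<Longrightarrow> Cod C f \<in> Ob C"
    and Idt_in: "X \<in> Ob C \<Longrightarrow> Idt C X \<in> hom C X X"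
    and Comp_in: "f \<in> hom C X Y \<Longrightarrow> g \<in> hom C Y Z \<Longrightarrow> g \<cdot>\<^bsub>C\<^esub> f \<in> hom C X Z"
    and Comp_Idt: "f \<in> hom C X Y \<Longrightarrow> f \<cdot>\<^bsub>C\<^esub> Idt C X = f"
    and Idt_Comp: "f \<in> hom C X Y \<Longrightarrow> Idt C Y \<cdot>\<^bsub>C\<^esub> f = f"
    and Comp_assoc: "f \<in> hom C W X \<Longrightarrow> g \<in> hom C X Y \<Longrightarrow> h \<in> hom C Y Z \<Longrightarrow>
                       (h \<cdot>\<^bsub>C\<^esub> g) \<cdot>\<^bsub>C\<^esub> f = h \<cdot>\<^bsub>C\<^esub> (g \<cdot>\<^bsub>C\<^esub> f)"

definition locally_small :: "'u itself \<Rightarrow> ('o, 'm) category \<Rightarrow> bool" where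
  "locally_small U C \<longleftrightarrow> (\<forall>X\<in>Ob C. \<forall>Y\<in>Ob C. small U (hom C X Y))"

definition full_subcategory :: "('o, 'm) category \<Rightarrow> 'o set \<Rightarrow> ('o, 'm) category" where
  "full_subcategory C S =
     C\<lparr>Ob := Ob C \<inter> S, Arr := {f \<in> Arr C. Dom C f \<in> S \<and> Cod C f \<in> S}\<rparr>"

record ('o, 'm, 'p, 'n) ftor =
  onOb :: "'o \<Rightarrow> 'p"
  onArr :: "'m \<Rightarrow> 'n"

definition is_functor ::
  "('o, 'm) category \<Rightarrow> ('p, 'n) category \<Rightarrow> ('o, 'm, 'p, 'n) ftor \<Rightarrow> bool" where
  "is_functor C D F \<longleftrightarrow>
     (\<forall>X\<in>Ob C. onOb F X \<in> Ob D) \<and>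
     (\<forall>f\<in>Arr C. onArr F f \<in> hom D (onOb F (Dom C f)) (onOb F (Cod C f))) \<and>
     (\<forall>X\<in>Ob C. onArr F (Idt C X) = Idt D (onOb F X)) \<and>
     (\<forall>f\<in>Arr C. \<forall>g\<in>Arr C. Dom C g = Cod C f \<longrightarrow>
        onArr F (g \<cdot>\<^bsub>C\<^esub> f) = onArr F g \<cdot>\<^bsub>D\<^esub> onArr F f)"

definition is_embedding ::
  "('o, 'm) category \<Rightarrow> ('p, 'n) category \<Rightarrow> ('o, 'm, 'p, 'n) ftor \<Rightarrow> bool" where
  "is_embedding C D F \<longleftrightarrow>
     is_functor C D F \<and> (\<forall>X\<in>Ob C. \<forall>Y\<in>Ob C. inj_on (onArr F) (hom C X Y))"

definition isomorphic_in :: "('o, 'm) category \<Rightarrow> 'o \<Rightarrow> 'o \<Rightarrow> bool" where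
  "isomorphic_in C X Y \<longleftrightarrow>
     X \<in> Ob C \<and> Y \<in> Ob C \<and>
     (\<exists>f\<in>hom C X Y. \<exists>g\<in>hom C Y X. g \<cdot>\<^bsub>C\<^esub> f = Idt C X \<and> f \<cdot>\<^bsub>C\<^esub> g = Idt C Y)"

definition has_right_adjoint ::
  "('o, 'm) category \<Rightarrow> ('p, 'n) category \<Rightarrow> ('o, 'm, 'p, 'n) ftor \<Rightarrow> bool" where
  "has_right_adjoint C D F \<longleftrightarrow>
     (\<exists>(G :: ('p, 'n, 'o, 'm) ftor) (\<phi> :: 'o \<Rightarrow> 'p \<Rightarrow> 'n \<Rightarrow> 'm).
        is_functor D C G \<and>
        (\<forall>X\<in>Ob C. \<forall>Y\<in>Ob D. bij_betw (\<phi> X Y) (hom D (onOb F X) Y) (hom C X (onOb G Y))) \<and>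
        (\<forall>X\<in>Ob C. \<forall>X'\<in>Ob C. \<forall>Y\<in>Ob D. \<forall>Y'\<in>Ob D.
           \<forall>h\<in>hom D (onOb F X) Y. \<forall>a\<in>hom C X' X. \<forall>b\<in>hom D Y Y'.
             \<phi> X' Y' (b \<cdot>\<^bsub>D\<^esub> (h \<cdot>\<^bsub>D\<^esub> onArr F a)) = onArr G b \<cdot>\<^bsub>C\<^esub> (\<phi> X Y h \<cdot>\<^bsub>C\<^esub> a)))"


section \<open>Limits and colimits\<close>

definition is_cone ::
  "('o, 'm) category \<Rightarrow> ('i, 'a) category \<Rightarrow> ('i, 'a, 'o, 'm) ftor \<Rightarrow> 'o \<Rightarrow> ('i \<Rightarrow> 'm) \<Rightarrow> bool" where
  "is_cone C J F L p \<longleftrightarrow>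
     L \<in> Ob C \<and> (\<forall>j\<in>Ob J. p j \<in> hom C L (onOb F j)) \<and>
     (\<forall>a\<in>Arr J. onArr F a \<cdot>\<^bsub>C\<^esub> p (Dom J a) = p (Cod J a))"

definition is_limit ::
  "('o, 'm) category \<Rightarrow> ('i, 'a) category \<Rightarrow> ('i, 'a, 'o, 'm) ftor \<Rightarrow> 'o \<Rightarrow> ('i \<Rightarrow> 'm) \<Rightarrow> bool" where
  "is_limit C J F L p \<longleftrightarrow>
     is_cone C J F L p \<and>
     (\<forall>X q. is_cone C J F X q \<longrightarrow> (\<exists>!h. h \<in> hom C X L \<and> (\<forall>j\<in>Ob J. p j \<cdot>\<^bsub>C\<^esub> h = q j)))"

definition is_cocone ::
  "('o, 'm) category \<Rightarrow> ('i, 'a) category \<Rightarrow> ('i, 'a, 'o, 'm) ftor \<Rightarrow> 'o \<Rightarrow> ('i \<Rightarrow> 'm) \<Rightarrow> bool" where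
  "is_cocone C J F L t \<longleftrightarrow>
     L \<in> Ob C \<and> (\<forall>j\<in>Ob J. t j \<in> hom C (onOb F j) L) \<and>
     (\<forall>a\<in>Arr J. t (Cod J a) \<cdot>\<^bsub>C\<^esub> onArr F a = t (Dom J a))"

definition is_colimit ::
  "('o, 'm) category \<Rightarrow> ('i, 'a) category \<Rightarrow> ('i, 'a, 'o, 'm) ftor \<Rightarrow> 'o \<Rightarrow> ('i \<Rightarrow> 'm) \<Rightarrow> bool" where
  "is_colimit C J F L t \<longleftrightarrow>
     is_cocone C J F L t \<and>
     (\<forall>X q. is_cocone C J F X q \<longrightarrow> (\<exists>!h. h \<in> hom C L X \<and> (\<forall>j\<in>Ob J. h \<cdot>\<^bsub>C\<^esub> t j = q j)))"

definition bicomplete :: "'u itself \<Rightarrow> ('o, 'm) category \<Rightarrow> bool" where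
  "bicomplete U C \<longleftrightarrow>
     (\<forall>(J :: ('u, 'u) category) (F :: ('u, 'u, 'o, 'm) ftor).
        category J \<and> small U (Ob J) \<and> small U (Arr J) \<and> is_functor J C F \<longrightarrow>
          (\<exists>L p. is_limit C J F L p) \<and> (\<exists>L t. is_colimit C J F L t))"

definition is_initial :: "('o, 'm) category \<Rightarrow> 'o \<Rightarrow> bool" where
  "is_initial C X \<longleftrightarrow> X \<in> Ob C \<and> (\<forall>Y\<in>Ob C. \<exists>!f. f \<in> hom C X Y)"

definition is_terminal :: "('o, 'm) category \<Rightarrow> 'o \<Rightarrow> bool" where
  "is_terminal C X \<longleftrightarrow> X \<in> Ob C \<and> (\<forall>Y\<in>Ob C. \<exists>!f. f \<in> hom C Y X)"

definition is_product :: "('o, 'm) category \<Rightarrow> 'o \<Rightarrow> 'o \<Rightarrow> 'o \<Rightarrow> 'm \<Rightarrow> 'm \<Rightarrow> bool" where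
  "is_product C A B P p q \<longleftrightarrow>
     P \<in> Ob C \<and> p \<in> hom C P A \<and> q \<in> hom C P B \<and>
     (\<forall>X\<in>Ob C. \<forall>f\<in>hom C X A. \<forall>g\<in>hom C X B.
        \<exists>!h. h \<in> hom C X P \<and> p \<cdot>\<^bsub>C\<^esub> h = f \<and> q \<cdot>\<^bsub>C\<^esub> h = g)"

definition is_coproduct ::
  "('o, 'm) category \<Rightarrow> 's set \<Rightarrow> ('s \<Rightarrow> 'o) \<Rightarrow> 'o \<Rightarrow> ('s \<Rightarrow> 'm) \<Rightarrow> bool" where
  "is_coproduct C S A Q t \<longleftrightarrow>
     Q \<in> Ob C \<and> (\<forall>s\<in>S. t s \<in> hom C (A s) Q) \<and>
     (\<forall>Y\<in>Ob C. \<forall>g. (\<forall>s\<in>S. g s \<in> hom C (A s) Y) \<longrightarrow>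
        (\<exists>!h. h \<in> hom C Q Y \<and> (\<forall>s\<in>S. h \<cdot>\<^bsub>C\<^esub> t s = g s)))"

text \<open>\<open>i\<close> and \<open>j\<close> are the legs of a pushout of the span \<open>f\<close>, \<open>g\<close>: the square is \<open>i f = j g\<close>.\<close>

definition is_pushout :: "('o, 'm) category \<Rightarrow> 'm \<Rightarrow> 'm \<Rightarrow> 'm \<Rightarrow> 'm \<Rightarrow> bool" where
  "is_pushout C f g i j \<longleftrightarrow>
     {f, g, i, j} \<subseteq> Arr C \<and> Dom C f = Dom C g \<and>
     Dom C i = Cod C f \<and> Dom C j = Cod C g \<and> Cod C i = Cod C j \<and>
     i \<cdot>\<^bsub>C\<^esub> f = j \<cdot>\<^bsub>C\<^esub> g \<and>
     (\<forall>Y\<in>Ob C. \<forall>x\<in>hom C (Cod C f) Y. \<forall>y\<in>hom C (Cod C g) Y. x \<cdot>\<^bsub>C\<^esub> f = y \<cdot>\<^bsub>C\<^esub> g \<longrightarrow>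
        (\<exists>!h. h \<in> hom C (Cod C i) Y \<and> h \<cdot>\<^bsub>C\<^esub> i = x \<and> h \<cdot>\<^bsub>C\<^esub> j = y))"

text \<open>
  Binary products are chosen once and for all; the choice is meaningful
  whenever the product exists, in particular in a bicomplete category.
\<close>

definition product_cone :: "('o, 'm) category \<Rightarrow> 'o \<Rightarrow> 'o \<Rightarrow> 'o \<times> 'm \<times> 'm" where
  "product_cone C A B = (SOME (P, p, q). is_product C A B P p q)"

definition times_ob :: "('o, 'm) category \<Rightarrow> 'o \<Rightarrow> 'o \<Rightarrow> 'o" where
  "times_ob C A B = fst (product_cone C A B)"

definition pr1 :: "('o, 'm) category \<Rightarrow> 'o \<Rightarrow> 'o \<Rightarrow> 'm" where
  "pr1 C A B = fst (snd (product_cone C A B))"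

definition pr2 :: "('o, 'm) category \<Rightarrow> 'o \<Rightarrow> 'o \<Rightarrow> 'm" where
  "pr2 C A B = snd (snd (product_cone C A B))"

definition pairing :: "('o, 'm) category \<Rightarrow> 'm \<Rightarrow> 'm \<Rightarrow> 'm" where
  "pairing C f g =
     (THE h. h \<in> hom C (Dom C f) (times_ob C (Cod C f) (Cod C g)) \<and>
             pr1 C (Cod C f) (Cod C g) \<cdot>\<^bsub>C\<^esub> h = f \<and> pr2 C (Cod C f) (Cod C g) \<cdot>\<^bsub>C\<^esub> h = g)"

definition times_arr :: "('o, 'm) category \<Rightarrow> 'm \<Rightarrow> 'm \<Rightarrow> 'm" where
  "times_arr C f g =
     pairing C (f \<cdot>\<^bsub>C\<^esub> pr1 C (Dom C f) (Dom C g)) (g \<cdot>\<^bsub>C\<^esub> pr2 C (Dom C f) (Dom C g))"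

definition exponentiable :: "('o, 'm) category \<Rightarrow> 'o \<Rightarrow> bool" where
  "exponentiable C A \<longleftrightarrow>
     A \<in> Ob C \<and>
     has_right_adjoint C C \<lparr>onOb = (\<lambda>X. times_ob C X A), onArr = (\<lambda>f. times_arr C f (Idt C A))\<rparr>"


section \<open>Lifting properties, cell complexes, smallness\<close>

definition has_lift :: "('o, 'm) category \<Rightarrow> 'm \<Rightarrow> 'm \<Rightarrow> bool" where
  "has_lift C i p \<longleftrightarrow>
     (\<forall>u\<in>hom C (Dom C i) (Dom C p). \<forall>v\<in>hom C (Cod C i) (Cod C p). p \<cdot>\<^bsub>C\<^esub> u = v \<cdot>\<^bsub>C\<^esub> i \<longrightarrow>
        (\<exists>h\<in>hom C (Cod C i) (Dom C p). h \<cdot>\<^bsub>C\<^esub> i = u \<and> p \<cdot>\<^bsub>C\<^esub> h = v))"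

definition rlp :: "('o, 'm) category \<Rightarrow> 'm set \<Rightarrow> 'm set" where
  "rlp C K = {p \<in> Arr C. \<forall>i\<in>K. has_lift C i p}"

definition is_retract :: "('o, 'm) category \<Rightarrow> 'm \<Rightarrow> 'm \<Rightarrow> bool" where
  "is_retract C f g \<longleftrightarrow>
     f \<in> Arr C \<and> g \<in> Arr C \<and>
     (\<exists>s\<in>hom C (Dom C f) (Dom C g). \<exists>r\<in>hom C (Dom C g) (Dom C f).
      \<exists>s'\<in>hom C (Cod C f) (Cod C g). \<exists>r'\<in>hom C (Cod C g) (Cod C f).
        r \<cdot>\<^bsub>C\<^esub> s = Idt C (Dom C f) \<and> r' \<cdot>\<^bsub>C\<^esub> s' = Idt C (Cod C f) \<and>
        g \<cdot>\<^bsub>C\<^esub> s = s' \<cdot>\<^bsub>C\<^esub> f \<and> f \<cdot>\<^bsub>C\<^esub> r = r' \<cdot>\<^bsub>C\<^esub> g)"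

definition coproducts_of_maps :: "'u itself \<Rightarrow> ('o, 'm) category \<Rightarrow> 'm set \<Rightarrow> 'm set" where
  "coproducts_of_maps (U :: 'u itself) C K =
     {h. \<exists>(S :: 'u set) k P p Q q.
        small U S \<and> (\<forall>s\<in>S. k s \<in> K) \<and>
        is_coproduct C S (\<lambda>s. Dom C (k s)) P p \<and> is_coproduct C S (\<lambda>s. Cod C (k s)) Q q \<and>
        h \<in> hom C P Q \<and> (\<forall>s\<in>S. h \<cdot>\<^bsub>C\<^esub> p s = q s \<cdot>\<^bsub>C\<^esub> k s)}"

definition pushouts_of_maps :: "('o, 'm) category \<Rightarrow> 'm set \<Rightarrow> 'm set" where
  "pushouts_of_maps C K = {f. \<exists>k\<in>K. \<exists>g g'. is_pushout C g k f g'}"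

text \<open>An ordinal is a nonempty well-order \<open>r\<close>; it is regarded as the poset category on its field.\<close>

definition poset_category :: "'a rel \<Rightarrow> ('a, 'a \<times> 'a) category" where
  "poset_category r =
     \<lparr>Ob = Field r, Arr = r, Dom = fst, Cod = snd, Idt = (\<lambda>x. (x, x)), Comp = (\<lambda>g f. (fst f, snd g))\<rparr>"

definition succ_in :: "'a rel \<Rightarrow> 'a \<Rightarrow> 'a \<Rightarrow> bool" where
  "succ_in r x y \<longleftrightarrow> x \<in> underS r y \<and> (\<forall>z\<in>underS r y. (z, x) \<in> r)"

definition limit_in :: "'a rel \<Rightarrow> 'a \<Rightarrow> bool" where
  "limit_in r y \<longleftrightarrow> y \<in> Field r \<and> underS r y \<noteq> {} \<and> (\<forall>x. \<not> succ_in r x y)"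

definition transfinite_sequence ::
  "('o, 'm) category \<Rightarrow> 'a rel \<Rightarrow> ('a, 'a \<times> 'a, 'o, 'm) ftor \<Rightarrow> bool" where
  "transfinite_sequence C r X \<longleftrightarrow>
     Well_order r \<and> Field r \<noteq> {} \<and> is_functor (poset_category r) C X \<and>
     (\<forall>y. limit_in r y \<longrightarrow>
        is_colimit C (poset_category (Restr r (underS r y))) X (onOb X y) (\<lambda>x. onArr X (x, y)))"

definition steps_in ::
  "'a rel \<Rightarrow> ('a, 'a \<times> 'a, 'o, 'm) ftor \<Rightarrow> 'm set \<Rightarrow> bool" where
  "steps_in r X D \<longleftrightarrow> (\<forall>x y. succ_in r x y \<longrightarrow> onArr X (x, y) \<in> D)"

definition transfinite_compositions ::
  "'u itself \<Rightarrow> ('o, 'm) category \<Rightarrow> 'm set \<Rightarrow> 'm set" where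
  "transfinite_compositions (U :: 'u itself) C D =
     {f. \<exists>(r :: 'u rel) X L t b.
        small U (Field r) \<and> transfinite_sequence C r X \<and> steps_in r X D \<and>
        is_colimit C (poset_category r) X L t \<and>
        b \<in> Field r \<and> underS r b = {} \<and> f = t b}"

definition cell :: "'u itself \<Rightarrow> ('o, 'm) category \<Rightarrow> 'm set \<Rightarrow> 'm set" where
  "cell U C K = transfinite_compositions U C (pushouts_of_maps C (coproducts_of_maps U C K))"

definition cof :: "'u itself \<Rightarrow> ('o, 'm) category \<Rightarrow> 'm set \<Rightarrow> 'm set" where
  "cof U C K = {f. \<exists>g\<in>cell U C K. is_retract C f g}"

text \<open>
  A limit ordinal \<open>r\<close> is filtered with respect to the cardinal of \<open>K\<close> if every subset of
  cardinality at most that of \<open>K\<close> is strictly bounded (and not merely cofinal) in \<open>r\<close>.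
\<close>

definition filtered_ordinal :: "'k set \<Rightarrow> 'a rel \<Rightarrow> bool" where
  "filtered_ordinal K r \<longleftrightarrow>
     Well_order r \<and> Field r \<noteq> {} \<and> (\<forall>x\<in>Field r. \<exists>y\<in>Field r. x \<in> underS r y) \<and>
     (\<forall>B \<subseteq> Field r. B \<lesssim> K \<longrightarrow> (\<exists>y\<in>Field r. B \<subseteq> underS r y))"

text \<open>
  \<open>A\<close> is small relative to \<open>D\<close> if, for some cardinal, the canonical map from the colimit
  of the sets \<open>hom C A (X\<^sub>x)\<close> to \<open>hom C A (colim X)\<close> is bijective for every sequence \<open>X\<close> of maps in
  \<open>D\<close> indexed by an ordinal filtered for that cardinal.  The last two conjuncts are surjectivity
  and injectivity of that map, elements of a directed colimit of sets being equal iff they become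
  equal at some later stage.
\<close>

definition small_relative_to ::
  "'u itself \<Rightarrow> ('o, 'm) category \<Rightarrow> 'o \<Rightarrow> 'm set \<Rightarrow> bool" where
  "small_relative_to (U :: 'u itself) C A D \<longleftrightarrow>
     A \<in> Ob C \<and>
     (\<exists>K :: 'u set. small U K \<and>
       (\<forall>(r :: 'u rel) X L t.
          small U (Field r) \<and> filtered_ordinal K r \<and> transfinite_sequence C r X \<and>
          steps_in r X D \<and> is_colimit C (poset_category r) X L t \<longrightarrow>
            (\<forall>f\<in>hom C A L. \<exists>x\<in>Field r. \<exists>g\<in>hom C A (onOb X x). t x \<cdot>\<^bsub>C\<^esub> g = f) \<and>
            (\<forall>x\<in>Field r. \<forall>g\<in>hom C A (onOb X x).
             \<forall>x'\<in>Field r. \<forall>g'\<in>hom C A (onOb X x'). t x \<cdot>\<^bsub>C\<^esub> g = t x' \<cdot>\<^bsub>C\<^esub> g' \<longrightarrow>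
               (\<exists>y. (x, y) \<in> r \<and> (x', y) \<in> r \<and>
                    onArr X (x, y) \<cdot>\<^bsub>C\<^esub> g = onArr X (x', y) \<cdot>\<^bsub>C\<^esub> g'))))"

text \<open>The pushout product of \<open>f : X \<rightarrow> Y\<close> and \<open>g : A \<rightarrow> B\<close>, for any choice of the pushout.\<close>

definition is_pushout_product :: "('o, 'm) category \<Rightarrow> 'm \<Rightarrow> 'm \<Rightarrow> 'm \<Rightarrow> bool" where
  "is_pushout_product C f g h \<longleftrightarrow>
     f \<in> Arr C \<and> g \<in> Arr C \<and>
     (\<exists>i j. is_pushout C (times_arr C f (Idt C (Dom C g))) (times_arr C (Idt C (Dom C f)) g) i j \<and>
        h \<in> hom C (Cod C i) (times_ob C (Cod C f) (Cod C g)) \<and>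
        h \<cdot>\<^bsub>C\<^esub> i = times_arr C (Idt C (Cod C f)) g \<and>
        h \<cdot>\<^bsub>C\<^esub> j = times_arr C f (Idt C (Cod C g)))"

definition pushout_products :: "('o, 'm) category \<Rightarrow> 'm set \<Rightarrow> 'm set \<Rightarrow> 'm set" where
  "pushout_products C K L = {h. \<exists>k\<in>K. \<exists>l\<in>L. is_pushout_product C k l h}"


section \<open>Model structures\<close>

definition model_structure ::
  "('o, 'm) category \<Rightarrow> 'm set \<Rightarrow> 'm set \<Rightarrow> 'm set \<Rightarrow> bool" where
  "model_structure C Weq Cofib Fib \<longleftrightarrow>
     Weq \<subseteq> Arr C \<and> Cofib \<subseteq> Arr C \<and> Fib \<subseteq> Arr C \<and>
     (\<forall>f\<in>Arr C. \<forall>g\<in>Arr C. Dom C g = Cod C f \<longrightarrow>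
        (f \<in> Weq \<and> g \<in> Weq \<longrightarrow> g \<cdot>\<^bsub>C\<^esub> f \<in> Weq) \<and>
        (f \<in> Weq \<and> g \<cdot>\<^bsub>C\<^esub> f \<in> Weq \<longrightarrow> g \<in> Weq) \<and>
        (g \<in> Weq \<and> g \<cdot>\<^bsub>C\<^esub> f \<in> Weq \<longrightarrow> f \<in> Weq)) \<and>
     (\<forall>f g. is_retract C f g \<longrightarrow>
        (g \<in> Weq \<longrightarrow> f \<in> Weq) \<and> (g \<in> Cofib \<longrightarrow> f \<in> Cofib) \<and> (g \<in> Fib \<longrightarrow> f \<in> Fib)) \<and>
     (\<forall>i\<in>Cofib. \<forall>p\<in>Fib. i \<in> Weq \<or> p \<in> Weq \<longrightarrow> has_lift C i p) \<and>
     (\<forall>f\<in>Arr C. \<exists>i\<in>Cofib. \<exists>p\<in>Fib \<inter> Weq. Dom C p = Cod C i \<and> f = p \<cdot>\<^bsub>C\<^esub> i) \<and>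
     (\<forall>f\<in>Arr C. \<exists>i\<in>Cofib \<inter> Weq. \<exists>p\<in>Fib. Dom C p = Cod C i \<and> f = p \<cdot>\<^bsub>C\<^esub> i)"


section \<open>The category of cubes and their boundaries\<close>

text \<open>
  The topological spaces with points in \<open>'a\<close>.  A map carries its source and target, and its
  underlying function is normalised to be \<open>undefined\<close> outside the source.
\<close>

type_synonym 'a top_arr = "'a topology \<times> ('a \<Rightarrow> 'a) \<times> 'a topology"

definition top_category :: "('a topology, 'a top_arr) category" where
  "top_category =
     \<lparr>Ob = UNIV,
      Arr = {(X, f, Y). continuous_map X Y f \<and> f \<in> extensional (topspace X)},
      Dom = (\<lambda>(X, f, Y). X),
      Cod = (\<lambda>(X, f, Y). Y),
      Idt = (\<lambda>X. (X, (\<lambda>x\<in>topspace X. x), X)),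
      Comp = (\<lambda>(_, g, Z) (X, f, _). (X, compose (topspace X) g f, Z))\<rparr>"

text \<open>
  Since \<open>Euclidean_space n\<close> consists of the sequences supported on \<open>{..<n}\<close>, the cube \<open>I\<^sup>n\<close> is
  literally the subspace \<open>I\<^sup>n \<times> {0}\<close> of \<open>I\<^sup>n \<times> I = I\<^sup>n\<^sup>+\<^sup>1\<close>, and \<open>cube_boundary 0\<close> is empty.
\<close>

definition cube :: "nat \<Rightarrow> (nat \<Rightarrow> real) topology" where
  "cube n = subtopology (Euclidean_space n) {x. \<forall>i<n. 0 \<le> x i \<and> x i \<le> 1}"

definition cube_boundary :: "nat \<Rightarrow> (nat \<Rightarrow> real) topology" where
  "cube_boundary n = subtopology (cube n) {x. \<exists>i<n. x i = 0 \<or> x i = 1}"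

type_synonym box_ob = "(nat \<Rightarrow> real) topology"
type_synonym box_arr = "(nat \<Rightarrow> real) top_arr"

definition Box :: "(box_ob, box_arr) category" where
  "Box = full_subcategory top_category (range cube \<union> range cube_boundary)"

definition Box2 :: "(box_ob, box_arr) category" where
  "Box2 = full_subcategory top_category (cube ` {..2} \<union> cube_boundary ` {..2})"

definition inclusion :: "box_ob \<Rightarrow> box_ob \<Rightarrow> box_arr" where
  "inclusion X Y = (X, (\<lambda>x\<in>topspace X. x), Y)"

text \<open>The inclusion of the endpoint \<open>k\<close> into \<open>X\<close>, where \<open>X\<close> is \<open>cube 1\<close> or \<open>cube_boundary 1\<close>.\<close>

definition endpoint :: "real \<Rightarrow> box_ob \<Rightarrow> box_arr" where
  "endpoint k X = (cube 0, (\<lambda>x\<in>topspace (cube 0). (\<lambda>i. if i = 0 then k else 0)), X)"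


section \<open>Categories with intervals and Q-structures\<close>

text \<open>\<open>id\<^sub>X \<times> e\<^sub>k\<close> as a map on \<open>X\<close>, that is, precomposed with \<open>X \<cong> X \<times> *\<close>; here \<open>B\<close> is \<open>I\<close> or its boundary.\<close>

definition at_endpoint ::
  "('o, 'm) category \<Rightarrow> (box_ob, box_arr, 'o, 'm) ftor \<Rightarrow> real \<Rightarrow> box_ob \<Rightarrow> 'o \<Rightarrow> 'm" where
  "at_endpoint C \<iota> k B X =
     pairing C (Idt C X) (onArr \<iota> (endpoint k B) \<cdot>\<^bsub>C\<^esub> (THE f. f \<in> hom C X (onOb \<iota> (cube 0))))"

text \<open>
  The isomorphism of \<open>\<iota> I\<^sup>2\<close> with \<open>\<iota> I \<times> \<iota> I\<close> is not required to be induced by the images of the projections.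
\<close>

definition category_with_intervals ::
  "'u itself \<Rightarrow> ('o, 'm) category \<Rightarrow> (box_ob, box_arr, 'o, 'm) ftor \<Rightarrow> bool" where
  "category_with_intervals U C \<iota> \<longleftrightarrow>
     category C \<and> locally_small U C \<and> bicomplete U C \<and> is_embedding Box2 C \<iota> \<and>
     is_initial C (onOb \<iota> (cube_boundary 0)) \<and> is_terminal C (onOb \<iota> (cube 0)) \<and>
     isomorphic_in C (onOb \<iota> (cube 2)) (times_ob C (onOb \<iota> (cube 1)) (onOb \<iota> (cube 1))) \<and>
     (\<exists>a b. is_pushout Box2 (endpoint 1 (cube 1)) (endpoint 0 (cube 1)) a b \<and>
        Cod Box2 a = cube 1 \<and>
        a \<cdot>\<^bsub>Box2\<^esub> endpoint 0 (cube 1) = endpoint 0 (cube 1) \<and>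
        b \<cdot>\<^bsub>Box2\<^esub> endpoint 1 (cube 1) = endpoint 1 (cube 1) \<and>
        is_pushout C (onArr \<iota> (endpoint 1 (cube 1))) (onArr \<iota> (endpoint 0 (cube 1)))
          (onArr \<iota> a) (onArr \<iota> b) \<and>
        (\<forall>X\<in>Ob C. is_pushout C
           (times_arr C (Idt C X) (onArr \<iota> (endpoint 1 (cube 1))))
           (times_arr C (Idt C X) (onArr \<iota> (endpoint 0 (cube 1))))
           (times_arr C (Idt C X) (onArr \<iota> a))
           (times_arr C (Idt C X) (onArr \<iota> b)))) \<and>
     (\<forall>X\<in>Ob C. isomorphic_in C (times_ob C (onOb \<iota> (cube_boundary 0)) X) (onOb \<iota> (cube_boundary 0)))"

definition boundary_inclusion :: "(box_ob, box_arr, 'o, 'm) ftor \<Rightarrow> nat \<Rightarrow> 'm" where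
  "boundary_inclusion \<iota> n = onArr \<iota> (inclusion (cube_boundary n) (cube n))"

definition gen_cof :: "(box_ob, box_arr, 'o, 'm) ftor \<Rightarrow> 'm set" where
  "gen_cof \<iota> = range (boundary_inclusion \<iota>)"

definition gen_triv_cof :: "(box_ob, box_arr, 'o, 'm) ftor \<Rightarrow> 'm set" where
  "gen_triv_cof \<iota> = range (\<lambda>n. onArr \<iota> (inclusion (cube n) (cube (Suc n))))"

definition Q_structure ::
  "'u itself \<Rightarrow> ('o, 'm) category \<Rightarrow> (box_ob, box_arr, 'o, 'm) ftor \<Rightarrow> bool" where
  "Q_structure U C \<iota> \<longleftrightarrow>
     category C \<and> locally_small U C \<and> bicomplete U C \<and> is_embedding Box C \<iota> \<and>
     category_with_intervals U C \<iota> \<and>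
     (\<forall>X\<in>Ob C. is_coproduct C {0, 1} (\<lambda>_. X)
        (times_ob C X (onOb \<iota> (cube_boundary 1))) (\<lambda>k. at_endpoint C \<iota> k (cube_boundary 1) X)) \<and>
     pushout_products C (gen_cof \<iota>) (gen_cof \<iota>) \<subseteq> cof U C (gen_cof \<iota>) \<and>
     pushout_products C (gen_cof \<iota>) (gen_triv_cof \<iota>) \<subseteq> cof U C (gen_triv_cof \<iota>) \<and>
     gen_triv_cof \<iota> \<subseteq> cof U C (gen_cof \<iota>) \<and>
     (\<forall>n. onArr \<iota> (inclusion (cube_boundary 0) (cube_boundary n)) \<in> cof U C (gen_cof \<iota>)) \<and>
     (\<forall>n. exponentiable C (onOb \<iota> (cube_boundary n)) \<and> exponentiable C (onOb \<iota> (cube n))) \<and>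
     (\<forall>n. small_relative_to U C (onOb \<iota> (cube_boundary n)) (cell U C (gen_cof \<iota>)) \<and>
          small_relative_to U C (onOb \<iota> (cube n)) (cell U C (gen_triv_cof \<iota>)))"


section \<open>Homotopies and connectedness\<close>

text \<open>\<open>f \<sim> g\<close> relative to the domain of \<open>i\<close>\<close>

definition homotopic_rel ::
  "('o, 'm) category \<Rightarrow> (box_ob, box_arr, 'o, 'm) ftor \<Rightarrow> 'm \<Rightarrow> 'm \<Rightarrow> 'm \<Rightarrow> bool" where
  "homotopic_rel C \<iota> i f g \<longleftrightarrow>
     (\<exists>X Y. f \<in> hom C X Y \<and> g \<in> hom C X Y \<and> i \<in> hom C (Dom C i) X \<and> f \<cdot>\<^bsub>C\<^esub> i = g \<cdot>\<^bsub>C\<^esub> i \<and>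
        (\<exists>H\<in>hom C (times_ob C X (onOb \<iota> (cube 1))) Y.
           H \<cdot>\<^bsub>C\<^esub> at_endpoint C \<iota> 0 (cube 1) X = f \<and>
           H \<cdot>\<^bsub>C\<^esub> at_endpoint C \<iota> 1 (cube 1) X = g \<and>
           H \<cdot>\<^bsub>C\<^esub> times_arr C i (Idt C (onOb \<iota> (cube 1))) =
             (f \<cdot>\<^bsub>C\<^esub> i) \<cdot>\<^bsub>C\<^esub> pr1 C (Dom C i) (onOb \<iota> (cube 1))))"

definition n_compressible ::
  "('o, 'm) category \<Rightarrow> (box_ob, box_arr, 'o, 'm) ftor \<Rightarrow> nat \<Rightarrow> 'm \<Rightarrow> bool" where
  "n_compressible C \<iota> n f \<longleftrightarrow>
     f \<in> Arr C \<and>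
     (\<forall>u\<in>hom C (onOb \<iota> (cube_boundary n)) (Dom C f). \<forall>v\<in>hom C (onOb \<iota> (cube n)) (Cod C f).
        f \<cdot>\<^bsub>C\<^esub> u = v \<cdot>\<^bsub>C\<^esub> boundary_inclusion \<iota> n \<longrightarrow>
        (\<exists>h\<in>hom C (onOb \<iota> (cube n)) (Dom C f).
           h \<cdot>\<^bsub>C\<^esub> boundary_inclusion \<iota> n = u \<and>
           homotopic_rel C \<iota> (boundary_inclusion \<iota> n) (f \<cdot>\<^bsub>C\<^esub> h) v))"

definition n_connected ::
  "('o, 'm) category \<Rightarrow> (box_ob, box_arr, 'o, 'm) ftor \<Rightarrow> nat \<Rightarrow> 'm \<Rightarrow> bool" where
  "n_connected C \<iota> n f \<longleftrightarrow> (\<forall>k\<le>n. n_compressible C \<iota> k f)"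

end

theory Submission
  imports Defs
begin

text \<open>
  Adjointness turns homotopies into maps to path objects, and the pushout product axioms say that
  the evaluations \<open>ev 0, ev 1 : Path Y \<rightarrow> Y\<close> have the right lifting property against the generating
  cofibrations while \<open>Path Y \<rightarrow> Y \<times> Y\<close> has it against the generating trivial ones, all objects being
  fibrant.  Lifting against the evaluations fills open boxes, so that homotopies never have to be
  concatenated.  By box filling, \<open>f\<close> is \<open>n\<close>-connected for all \<open>n\<close> iff the endpoint map of its mapping
  path space lifts against the generating cofibrations, hence against every cofibration.  The
  two-out-of-three property follows by applying this to \<open>\<partial>I\<^sup>n \<rightarrow> I\<^sup>n\<close>, to its pushout product with
  \<open>\<partial>I \<rightarrow> I\<close> and to \<open>\<emptyset> \<rightarrow> \<partial>I\<^sup>n\<close>.  The rest is the small object argument and the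
  retract argument.
\<close>

text \<open>Compressibility supplies a lift in which one triangle commutes only up to homotopy, and
  it is tested on the generators alone; such a property does not pass formally to pushouts and
  transfinite compositions. Recording the homotopy as a path makes both triangles strict, after
  which lifting against all of \<open>Cof\<close> is formal. The delicate cancellation concludes
  from \<open>f\<close> and \<open>g f\<close> to \<open>g\<close>: a sphere in the middle object
  need not come from the source of \<open>f\<close>. It has to be moved there along paths first,
  which is possible because spheres are cofibrant. The retract argument rests on this case: if a
  weak equivalence in \<open>Cof\<close> is factored as a map in \<open>Cof\<^sub>J\<close> followed
  by a fibration, that fibration must be seen to be a weak equivalence too. On the side of set
  theory, the small object argument runs along a single ordinal for all countably many generators,
  so their smallness cardinals have to be dominated together below the universe.\<close>

section \<open>Small sets\<close>

unbundle cardinal_syntax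

text \<open>Cardinals given by well-orders carry the arithmetic of products, successors and
  regularity used in this section, so smallness is restated in their order.\<close>

lemma small_iff_ordLess: "small (U :: 'u itself) A \<longleftrightarrow> |A| <o |UNIV :: 'u set|"
proof -
  have "A \<lesssim> B \<longleftrightarrow> |A| \<le>o |B|" for A :: "'x set" and B :: "'y set"
    unfolding lepoll_def by (rule card_of_ordLeq)
  then show ?thesis
    unfolding small_def lesspoll_def eqpoll_iff_card_of_ordIso by (simp add: ordLeq_iff_ordLess_or_ordIso) (blast dest: not_ordLess_ordIso)
qed

lemma small_lepoll: "A \<lesssim> B \<Longrightarrow> small U B \<Longrightarrow> small U A"
  unfolding small_def by (rule lesspoll_trans1)

lemma small_subset: "A \<subseteq> B \<Longrightarrow> small U B \<Longrightarrow> small U A"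
  by (blast intro: small_lepoll subset_imp_lepoll)

lemma small_image: "small U A \<Longrightarrow> small U (f ` A)"
  by (blast intro: small_lepoll image_lepoll)

lemma small_inj_image_iff: "inj_on f A \<Longrightarrow> small U (f ` A) \<longleftrightarrow> small U A"
  unfolding small_def by simp

text \<open>The universe axioms and bicompleteness speak only of sets of elements of
  \<open>'u\<close>; this injection transports any other small set there.\<close>

lemma small_copy:
  assumes "small (U :: 'u itself) A"
  obtains e :: "'a \<Rightarrow> 'u" where "inj_on e A" "small U (e ` A)"
proof -
  have "A \<lesssim> (UNIV :: 'u set)" using assms unfolding small_def by (rule lesspoll_imp_lepoll)
  then obtain e :: "'a \<Rightarrow> 'u" where "inj_on e A" unfolding lepoll_def by blast
  with assms show ?thesis by (intro that small_image)
qed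

context
  fixes U :: "'u itself"
  assumes universe: "grothendieck_universe U"
begin

lemma small_nat: "small U (UNIV :: nat set)"
  using universe unfolding grothendieck_universe_def by blast

lemma infinite_universe: "infinite (UNIV :: 'u set)"
  using small_nat unfolding small_def infinite_le_lepoll by (rule lesspoll_imp_lepoll)

lemma small_finite: "finite A \<Longrightarrow> small U A"
  unfolding small_def using infinite_universe by (rule finite_lesspoll_infinite)

lemma small_Pow: "small U A \<Longrightarrow> small U (Pow A)"
proof -
  assume "small U A"
  then obtain e :: "'a \<Rightarrow> 'u" where e: "inj_on e A" "small U (e ` A)" by (rule small_copy)
  then have "small U (Pow (e ` A))" using universe unfolding grothendieck_universe_def by blast
  then have "small U ((`) e ` Pow A)" by (simp add: image_Pow_surj)
  then show "small U (Pow A)" using inj_on_image_Pow[OF e(1)] by (simp add: small_inj_image_iff)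
qed

text \<open>The universe axioms mention no products. Unless both factors are finite, the larger one
  is infinite and the product is no larger than it.\<close>

lemma small_Times:
  assumes A: "small U A" and B: "small U B"
  shows "small U (A \<times> B)"
proof (cases "finite A \<and> finite B")
  case True
  then show ?thesis by (simp add: small_finite)
next
  case False
  have "|A| \<le>o |B| \<or> |B| \<le>o |A|" by (intro ordLeq_total card_of_Well_order)
  then consider "infinite A" "|B| \<le>o |A|" | "infinite B" "|A| \<le>o |B|"
    using False card_of_ordLeq_finite[of A B] card_of_ordLeq_finite[of B A] by blast
  then have "|A \<times> B| \<le>o |A| \<or> |A \<times> B| \<le>o |B|"
    using card_of_Times_ordLeq_infinite_Field[of "|A|" A B] card_of_Times_ordLeq_infinite_Field[of "|B|" A B]
    by cases (simp_all add: Field_card_of card_of_card_order_on ordIso_ordLeq_trans[OF card_of_refl] ordLeq_refl)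
  with A B show ?thesis unfolding small_iff_ordLess by (blast intro: ordLeq_ordLess_trans)
qed

text \<open>The union axiom is indexed by small subsets of \<open>'u\<close>, so the natural numbers
  are replaced by their copy \<open>range e\<close>.\<close>

lemma small_UN_nat: "(\<And>n :: nat. small U (F n :: 'u set)) \<Longrightarrow> small U (\<Union>n. F n)"
proof -
  assume F: "\<And>n :: nat. small U (F n)"
  obtain e :: "nat \<Rightarrow> 'u" where e: "inj e" "small U (range e)"
    using small_copy[OF small_nat] by blast
  have "small U (\<Union>s\<in>range e. F (inv e s))"
    using universe unfolding grothendieck_universe_def
    by (elim conjE allE[of _ "range e"] allE[of _ "\<lambda>s. F (inv e s)"] impE) (simp_all add: e(2) F)
  then show ?thesis using e(1) by simp
qed

text \<open>Serves to bound the set of lifting problems against countably many generators. The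
  injections of the fibres may have overlapping images, hence the index is kept as a tag.\<close>

lemma small_Sigma_nat:
  assumes "\<And>n :: nat. small U (F n :: 'a set)"
  shows "small U (SIGMA n : UNIV. F n)"
proof -
  have "\<exists>e :: 'a \<Rightarrow> 'u. inj_on e (F n) \<and> small U (e ` F n)" for n
    using small_copy[OF assms] by blast
  then obtain e :: "nat \<Rightarrow> 'a \<Rightarrow> 'u" where e: "\<And>n. inj_on (e n) (F n)" "\<And>n. small U (e n ` F n)"
    by metis
  let ?g = "\<lambda>(n, x). (n, e n x)"
  have "inj_on ?g (SIGMA n : UNIV. F n)" using e(1) by (auto simp: inj_on_def)
  moreover have "?g ` (SIGMA n : UNIV. F n) \<subseteq> UNIV \<times> (\<Union>n. e n ` F n)" by auto
  then have "small U (?g ` (SIGMA n : UNIV. F n))"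
    by (rule small_subset) (intro small_Times small_nat small_UN_nat e(2))
  ultimately show ?thesis by (simp add: small_inj_image_iff)
qed

text \<open>The successor cardinal of the union of the given sets is regular, hence filtered for each of them.\<close>

lemma filtered_ordinal_exists:
  assumes "\<And>n :: nat. small U (K n :: 'u set)"
  obtains r :: "'u rel" where "small U (Field r)" "\<And>n. filtered_ordinal (K n) r"
proof -
  obtain e :: "nat \<Rightarrow> 'u" where e: "inj e" "small U (range e)"
    using small_copy[OF small_nat] by blast
  \<comment> \<open>The copy of the natural numbers is added to make \<open>T\<close> infinite,
    since the successor of an infinite cardinal is regular.\<close>
  define T where "T = (\<Union>n. range e \<union> K n)"
  have T: "small U T" unfolding T_def
  proof (rule small_UN_nat)
    fix n
    let ?F = "\<lambda>m :: nat. if m = 0 then range e else K n"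
    have "range e \<union> K n \<subseteq> ?F 0 \<union> ?F 1" by simp
    also have "\<dots> \<subseteq> (\<Union>m. ?F m)" by blast
    finally show "small U (range e \<union> K n)"
      by (rule small_subset) (rule small_UN_nat, simp add: e(2) assms)
  qed
  have infT: "infinite T"
  proof
    assume "finite T"
    then have "finite (range e)" by (rule rev_finite_subset) (auto simp: T_def)
    with e(1) show False using finite_imageD infinite_UNIV_nat by blast
  qed
  let ?s = "cardSuc |T|"
  have s: "Card_order ?s" "\<not> finite (Field ?s)" "|T| <o ?s"
    using infT cardSuc_Card_order[OF card_of_Card_order, of T] cardSuc_finite[OF card_of_Card_order, of T]
      cardSuc_greater[OF card_of_Card_order, of T] by (simp_all add: Field_card_of)
  have "|Pow T| <o |UNIV :: 'u set|"
    using small_Pow[OF T] unfolding small_iff_ordLess .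
  \<comment> \<open>Closure of the universe under power sets keeps the successor cardinal
    small.\<close>
  moreover have "?s \<le>o |Pow T|" by (intro cardSuc_least card_of_Card_order card_of_Pow)
  ultimately have "?s <o |UNIV :: 'u set|" by (rule ordLeq_ordLess_trans[rotated])
  moreover have "|Field ?s| =o ?s" using s(1) by (rule card_of_Field_ordIso)
  ultimately have F: "|Field ?s| <o |UNIV :: 'u set|" by (rule ordIso_ordLess_trans[rotated])
  then obtain c :: "'u set \<Rightarrow> 'u" where c: "inj_on c (Field ?s)"
    using card_of_ordLeq[of "Field ?s" "UNIV :: 'u set"] ordLess_imp_ordLeq by blast
  \<comment> \<open>The successor cardinal is a relation on sets of elements of \<open>'u\<close>.
    Its field is copied into \<open>'u\<close> and well-ordered anew, as sequences are indexed by
    relations on \<open>'u\<close>.\<close>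
  define r where "r = |c ` Field ?s|"
  have "|Field ?s| =o r" unfolding r_def using c card_of_ordIso inj_on_imp_bij_betw by blast
  then have rs: "r =o ?s" by (rule ordIso_transitive[OF ordIso_symmetric]) fact
  have Fr: "Field r = c ` Field ?s" unfolding r_def by (rule Field_card_of)
  have r: "Card_order r" "\<not> finite (Field r)" unfolding r_def using s(2) c
    by (simp_all only: card_of_card_order_on Field_card_of finite_image_iff not_False_eq_True)
  have cinf: "Cinfinite ?s" using s by (simp add: cinfinite_def)
  have "regularCard ?s" using infT by (intro infinite_cardSuc_regularCard card_of_Card_order) (simp add: Field_card_of)
  then have reg: "regularCard r" by (rule regularCard_ordIso[OF ordIso_symmetric[OF rs] cinf])
  have wo: "Well_order r" using r(1) by (rule card_order_on_well_order_on)
  interpret wo: wo_rel r using wo by (simp add: wo_rel_def)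
  have smallr: "small U (Field r)" 
    unfolding Fr by (rule small_image) (unfold small_iff_ordLess, rule F)
  have nomax: "\<exists>y\<in>Field r. x \<in> underS r y" if "x \<in> Field r" for x
    using infinite_Card_order_limit[OF r that] unfolding underS_def by auto
  have "filtered_ordinal (K n) r" for n
    unfolding filtered_ordinal_def
  proof (intro conjI allI impI ballI)
    show "Field r \<noteq> {}" using r(2) by auto
    fix B assume B: "B \<subseteq> Field r" "B \<lesssim> K n"
    have "K n \<subseteq> T" unfolding T_def by blast
    then have "B \<lesssim> T" using B(2) lepoll_trans subset_imp_lepoll by blast
    then have "|B| \<le>o |T|" unfolding lepoll_def card_of_ordLeq .
    then have "|B| <o ?s" using s(3) by (rule ordLeq_ordLess_trans)
    then have "|B| <o r" by (rule ordLess_ordIso_trans[OF _ ordIso_symmetric[OF rs]])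
    \<comment> \<open>By regularity a cofinal subset would be as large as \<open>r\<close>. A stage
      \<open>a\<close> that \<open>B\<close> does not exceed is a weak bound, and any larger
      \<open>y\<close> is a strict one.\<close>
    then have "\<not> cofinal B r" using reg B(1) unfolding regularCard_def by (blast dest: not_ordLess_ordIso)
    then obtain a where a: "a \<in> Field r" "\<And>b. b \<in> B \<Longrightarrow> a = b \<or> (a, b) \<notin> r"
      unfolding cofinal_def by blast
    obtain y where y: "y \<in> Field r" "a \<in> underS r y" using nomax a(1) by blast
    have "B \<subseteq> underS r y"
    proof
      fix b assume b: "b \<in> B"
      then have "(b, a) \<in> r" using a B(1) wo.TOTALS wo.REFL unfolding refl_on_def by (metis subsetD)
      then show "b \<in> underS r y" using y(2) wo.TRANS wo.ANTISYM unfolding underS_def trans_def antisym_def by blast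
    qed
    with y(1) show "\<exists>y\<in>Field r. B \<subseteq> underS r y" by blast
  qed (use wo nomax in auto)
  with smallr that show ?thesis by blast
qed

end

unbundle no cardinal_syntax

section \<open>Limits and colimits\<close>

context category
begin

lemma in_hom: "f \<in> hom C X Y \<Longrightarrow> f \<in> Arr C" "f \<in> hom C X Y \<Longrightarrow> Dom C f = X"
    "f \<in> hom C X Y \<Longrightarrow> Cod C f = Y"
  by (simp_all add: hom_def)

lemma Ob_of_hom: "f \<in> hom C X Y \<Longrightarrow> X \<in> Ob C" "f \<in> hom C X Y \<Longrightarrow> Y \<in> Ob C"
  unfolding hom_def using Dom_in Cod_in by blast+

lemma Ob_of_Arr [simp]: "f \<in> Arr C \<Longrightarrow> Dom C f \<in> Ob C" "f \<in> Arr C \<Longrightarrow> Cod C f \<in> Ob C"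
  by (rule Dom_in Cod_in, assumption)+

lemma Arr_hom: "f \<in> Arr C \<Longrightarrow> f \<in> hom C (Dom C f) (Cod C f)"
  by (simp add: hom_def)

lemma Idt_simps [simp]: 
  assumes "X \<in> Ob C"
  shows "Idt C X \<in> Arr C" "Dom C (Idt C X) = X" "Cod C (Idt C X) = X"
  using Idt_in[OF assms] by (simp_all add: hom_def)

lemma Comp_simps [simp]:
  assumes "f \<in> Arr C" "g \<in> Arr C" "Dom C g = Cod C f"
  shows "g \<cdot>\<^bsub>C\<^esub> f \<in> Arr C" "Dom C (g \<cdot>\<^bsub>C\<^esub> f) = Dom C f" "Cod C (g \<cdot>\<^bsub>C\<^esub> f) = Cod C g"
  using Comp_in[of f "Dom C f" "Cod C f" g "Cod C g"] assms by (simp_all add: hom_def)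

lemma Comp_assoc_simp [simp]:
  assumes "f \<in> Arr C" "g \<in> Arr C" "h \<in> Arr C" "Dom C g = Cod C f" "Dom C h = Cod C g"
  shows "(h \<cdot>\<^bsub>C\<^esub> g) \<cdot>\<^bsub>C\<^esub> f = h \<cdot>\<^bsub>C\<^esub> (g \<cdot>\<^bsub>C\<^esub> f)"
  using assms by (intro Comp_assoc[OF Arr_hom]) (simp_all add: hom_def)

lemma Comp_Idt_simp [simp]: "f \<in> Arr C \<Longrightarrow> Dom C f = X \<Longrightarrow> f \<cdot>\<^bsub>C\<^esub> Idt C X = f"
  by (rule Comp_Idt) (simp add: hom_def)

lemma Idt_Comp_simp [simp]: "f \<in> Arr C \<Longrightarrow> Cod C f = X \<Longrightarrow> Idt C X \<cdot>\<^bsub>C\<^esub> f = f"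
  by (rule Idt_Comp) (simp add: hom_def)

declare Comp_Idt [simp] Idt_Comp [simp]

text \<open>Simplification nests composites to the right, where an equation for
  \<open>g \<cdot> f\<close> no longer matches; this form applies it in front of a further map
  \<open>w\<close>.\<close>

lemma Comp_reassoc:
  assumes "g \<cdot>\<^bsub>C\<^esub> f = k" "f \<in> Arr C" "g \<in> Arr C" "Dom C g = Cod C f" "w \<in> Arr C" "Dom C f = Cod C w"
  shows "g \<cdot>\<^bsub>C\<^esub> (f \<cdot>\<^bsub>C\<^esub> w) = k \<cdot>\<^bsub>C\<^esub> w"
  using assms Comp_assoc_simp by metis

text \<open>Bicompleteness only provides (co)limits of diagrams whose shape is carried by the universe itself.\<close>

lemma bicomplete_limits:
  fixes J :: "('i, 'a) category"
  assumes C: "bicomplete (U :: 'u itself) C" and J: "category J" "small U (Ob J)" "small U (Arr J)"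
    and F: "is_functor J C F"
  shows "\<exists>L p. is_limit C J F L p" "\<exists>L t. is_colimit C J F L t"
proof -
  interpret J: category J by (rule J)
  obtain e :: "'i \<Rightarrow> 'u" where e: "inj_on e (Ob J)" "small U (e ` Ob J)" by (rule small_copy[OF J(2)]) blast
  obtain a :: "'a \<Rightarrow> 'u" where a: "inj_on a (Arr J)" "small U (a ` Arr J)" by (rule small_copy[OF J(3)]) blast
  define e' where "e' = inv_into (Ob J) e"
  define a' where "a' = inv_into (Arr J) a"
  have e'[simp]: "x \<in> Ob J \<Longrightarrow> e' (e x) = x" for x using e(1) by (simp add: e'_def)
  have a'[simp]: "x \<in> Arr J \<Longrightarrow> a' (a x) = x" for x using a(1) by (simp add: a'_def)
  have e_eq[simp]: "x \<in> Ob J \<Longrightarrow> y \<in> Ob J \<Longrightarrow> e x = e y \<longleftrightarrow> x = y" for x y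
    using e(1) by (simp add: inj_on_eq_iff)
  define J' where "J' = \<lparr>Ob = e ` Ob J, Arr = a ` Arr J, Dom = e \<circ> Dom J \<circ> a', Cod = e \<circ> Cod J \<circ> a',
    Idt = a \<circ> Idt J \<circ> e', Comp = \<lambda>g f. a (a' g \<cdot>\<^bsub>J\<^esub> a' f)\<rparr>"
  define F' where "F' = \<lparr>onOb = onOb F \<circ> e', onArr = onArr F \<circ> a'\<rparr>"
  have hom': "h \<in> hom J' (e X) (e Y) \<longleftrightarrow> h \<in> a ` hom J X Y" if "X \<in> Ob J" "Y \<in> Ob J" for h X Y
    using that e(1) by (auto simp: hom_def J'_def inj_on_def)
  have J': "category J'"
  proof
    fix f assume "f \<in> Arr J'"
    then show "Dom J' f \<in> Ob J'" "Cod J' f \<in> Ob J'" by (auto simp: J'_def)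
  next
    fix X assume "X \<in> Ob J'"
    then obtain x where x: "x \<in> Ob J" "X = e x" by (auto simp: J'_def)
    then show "Idt J' X \<in> hom J' X X" using J.Idt_in[OF x(1)] by (simp add: hom') (simp add: J'_def)
  next
    fix f X Y g Z assume fg: "f \<in> hom J' X Y" "g \<in> hom J' Y Z"
    then show "g \<cdot>\<^bsub>J'\<^esub> f \<in> hom J' X Z"
      by (auto simp: hom_def J'_def)
  next
    fix f X Y assume "f \<in> hom J' X Y"
    then show "f \<cdot>\<^bsub>J'\<^esub> Idt J' X = f" "Idt J' Y \<cdot>\<^bsub>J'\<^esub> f = f" by (auto simp: hom_def J'_def)
  next
    fix f W X g Y h Z assume "f \<in> hom J' W X" "g \<in> hom J' X Y" "h \<in> hom J' Y Z"
    then show "(h \<cdot>\<^bsub>J'\<^esub> g) \<cdot>\<^bsub>J'\<^esub> f = h \<cdot>\<^bsub>J'\<^esub> (g \<cdot>\<^bsub>J'\<^esub> f)"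
      by (auto simp: hom_def J'_def)
  qed
  have "is_functor J' C F'"
    using F unfolding is_functor_def by (auto simp: J'_def F'_def)
  moreover have "small U (Ob J')" "small U (Arr J')" using e(2) a(2) by (simp_all add: J'_def)
  ultimately obtain L p L' t where L: "is_limit C J' F' L p" "is_colimit C J' F' L' t"
    using C[unfolded bicomplete_def, rule_format, of J' F'] J' by blast
  \<comment> \<open>Only the values on objects and arrows of the shape enter a cone, so reindexing
    along \<open>e\<close> and \<open>e'\<close> matches the cones over the two diagrams.\<close>
  have c: "is_cone C J' F' X (q \<circ> e') \<longleftrightarrow> is_cone C J F X q"
      "is_cocone C J' F' X (q \<circ> e') \<longleftrightarrow> is_cocone C J F X q" for X q
    by (simp_all add: is_cone_def is_cocone_def J'_def F'_def)
  have c': "is_cone C J' F' X q \<longleftrightarrow> is_cone C J F X (q \<circ> e)"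
      "is_cocone C J' F' X q \<longleftrightarrow> is_cocone C J F X (q \<circ> e)" for X q
    by (simp_all add: is_cone_def is_cocone_def J'_def F'_def)
  have "is_limit C J F L (p \<circ> e)"
    unfolding is_limit_def
  proof (intro conjI allI impI)
    show "is_cone C J F L (p \<circ> e)" using L(1) unfolding is_limit_def c' by blast
    fix X q assume "is_cone C J F X q"
    with L(1) have "\<exists>!h. h \<in> hom C X L \<and> (\<forall>j\<in>Ob J'. p j \<cdot>\<^bsub>C\<^esub> h = (q \<circ> e') j)"
      unfolding is_limit_def c(1)[symmetric] by blast
    then show "\<exists>!h. h \<in> hom C X L \<and> (\<forall>j\<in>Ob J. (p \<circ> e) j \<cdot>\<^bsub>C\<^esub> h = q j)" by (simp add: J'_def)
  qed
  moreover have "is_colimit C J F L' (t \<circ> e)"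
    unfolding is_colimit_def
  proof (intro conjI allI impI)
    show "is_cocone C J F L' (t \<circ> e)" using L(2) unfolding is_colimit_def c' by blast
    fix X q assume "is_cocone C J F X q"
    with L(2) have "\<exists>!h. h \<in> hom C L' X \<and> (\<forall>j\<in>Ob J'. h \<cdot>\<^bsub>C\<^esub> t j = (q \<circ> e') j)"
      unfolding is_colimit_def c(2)[symmetric] by blast
    then show "\<exists>!h. h \<in> hom C L' X \<and> (\<forall>j\<in>Ob J. h \<cdot>\<^bsub>C\<^esub> (t \<circ> e) j = q j)" by (simp add: J'_def)
  qed
  ultimately show "\<exists>L p. is_limit C J F L p" "\<exists>L t. is_colimit C J F L t" by blast+
qed

end

section \<open>Diagrams indexed by posets\<close>

lemma poset_category_simps [simp]:
  "Ob (poset_category r) = Field r" "Arr (poset_category r) = r"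
  "Dom (poset_category r) = fst" "Cod (poset_category r) = snd"
  "Idt (poset_category r) x = (x, x)" "Comp (poset_category r) g f = (fst f, snd g)"
  by (simp_all add: poset_category_def)

lemma category_poset:
  assumes "\<And>x. x \<in> Field r \<Longrightarrow> (x, x) \<in> r" and "trans r"
  shows "category (poset_category r)"
  by unfold_locales (use assms in \<open>auto simp: hom_def intro: FieldI1 FieldI2 dest: transD\<close>)

lemma is_functor_poset:
  "is_functor (poset_category r) C F \<longleftrightarrow>
     (\<forall>x\<in>Field r. onOb F x \<in> Ob C \<and> onArr F (x, x) = Idt C (onOb F x)) \<and>
     (\<forall>x y. (x, y) \<in> r \<longrightarrow> onArr F (x, y) \<in> hom C (onOb F x) (onOb F y)) \<and>
     (\<forall>x y z. (x, y) \<in> r \<longrightarrow> (y, z) \<in> r \<longrightarrow>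
        onArr F (x, z) = onArr F (y, z) \<cdot>\<^bsub>C\<^esub> onArr F (x, y))"
  unfolding is_functor_def by (auto simp: Ball_def)

lemma is_cone_poset:
  "is_cone C (poset_category r) F L p \<longleftrightarrow>
     L \<in> Ob C \<and> (\<forall>x\<in>Field r. p x \<in> hom C L (onOb F x)) \<and>
     (\<forall>x y. (x, y) \<in> r \<longrightarrow> onArr F (x, y) \<cdot>\<^bsub>C\<^esub> p x = p y)"
  unfolding is_cone_def by auto

lemma is_cocone_poset:
  "is_cocone C (poset_category r) F L t \<longleftrightarrow>
     L \<in> Ob C \<and> (\<forall>x\<in>Field r. t x \<in> hom C (onOb F x) L) \<and>
     (\<forall>x y. (x, y) \<in> r \<longrightarrow> t y \<cdot>\<^bsub>C\<^esub> onArr F (x, y) = t x)"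
  unfolding is_cocone_def by auto

locale category_syntax = category C for C (structure)

locale bicomplete_category = category_syntax +
  fixes U :: "'u itself"
  assumes universe: "grothendieck_universe U" and bicomplete: "bicomplete U C"
begin

text \<open>Spans, cospans, discrete families and ordinals are all posets, so this covers the shapes
  that occur. The set of arrows is small because it lies in the square of the field.\<close>

lemma poset_limits:
  assumes "small U (Field r)" and "\<And>x. x \<in> Field r \<Longrightarrow> (x, x) \<in> r" and "trans r"
    and "is_functor (poset_category r) C F"
  shows "\<exists>L p. is_limit C (poset_category r) F L p" "\<exists>L t. is_colimit C (poset_category r) F L t"
proof -
  have "small U r"
    using small_Times[OF universe assms(1) assms(1)] by (rule small_subset[rotated]) (auto intro: FieldI1 FieldI2)
  then show "\<exists>L p. is_limit C (poset_category r) F L p" "\<exists>L t. is_colimit C (poset_category r) F L t"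
    using assms bicomplete category_poset[of r] by (simp_all add: bicomplete_limits)
qed

lemma pushout_exists:
  assumes f: "f \<in> hom C A B" and g: "g \<in> hom C A D"
  obtains P i j where "is_pushout C f g i j" "i \<in> hom C B P" "j \<in> hom C D P"
proof -
  \<comment> \<open>The walking span: 0 is the apex, 1 and 2 are the feet.\<close>
  define r :: "nat rel" where "r = {(0,0),(1,1),(2,2),(0,1),(0,2)}"
  define F where "F = \<lparr>onOb = (\<lambda>n :: nat. if n = 0 then A else if n = 1 then B else D),
    onArr = (\<lambda>(x :: nat, y :: nat). if x = y then Idt C (if x = 0 then A else if x = 1 then B else D)
      else if y = 1 then f else g)\<rparr>"
  have Fr: "Field r = {0,1,2}" by (auto simp: r_def Field_def)
  note ob = Ob_of_hom[OF f] Ob_of_hom[OF g]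
  have "is_functor (poset_category r) C F"
    using f g ob by (auto simp: is_functor_poset Fr) (auto simp: r_def F_def Idt_in)
  moreover have "small U (Field r)" by (simp add: Fr small_finite[OF universe])
  moreover have "trans r" by (auto simp: r_def trans_def)
  ultimately obtain P t where P: "is_colimit C (poset_category r) F P t"
    using poset_limits(2)[of r F] by (auto simp: Fr) (auto simp: r_def)
  have cc: "is_cocone C (poset_category r) F Q q \<longleftrightarrow>
      Q \<in> Ob C \<and> q 0 \<in> hom C A Q \<and> q 1 \<in> hom C B Q \<and> q 2 \<in> hom C D Q \<and> q 1 \<cdot> f = q 0 \<and> q 2 \<cdot> g = q 0" for Q q
    unfolding is_cocone_poset Fr by (auto simp: r_def F_def)
  have t: "P \<in> Ob C" "t 0 \<in> hom C A P" "t 1 \<in> hom C B P" "t 2 \<in> hom C D P" "t 1 \<cdot> f = t 0" "t 2 \<cdot> g = t 0"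
    using P unfolding is_colimit_def cc by blast+
  have "\<exists>!h. h \<in> hom C P Y \<and> h \<cdot> t 1 = x \<and> h \<cdot> t 2 = y"
    if Y: "Y \<in> Ob C" and x: "x \<in> hom C B Y" and y: "y \<in> hom C D Y" and xy: "x \<cdot> f = y \<cdot> g" for Y x y
  proof -
    define q where "q = (\<lambda>n :: nat. if n = 0 then x \<cdot> f else if n = 1 then x else y)"
    have "is_cocone C (poset_category r) F Y q"
      unfolding cc using Y x y xy f g Comp_in[OF f x] by (simp add: q_def)
    then have ex: "\<exists>!h. h \<in> hom C P Y \<and> (\<forall>j\<in>{0,1,2}. h \<cdot> t j = q j)" 
      using P unfolding is_colimit_def by (simp add: Fr)
    \<comment> \<open>The component at the apex is determined by the component at a foot, so only
      two equations remain.\<close>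
    have "(\<forall>j\<in>{0,1,2}. h \<cdot> t j = q j) \<longleftrightarrow> h \<cdot> t 1 = x \<and> h \<cdot> t 2 = y" if "h \<in> hom C P Y" for h
    proof -
      have "h \<cdot> t 0 = (h \<cdot> t 1) \<cdot> f" using t that f by (simp add: Comp_assoc[OF f _ that])
      then show ?thesis by (auto simp: q_def)
    qed
    with ex show ?thesis by metis
  qed
  then have "is_pushout C f g (t 1) (t 2)"
    using t in_hom[OF f] in_hom[OF g] in_hom[OF t(3)] in_hom[OF t(4)] by (simp add: is_pushout_def)
  with t show ?thesis by (intro that)
qed

lemma pullback_exists:
  assumes f: "f \<in> hom C B A" and g: "g \<in> hom C D A"
  obtains P i j where "i \<in> hom C P B" "j \<in> hom C P D" "f \<cdot> i = g \<cdot> j"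
    "\<And>Y x y. x \<in> hom C Y B \<Longrightarrow> y \<in> hom C Y D \<Longrightarrow> f \<cdot> x = g \<cdot> y \<Longrightarrow>
       \<exists>!h. h \<in> hom C Y P \<and> i \<cdot> h = x \<and> j \<cdot> h = y"
proof -
  \<comment> \<open>The same shape with its arrows reversed: 0 is now the common target.\<close>
  define r :: "nat rel" where "r = {(0,0),(1,1),(2,2),(1,0),(2,0)}"
  define F where "F = \<lparr>onOb = (\<lambda>n :: nat. if n = 0 then A else if n = 1 then B else D),
    onArr = (\<lambda>(x :: nat, y :: nat). if x = y then Idt C (if x = 0 then A else if x = 1 then B else D)
      else if x = 1 then f else g)\<rparr>"
  have Fr: "Field r = {0,1,2}" by (auto simp: r_def Field_def)
  note ob = Ob_of_hom[OF f] Ob_of_hom[OF g]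
  have "is_functor (poset_category r) C F"
    using f g ob by (auto simp: is_functor_poset Fr) (auto simp: r_def F_def Idt_in)
  moreover have "small U (Field r)" by (simp add: Fr small_finite[OF universe])
  moreover have "trans r" by (auto simp: r_def trans_def)
  ultimately obtain P t where P: "is_limit C (poset_category r) F P t"
    using poset_limits(1)[of r F] by (auto simp: Fr) (auto simp: r_def)
  have cc: "is_cone C (poset_category r) F Q q \<longleftrightarrow>
      Q \<in> Ob C \<and> q 0 \<in> hom C Q A \<and> q 1 \<in> hom C Q B \<and> q 2 \<in> hom C Q D \<and> f \<cdot> q 1 = q 0 \<and> g \<cdot> q 2 = q 0" for Q q
    unfolding is_cone_poset Fr by (auto simp: r_def F_def)
  have t: "P \<in> Ob C" "t 0 \<in> hom C P A" "t 1 \<in> hom C P B" "t 2 \<in> hom C P D" "f \<cdot> t 1 = t 0" "g \<cdot> t 2 = t 0"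
    using P unfolding is_limit_def cc by blast+
  have *: "\<exists>!h. h \<in> hom C Y P \<and> t 1 \<cdot> h = x \<and> t 2 \<cdot> h = y"
    if x: "x \<in> hom C Y B" and y: "y \<in> hom C Y D" and xy: "f \<cdot> x = g \<cdot> y" for Y x y
  proof -
    define q where "q = (\<lambda>n :: nat. if n = 0 then f \<cdot> x else if n = 1 then x else y)"
    have "is_cone C (poset_category r) F Y q"
      unfolding cc using Ob_of_hom[OF x] x y xy f g Comp_in[OF x f] by (simp add: q_def)
    then have ex: "\<exists>!h. h \<in> hom C Y P \<and> (\<forall>j\<in>{0,1,2}. t j \<cdot> h = q j)" 
      using P unfolding is_limit_def by (simp add: Fr)
    have "(\<forall>j\<in>{0,1,2}. t j \<cdot> h = q j) \<longleftrightarrow> t 1 \<cdot> h = x \<and> t 2 \<cdot> h = y" if "h \<in> hom C Y P" for h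
    proof -
      have "t 0 \<cdot> h = f \<cdot> (t 1 \<cdot> h)" using t that f Comp_assoc[OF that t(3) f] by simp
      then show ?thesis by (auto simp: q_def)
    qed
    with ex show ?thesis by metis
  qed
  have "f \<cdot> t 1 = g \<cdot> t 2" using t by simp
  from that[OF t(3,4) this *] show ?thesis .
qed

lemma coproduct_exists:
  fixes S :: "'s set"
  assumes "small U S" and "\<And>s. s \<in> S \<Longrightarrow> A s \<in> Ob C"
  obtains Q t where "is_coproduct C S A Q t"
proof -
  define F where "F = \<lparr>onOb = A, onArr = (\<lambda>(x :: 's, y :: 's). Idt C (A x))\<rparr>"
  have Fr: "Field (Id_on S) = S" by (auto simp: Field_def)
  have "is_functor (poset_category (Id_on S)) C F"
    using assms(2) by (auto simp: is_functor_poset Fr F_def Idt_in)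
  then obtain Q t where Q: "is_colimit C (poset_category (Id_on S)) F Q t"
    using poset_limits(2)[of "Id_on S" F] assms(1) by (auto simp: Fr)
  have cc: "is_cocone C (poset_category (Id_on S)) F Y q \<longleftrightarrow> Y \<in> Ob C \<and> (\<forall>s\<in>S. q s \<in> hom C (A s) Y)" for Y q
    unfolding is_cocone_poset Fr by (auto simp: F_def)
  have "is_coproduct C S A Q t"
    using Q unfolding is_coproduct_def is_colimit_def cc by (simp add: Fr)
  then show ?thesis by (rule that)
qed

lemma product_exists:
  assumes "A \<in> Ob C" "B \<in> Ob C"
  obtains P p q where "is_product C A B P p q"
proof -
  define F where "F = \<lparr>onOb = (\<lambda>b. if b then A else B), onArr = (\<lambda>(x :: bool, y :: bool). Idt C (if x then A else B))\<rparr>"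
  have Fr: "Field (Id :: bool rel) = UNIV" by (auto simp: Field_def)
  have "is_functor (poset_category Id) C F"
    using assms by (auto simp: is_functor_poset F_def Idt_in)
  moreover have "small U (UNIV :: bool set)" by (rule small_finite[OF universe]) simp
  ultimately obtain P t where P: "is_limit C (poset_category Id) F P t"
    using poset_limits(1)[of "Id" F] by (auto simp: Fr trans_Id)
  have cc: "is_cone C (poset_category Id) F Y q \<longleftrightarrow> Y \<in> Ob C \<and> q True \<in> hom C Y A \<and> q False \<in> hom C Y B" for Y q
    unfolding is_cone_poset Fr by (auto simp: F_def all_bool_eq)
  have "is_product C A B P (t True) (t False)"
    unfolding is_product_def
  proof (intro conjI ballI)
    show "P \<in> Ob C" "t True \<in> hom C P A" "t False \<in> hom C P B" using P unfolding is_limit_def cc by auto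
    fix X f g assume "X \<in> Ob C" "f \<in> hom C X A" "g \<in> hom C X B"
    then have "is_cone C (poset_category Id) F X (\<lambda>b. if b then f else g)" unfolding cc by simp
    then have "\<exists>!h. h \<in> hom C X P \<and> (\<forall>j. t j \<cdot> h = (if j then f else g))"
      using P unfolding is_limit_def by (simp add: Fr)
    then show "\<exists>!h. h \<in> hom C X P \<and> t True \<cdot> h = f \<and> t False \<cdot> h = g" by (simp add: all_bool_eq)
  qed
  then show ?thesis by (rule that)
qed

end

section \<open>Lifting properties\<close>

lemma has_liftD:
  assumes "has_lift C i p" "i \<in> hom C A B" "p \<in> hom C E F" "u \<in> hom C A E" "v \<in> hom C B F"
    "p \<cdot>\<^bsub>C\<^esub> u = v \<cdot>\<^bsub>C\<^esub> i"
  obtains h where "h \<in> hom C B E" "h \<cdot>\<^bsub>C\<^esub> i = u" "p \<cdot>\<^bsub>C\<^esub> h = v"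
  using assms unfolding has_lift_def hom_def by auto

lemma has_liftI:
  assumes "i \<in> hom C A B" "p \<in> hom C E F"
    and "\<And>u v. u \<in> hom C A E \<Longrightarrow> v \<in> hom C B F \<Longrightarrow> p \<cdot>\<^bsub>C\<^esub> u = v \<cdot>\<^bsub>C\<^esub> i \<Longrightarrow>
           \<exists>h\<in>hom C B E. h \<cdot>\<^bsub>C\<^esub> i = u \<and> p \<cdot>\<^bsub>C\<^esub> h = v"
  shows "has_lift C i p"
  using assms unfolding has_lift_def hom_def by auto

section \<open>Zero, successor and limit stages of a well-order\<close>

lemma well_order_cases:
  assumes "y \<in> Field r"
  obtains "underS r y = {}" | x where "succ_in r x y" | "limit_in r y"
  using assms unfolding limit_in_def by blast

context
  fixes r :: "'a rel"
  assumes r: "Well_order r"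
begin

lemma well_order_simps:
  "x \<in> Field r \<Longrightarrow> (x, x) \<in> r" "trans r" "antisym r"
  "x \<in> Field r \<Longrightarrow> y \<in> Field r \<Longrightarrow> (x, y) \<in> r \<or> (y, x) \<in> r" "wf (r - Id)"
  using wo_rel.REFL[of r] wo_rel.TRANS[of r] wo_rel.ANTISYM[of r] wo_rel.TOTALS[of r] r
  by (auto simp: wo_rel_def refl_on_def well_order_on_def)

lemma underS_Field: "x \<in> underS r y \<Longrightarrow> x \<in> Field r \<and> y \<in> Field r \<and> (x, y) \<in> r \<and> x \<noteq> y"
  by (auto simp: underS_def intro: FieldI1 FieldI2)

lemma le_iff_underS: "(x, y) \<in> r \<longleftrightarrow> x \<in> underS r y \<or> x = y \<and> y \<in> Field r"
  using well_order_simps(1) by (auto simp: underS_def intro: FieldI1)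

lemma underS_trans: "x \<in> underS r y \<Longrightarrow> (y, z) \<in> r \<Longrightarrow> x \<in> underS r z"
  "(x, y) \<in> r \<Longrightarrow> y \<in> underS r z \<Longrightarrow> x \<in> underS r z"
  using well_order_simps(2,3) by (auto simp: underS_def dest: transD antisymD)

lemma least_unique: "b \<in> Field r \<Longrightarrow> underS r b = {} \<Longrightarrow> y \<in> Field r \<Longrightarrow> underS r y = {} \<Longrightarrow> y = b"
  using well_order_simps(4)[of b y] by (auto simp: underS_def)

lemma succ_unique: "succ_in r x y \<Longrightarrow> succ_in r x' y \<Longrightarrow> x = x'"
  using well_order_simps(3) by (auto simp: succ_in_def antisym_def)

lemma least_above:
  assumes "x \<in> A" "A \<subseteq> Field r"
  obtains y where "y \<in> A" "underS r y \<inter> A = {}"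
proof -
  obtain y where "y \<in> A" "\<And>z. (z, y) \<in> r - Id \<Longrightarrow> z \<notin> A"
    using wfE_min[OF well_order_simps(5) assms(1)] by blast
  then show ?thesis by (intro that) (auto simp: underS_def)
qed

text \<open>The least element strictly above \<open>x\<close> is its successor; the assumption says
  that \<open>x\<close> is not the last element.\<close>

lemma succ_exists:
  assumes "x \<in> underS r y"
  obtains z where "succ_in r x z"
proof -
  obtain z where z: "z \<in> {z. x \<in> underS r z}" "underS r z \<inter> {z. x \<in> underS r z} = {}"
    using least_above[of y "{z. x \<in> underS r z}"] assms underS_Field by blast
  have "(w, x) \<in> r" if w: "w \<in> underS r z" for w
  proof -
    have "x \<notin> underS r w" using z(2) w by blast
    moreover have "x \<in> Field r" "w \<in> Field r" using z(1) w underS_Field by blast+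
    ultimately show ?thesis using well_order_simps(4)[of x w] well_order_simps(1)[of x] unfolding underS_def by blast
  qed
  then show ?thesis using z(1) by (intro that) (auto simp: succ_in_def)
qed

lemma Field_Restr_underS: "Field (Restr r (underS r y)) = underS r y"
  using underS_Field well_order_simps(1) by (auto simp: Field_def) blast

end

text \<open>Lets the colimit condition at a limit stage depend on the earlier stages only, as a
  recursion requires.\<close>

lemma is_colimit_cong:
  assumes "\<And>j. j \<in> Ob J \<Longrightarrow> onOb F j = onOb G j" "\<And>a. a \<in> Arr J \<Longrightarrow> onArr F a = onArr G a"
    "\<And>j. j \<in> Ob J \<Longrightarrow> t j = t' j" "category J"
  shows "is_colimit C J F L t = is_colimit C J G L t'"
proof -
  have "is_cocone C J F X q = is_cocone C J G X q'" if "\<And>j. j \<in> Ob J \<Longrightarrow> q j = q' j" for X q q'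
    using assms(1,2) that category.Dom_in[OF assms(4)] category.Cod_in[OF assms(4)] by (simp add: is_cocone_def)
  then have "is_cocone C J F L t = is_cocone C J G L t'" "is_cocone C J F X q = is_cocone C J G X q" for X q
    using assms(3) by blast+
  then show ?thesis using assms(3) by (simp add: is_colimit_def)
qed

section \<open>Stability of lifting properties under colimits and retracts\<close>

context category_syntax
begin

lemma colimit_mediating:
  assumes "is_colimit C (poset_category r) F L t" "X \<in> Ob C"
    and "\<And>x. x \<in> Field r \<Longrightarrow> q x \<in> hom C (onOb F x) X"
    and "\<And>x y. (x, y) \<in> r \<Longrightarrow> q y \<cdot> onArr F (x, y) = q x"
  obtains h where "h \<in> hom C L X" "\<And>x. x \<in> Field r \<Longrightarrow> h \<cdot> t x = q x"
proof -
  have "is_cocone C (poset_category r) F X q" using assms(2-) by (simp add: is_cocone_poset)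
  with assms(1) have "\<exists>!h. h \<in> hom C L X \<and> (\<forall>x\<in>Field r. h \<cdot> t x = q x)"
    unfolding is_colimit_def by auto
  with that show ?thesis by blast
qed

lemma colimit_eqI:
  assumes L: "is_colimit C (poset_category r) F L t" and F: "is_functor (poset_category r) C F"
    and g: "g \<in> hom C L X" and h: "h \<in> hom C L X"
    and eq: "\<And>x. x \<in> Field r \<Longrightarrow> g \<cdot> t x = h \<cdot> t x"
  shows "g = h"
proof -
  have t: "\<And>x. x \<in> Field r \<Longrightarrow> t x \<in> hom C (onOb F x) L"
    "\<And>x y. (x, y) \<in> r \<Longrightarrow> t y \<cdot> onArr F (x, y) = t x"
    using L unfolding is_colimit_def is_cocone_poset by blast+
  have F': "\<And>x y. (x, y) \<in> r \<Longrightarrow> onArr F (x, y) \<in> hom C (onOb F x) (onOb F y)"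
    using F unfolding is_functor_poset by blast
  have "is_cocone C (poset_category r) F X (\<lambda>x. h \<cdot> t x)"
    unfolding is_cocone_poset
  proof (intro conjI ballI allI impI)
    show "X \<in> Ob C" using g by (rule Ob_of_hom)
    show "h \<cdot> t x \<in> hom C (onOb F x) X" if "x \<in> Field r" for x using Comp_in[OF t(1)[OF that] h] .
    show "(h \<cdot> t y) \<cdot> onArr F (x, y) = h \<cdot> t x" if "(x, y) \<in> r" for x y
      using Comp_assoc[OF F'[OF that] t(1) h] that t(2)[OF that] by (auto intro: FieldI2)
  qed
  then have "\<exists>!k. k \<in> hom C L X \<and> (\<forall>x\<in>Field r. k \<cdot> t x = h \<cdot> t x)"
    using L unfolding is_colimit_def by auto
  with g h eq show ?thesis by blast
qed

text \<open>A square against \<open>f\<close> is extended along \<open>r\<close> and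
  \<open>r'\<close> to one against \<open>g\<close>, and the lift found there is restricted along
  \<open>s'\<close>.\<close>

lemma has_lift_retract:
  assumes "is_retract C f g" "has_lift C g p" "p \<in> hom C E F"
  shows "has_lift C f p"
proof -
  obtain s r s' r' where f: "f \<in> hom C (Dom C f) (Cod C f)" and g: "g \<in> hom C (Dom C g) (Cod C g)"
    and s: "s \<in> hom C (Dom C f) (Dom C g)" and r: "r \<in> hom C (Dom C g) (Dom C f)"
    and s': "s' \<in> hom C (Cod C f) (Cod C g)" and r': "r' \<in> hom C (Cod C g) (Cod C f)"
    and eq: "r \<cdot> s = Idt C (Dom C f)" "r' \<cdot> s' = Idt C (Cod C f)"
      "g \<cdot> s = s' \<cdot> f" "f \<cdot> r = r' \<cdot> g"
    using assms(1) unfolding is_retract_def by (auto simp: hom_def)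
  show ?thesis
  proof (rule has_liftI[OF f assms(3)])
    fix u v assume u: "u \<in> hom C (Dom C f) E" and v: "v \<in> hom C (Cod C f) F" and uv: "p \<cdot> u = v \<cdot> f"
    have "p \<cdot> (u \<cdot> r) = (p \<cdot> u) \<cdot> r" using Comp_assoc[OF r u assms(3)] by simp
    also have "\<dots> = v \<cdot> (f \<cdot> r)" unfolding uv using Comp_assoc[OF r f v] .
    also have "\<dots> = (v \<cdot> r') \<cdot> g" unfolding eq using Comp_assoc[OF g r' v] by simp
    finally obtain h where h: "h \<in> hom C (Cod C g) E" "h \<cdot> g = u \<cdot> r" "p \<cdot> h = v \<cdot> r'"
      by (rule has_liftD[OF assms(2) g assms(3) Comp_in[OF r u] Comp_in[OF r' v]]) blast
    have "(h \<cdot> s') \<cdot> f = h \<cdot> (g \<cdot> s)" using Comp_assoc[OF f s' h(1)] eq by simp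
    also have "\<dots> = (u \<cdot> r) \<cdot> s" using Comp_assoc[OF s g h(1)] h(2) by simp
    also have "\<dots> = u" using Comp_assoc[OF s r u] eq u by simp
    finally have 1: "(h \<cdot> s') \<cdot> f = u" .
    have "p \<cdot> (h \<cdot> s') = (v \<cdot> r') \<cdot> s'" using Comp_assoc[OF s' h(1) assms(3)] h(3) by simp
    also have "\<dots> = v" using Comp_assoc[OF s' r' v] eq v by simp
    finally show "\<exists>h\<in>hom C (Cod C f) E. h \<cdot> f = u \<and> p \<cdot> h = v" using 1 Comp_in[OF s' h(1)] by blast
  qed
qed

lemma coproduct_eqI:
  assumes "is_coproduct C S A Q t" "g \<in> hom C Q Y" "h \<in> hom C Q Y" "\<And>s. s \<in> S \<Longrightarrow> g \<cdot> t s = h \<cdot> t s"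
  shows "g = h"
proof -
  have "\<forall>s\<in>S. h \<cdot> t s \<in> hom C (A s) Y"
    using assms(1) Comp_in[OF _ assms(3)] unfolding is_coproduct_def by blast
  then have "\<exists>!k. k \<in> hom C Q Y \<and> (\<forall>s\<in>S. k \<cdot> t s = h \<cdot> t s)"
    using assms(1) Ob_of_hom[OF assms(2)] unfolding is_coproduct_def by simp
  with assms(2-) show ?thesis by blast
qed

lemma coproduct_mediating:
  assumes "is_coproduct C S A Q t" "Y \<in> Ob C" "\<And>s. s \<in> S \<Longrightarrow> g s \<in> hom C (A s) Y"
  obtains h where "h \<in> hom C Q Y" "\<And>s. s \<in> S \<Longrightarrow> h \<cdot> t s = g s"
  using assms unfolding is_coproduct_def by metis

text \<open>Lifts are chosen on the summands and assembled; both triangles can be checked on the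
  summands, which detect equality of maps out of a coproduct.\<close>

lemma has_lift_coproduct:
  fixes U :: "'u itself"
  assumes "h \<in> coproducts_of_maps U C K" "K \<subseteq> Arr C" "\<And>k. k \<in> K \<Longrightarrow> has_lift C k p" "p \<in> hom C E F"
  shows "has_lift C h p"
proof -
  obtain S :: "'u set" and k P a Q b where k: "\<And>s. s \<in> S \<Longrightarrow> k s \<in> K"
    and P: "is_coproduct C S (\<lambda>s. Dom C (k s)) P a" and Q: "is_coproduct C S (\<lambda>s. Cod C (k s)) Q b"
    and h: "h \<in> hom C P Q" and eq: "\<And>s. s \<in> S \<Longrightarrow> h \<cdot> a s = b s \<cdot> k s"
    using assms(1) unfolding coproducts_of_maps_def by blast
  have a: "\<And>s. s \<in> S \<Longrightarrow> a s \<in> hom C (Dom C (k s)) P" and b: "\<And>s. s \<in> S \<Longrightarrow> b s \<in> hom C (Cod C (k s)) Q"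
    using P Q unfolding is_coproduct_def by blast+
  have kh: "\<And>s. s \<in> S \<Longrightarrow> k s \<in> hom C (Dom C (k s)) (Cod C (k s))" using k assms(2) by (auto simp: hom_def)
  show ?thesis
  proof (rule has_liftI[OF h assms(4)])
    fix u v assume u: "u \<in> hom C P E" and v: "v \<in> hom C Q F" and uv: "p \<cdot> u = v \<cdot> h"
    have "\<exists>l. l \<in> hom C (Cod C (k s)) E \<and> l \<cdot> k s = u \<cdot> a s \<and> p \<cdot> l = v \<cdot> b s" if s: "s \<in> S" for s
    proof -
      have "p \<cdot> (u \<cdot> a s) = (v \<cdot> b s) \<cdot> k s"
        using Comp_assoc[OF a[OF s] u assms(4)] Comp_assoc[OF a[OF s] h v] Comp_assoc[OF kh[OF s] b[OF s] v]
          uv eq[OF s] by simp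
      then show ?thesis
        by (rule has_liftD[OF assms(3)[OF k[OF s]] kh[OF s] assms(4) Comp_in[OF a[OF s] u] Comp_in[OF b[OF s] v]]) blast
    qed
    then obtain l where l: "\<And>s. s \<in> S \<Longrightarrow> l s \<in> hom C (Cod C (k s)) E"
      "\<And>s. s \<in> S \<Longrightarrow> l s \<cdot> k s = u \<cdot> a s" "\<And>s. s \<in> S \<Longrightarrow> p \<cdot> l s = v \<cdot> b s" by metis
    obtain m where m: "m \<in> hom C Q E" "\<And>s. s \<in> S \<Longrightarrow> m \<cdot> b s = l s"
      using coproduct_mediating[OF Q Ob_of_hom(2)[OF u] l(1)] by metis
    have "m \<cdot> h = u"
    proof (rule coproduct_eqI[OF P Comp_in[OF h m(1)] u])
      fix s assume s: "s \<in> S"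
      show "(m \<cdot> h) \<cdot> a s = u \<cdot> a s"
        using Comp_assoc[OF a[OF s] h m(1)] eq[OF s] Comp_assoc[OF kh[OF s] b[OF s] m(1)] m(2)[OF s] l(2)[OF s] by simp
    qed
    moreover have "p \<cdot> m = v"
    proof (rule coproduct_eqI[OF Q Comp_in[OF m(1) assms(4)] v])
      fix s assume s: "s \<in> S"
      show "(p \<cdot> m) \<cdot> b s = v \<cdot> b s"
        using Comp_assoc[OF b[OF s] m(1) assms(4)] m(2)[OF s] l(3)[OF s] by simp
    qed
    ultimately show "\<exists>l\<in>hom C Q E. l \<cdot> h = u \<and> p \<cdot> l = v" using m(1) by blast
  qed
qed

lemma pushoutD:
  assumes "is_pushout C f g i j"
  shows "f \<in> hom C (Dom C f) (Cod C f)" "g \<in> hom C (Dom C f) (Cod C g)" "i \<in> hom C (Cod C f) (Cod C i)"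
    "j \<in> hom C (Cod C g) (Cod C i)" "i \<cdot> f = j \<cdot> g"
  using assms unfolding is_pushout_def hom_def by auto

lemma pushout_mediating:
  assumes "is_pushout C f g i j" "x \<in> hom C (Cod C f) Y" "y \<in> hom C (Cod C g) Y" "x \<cdot> f = y \<cdot> g"
  obtains h where "h \<in> hom C (Cod C i) Y" "h \<cdot> i = x" "h \<cdot> j = y"
  using assms Ob_of_hom[OF assms(2)] unfolding is_pushout_def by metis

lemma pushout_eqI:
  assumes P: "is_pushout C f g i j" and h: "h \<in> hom C (Cod C i) Y" and k: "k \<in> hom C (Cod C i) Y"
    and eq: "h \<cdot> i = k \<cdot> i" "h \<cdot> j = k \<cdot> j"
  shows "h = k"
proof -
  note d = pushoutD[OF P]
  have "(k \<cdot> i) \<cdot> f = (k \<cdot> j) \<cdot> g"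
    using Comp_assoc[OF d(1) d(3) k] Comp_assoc[OF d(2) d(4) k] d(5) by simp
  then have "\<exists>!l. l \<in> hom C (Cod C i) Y \<and> l \<cdot> i = k \<cdot> i \<and> l \<cdot> j = k \<cdot> j"
    using P Ob_of_hom[OF h] Comp_in[OF d(3) k] Comp_in[OF d(4) k] unfolding is_pushout_def by blast
  with h k eq show ?thesis by blast
qed

text \<open>A lift for the composite square against \<open>k\<close> agrees with \<open>u\<close>
  over the corner and so glues with it over the pushout.\<close>

lemma has_lift_pushout:
  assumes P: "is_pushout C g k f g'" and k: "has_lift C k p" and p: "p \<in> hom C E F"
  shows "has_lift C f p"
proof (rule has_liftI[OF pushoutD(3)[OF P] p])
  note d = pushoutD[OF P]
  fix u v assume u: "u \<in> hom C (Cod C g) E" and v: "v \<in> hom C (Cod C f) F" and uv: "p \<cdot> u = v \<cdot> f"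
  have "p \<cdot> (u \<cdot> g) = (v \<cdot> g') \<cdot> k"
    using Comp_assoc[OF d(1) u p] Comp_assoc[OF d(1) d(3) v] Comp_assoc[OF d(2) d(4) v] uv d(5) by simp
  then obtain h where h: "h \<in> hom C (Cod C k) E" "h \<cdot> k = u \<cdot> g" "p \<cdot> h = v \<cdot> g'"
    by (rule has_liftD[OF k d(2) p Comp_in[OF d(1) u] Comp_in[OF d(4) v]]) blast
  obtain l where l: "l \<in> hom C (Cod C f) E" "l \<cdot> f = u" "l \<cdot> g' = h"
    using pushout_mediating[OF P u h(1)] h(2) by metis
  have "p \<cdot> l = v"
    by (rule pushout_eqI[OF P Comp_in[OF l(1) p] v])
      (use Comp_assoc[OF d(3) l(1) p] Comp_assoc[OF d(4) l(1) p] l uv h in simp_all)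
  with l show "\<exists>h\<in>hom C (Cod C f) E. h \<cdot> f = u \<and> p \<cdot> h = v" by blast
qed

text \<open>The lift is built stage by stage: \<open>u\<close> at the bottom, the hypothesis on
  steps at successors, and the colimit property at limits, where compatibility leaves no
  choice.\<close>

lemma has_lift_transfinite:
  assumes X: "transfinite_sequence C r X" and L: "is_colimit C (poset_category r) X L t"
    and b: "b \<in> Field r" "underS r b = {}" and p: "p \<in> hom C E F"
    and step: "\<And>x y. succ_in r x y \<Longrightarrow> has_lift C (onArr X (x, y)) p"
  shows "has_lift C (t b) p"
proof -
  have r: "Well_order r" and F: "is_functor (poset_category r) C X"
    and lim: "\<And>y. limit_in r y \<Longrightarrow>
        is_colimit C (poset_category (Restr r (underS r y))) X (onOb X y) (\<lambda>x. onArr X (x, y))"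
    using X unfolding transfinite_sequence_def by auto
  have Xa: "\<And>x y. (x, y) \<in> r \<Longrightarrow> onArr X (x, y) \<in> hom C (onOb X x) (onOb X y)"
    and Xi: "\<And>x. x \<in> Field r \<Longrightarrow> onArr X (x, x) = Idt C (onOb X x)"
    and Xc: "\<And>x y z. (x, y) \<in> r \<Longrightarrow> (y, z) \<in> r \<Longrightarrow> onArr X (x, z) = onArr X (y, z) \<cdot> onArr X (x, y)"
    using F unfolding is_functor_poset by blast+
  have t: "\<And>x. x \<in> Field r \<Longrightarrow> t x \<in> hom C (onOb X x) L"
    "\<And>x y. (x, y) \<in> r \<Longrightarrow> t y \<cdot> onArr X (x, y) = t x"
    using L unfolding is_colimit_def is_cocone_poset by blast+
  note wo = well_order_simps[OF r] and uF = underS_Field[OF r]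
  show ?thesis
  proof (rule has_liftI[OF t(1)[OF b(1)] p])
    fix u v assume u: "u \<in> hom C (onOb X b) E" and v: "v \<in> hom C L F" and uv: "p \<cdot> u = v \<cdot> t b"
    \<comment> \<open>\<open>P h y g\<close> says that \<open>g\<close> is an admissible value at
      stage \<open>y\<close> once \<open>h\<close> has been chosen below it. Compatibility with all
      earlier values is included because limit stages need a cocone.\<close>
    define P where "P = (\<lambda>h y g. y \<in> Field r \<longrightarrow> g \<in> hom C (onOb X y) E \<and> p \<cdot> g = v \<cdot> t y \<and>
      (\<forall>z\<in>underS r y. g \<cdot> onArr X (z, y) = h z) \<and> (y = b \<longrightarrow> g = u))"
    have "\<exists>h. \<forall>y. P h y (h y)"
    proof (rule dependent_wf_choice[OF wo(5)])
      \<comment> \<open>Admissibility looks only at earlier choices; under this condition choices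
        can be made along a well-founded order.\<close>
      show "P f x g = P f' x g" if "\<And>z. (z, x) \<in> r - Id \<Longrightarrow> f z = f' z" for f f' x g
        using that unfolding P_def underS_def by auto
      fix y h assume "\<And>z. (z, y) \<in> r - Id \<Longrightarrow> P h z (h z)"
      then have h: "\<And>z. z \<in> underS r y \<Longrightarrow> h z \<in> hom C (onOb X z) E"
          "\<And>z. z \<in> underS r y \<Longrightarrow> p \<cdot> h z = v \<cdot> t z"
          "\<And>z w. z \<in> underS r y \<Longrightarrow> w \<in> underS r z \<Longrightarrow> h z \<cdot> onArr X (w, z) = h w"
        using uF unfolding P_def underS_def by blast+
      have hle: "h x \<cdot> onArr X (z, x) = h z" if "x \<in> underS r y" "(z, x) \<in> r" for x z
        using that h(3) Xi[of x] uF[of x y] le_iff_underS[OF r] Comp_Idt[OF h(1)[OF that(1)]]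
        by (cases "z = x") auto
      show "\<exists>g. P h y g"
      proof (cases "y \<in> Field r")
        case False
        then show ?thesis by (simp add: P_def)
      next
        case y: True
        then show ?thesis
        proof (cases rule: well_order_cases)
          case 1
          then have "y = b" using least_unique[OF r b y] by simp
          with u uv b(2) have "P h y u" by (simp add: P_def)
          then show ?thesis ..
        next
          case (2 x)
          then have xy: "x \<in> underS r y" "(x, y) \<in> r" using uF unfolding succ_in_def by blast+
          have "p \<cdot> h x = (v \<cdot> t y) \<cdot> onArr X (x, y)"
            using h(2)[OF xy(1)] t(2)[OF xy(2)] Comp_assoc[OF Xa[OF xy(2)] t(1)[OF y] v] by simp
          then obtain g where g: "g \<in> hom C (onOb X y) E" "g \<cdot> onArr X (x, y) = h x" "p \<cdot> g = v \<cdot> t y"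
            by (rule has_liftD[OF step[OF 2] Xa[OF xy(2)] p h(1)[OF xy(1)] Comp_in[OF t(1)[OF y] v]]) blast
          have "g \<cdot> onArr X (z, y) = h z" if z: "z \<in> underS r y" for z
          proof -
            have zx: "(z, x) \<in> r" using 2 z unfolding succ_in_def by blast
            then show ?thesis
              using Xc[OF zx xy(2)] Comp_assoc[OF Xa[OF zx] Xa[OF xy(2)] g(1)] g(2) hle[OF xy(1) zx] by simp
          qed
          with g xy(1) b have "P h y g" unfolding P_def by blast
          then show ?thesis ..
        next
          case 3
          have Fr: "Field (Restr r (underS r y)) = underS r y" by (rule Field_Restr_underS[OF r])
          obtain g where g: "g \<in> hom C (onOb X y) E" "\<And>z. z \<in> underS r y \<Longrightarrow> g \<cdot> onArr X (z, y) = h z"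
            using colimit_mediating[OF lim[OF 3] Ob_of_hom(1)[OF p], of h] h(1) hle unfolding Fr by auto
          have "p \<cdot> g = v \<cdot> t y"
          proof (rule colimit_eqI[OF lim[OF 3] _ Comp_in[OF g(1) p] Comp_in[OF t(1)[OF y] v]], goal_cases)
            case 1
            show ?case using F Fr uF unfolding is_functor_poset by blast
          next
            case (2 z)
            then have z: "z \<in> underS r y" "(z, y) \<in> r" using uF unfolding Fr by blast+
            show ?case
              using Comp_assoc[OF Xa[OF z(2)] g(1) p] Comp_assoc[OF Xa[OF z(2)] t(1)[OF y] v]
                t(2)[OF z(2)] h(2)[OF z(1)] g(2)[OF z(1)] by simp
          qed
          moreover have "y \<noteq> b" using 3 b(2) unfolding limit_in_def by auto
          ultimately have "P h y g" using g by (simp add: P_def)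
          then show ?thesis ..
        qed
      qed
    qed
    then obtain h where h: "\<And>y. P h y (h y)" by blast
    have hle: "h y \<cdot> onArr X (z, y) = h z" if "(z, y) \<in> r" for y z
      using that h[of y] Xi[of y] FieldI2[OF that] unfolding le_iff_underS[OF r] P_def by auto
    obtain l where l: "l \<in> hom C L E" "\<And>x. x \<in> Field r \<Longrightarrow> l \<cdot> t x = h x"
      using colimit_mediating[OF L Ob_of_hom(1)[OF p], of h] h hle unfolding P_def by metis
    have "p \<cdot> l = v"
    proof (rule colimit_eqI[OF L F Comp_in[OF l(1) p] v])
      fix x assume x: "x \<in> Field r"
      show "(p \<cdot> l) \<cdot> t x = v \<cdot> t x"
        using Comp_assoc[OF t(1)[OF x] l(1) p] l(2)[OF x] h[of x] x unfolding P_def by simp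
    qed
    moreover have "l \<cdot> t b = u" using l(2)[OF b(1)] h[of b] b(1) unfolding P_def by simp
    ultimately show "\<exists>h\<in>hom C L E. h \<cdot> t b = u \<and> p \<cdot> h = v" using l(1) by blast
  qed
qed

lemma has_lift_cof:
  fixes U :: "'u itself"
  assumes "i \<in> cof U C K" "p \<in> rlp C K" "K \<subseteq> Arr C"
  shows "has_lift C i p"
proof -
  have p: "p \<in> hom C (Dom C p) (Cod C p)" "\<And>k. k \<in> K \<Longrightarrow> has_lift C k p"
    using assms(2) unfolding rlp_def by (auto simp: hom_def)
  obtain g where g: "g \<in> cell U C K" "is_retract C i g" using assms(1) unfolding cof_def by blast
  from g(1) obtain r :: "'u rel" and X L t b where r: "transfinite_sequence C r X"
      "steps_in r X (pushouts_of_maps C (coproducts_of_maps U C K))"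
      "is_colimit C (poset_category r) X L t" "b \<in> Field r" "underS r b = {}" "g = t b"
    unfolding cell_def transfinite_compositions_def by blast
  have "has_lift C (t b) p"
  proof (rule has_lift_transfinite[OF r(1,3,4,5) p(1)])
    fix x y assume "succ_in r x y"
    then obtain k g g' where "k \<in> coproducts_of_maps U C K" "is_pushout C g k (onArr X (x, y)) g'"
      using r(2) unfolding steps_in_def pushouts_of_maps_def by blast
    then show "has_lift C (onArr X (x, y)) p"
      using has_lift_pushout[OF _ has_lift_coproduct[OF _ assms(3) p(2) p(1)] p(1)] by blast
  qed
  with g(2) r(6) p(1) show ?thesis by (blast intro: has_lift_retract)
qed

lemma rlp_retract:
  assumes "is_retract C f g" "g \<in> rlp C K" "K \<subseteq> Arr C"
  shows "f \<in> rlp C K"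
proof -
  obtain s r s' r' where f: "f \<in> hom C (Dom C f) (Cod C f)" and g: "g \<in> hom C (Dom C g) (Cod C g)"
    and s: "s \<in> hom C (Dom C f) (Dom C g)" and r: "r \<in> hom C (Dom C g) (Dom C f)"
    and s': "s' \<in> hom C (Cod C f) (Cod C g)" and r': "r' \<in> hom C (Cod C g) (Cod C f)"
    and eq: "r \<cdot> s = Idt C (Dom C f)" "r' \<cdot> s' = Idt C (Cod C f)" "g \<cdot> s = s' \<cdot> f" "f \<cdot> r = r' \<cdot> g"
    using assms(1) unfolding is_retract_def by (auto simp: hom_def)
  have "has_lift C k f" if k: "k \<in> K" for k
  proof -
    have kh: "k \<in> hom C (Dom C k) (Cod C k)" using k assms(3) by (auto simp: hom_def)
    show ?thesis
    proof (rule has_liftI[OF kh f])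
      fix u v assume u: "u \<in> hom C (Dom C k) (Dom C f)" and v: "v \<in> hom C (Cod C k) (Cod C f)" and uv: "f \<cdot> u = v \<cdot> k"
      have "g \<cdot> (s \<cdot> u) = (s' \<cdot> v) \<cdot> k"
        using Comp_assoc[OF u s g] Comp_assoc[OF u f s'] Comp_assoc[OF kh v s'] uv eq(3) by simp
      then obtain h where h: "h \<in> hom C (Cod C k) (Dom C g)" "h \<cdot> k = s \<cdot> u" "g \<cdot> h = s' \<cdot> v"
        using has_liftD[OF _ kh g Comp_in[OF u s] Comp_in[OF v s']] k assms(2) unfolding rlp_def by blast
      have "(r \<cdot> h) \<cdot> k = u" using Comp_assoc[OF kh h(1) r] h(2) Comp_assoc[OF u s r] eq(1) u by simp
      moreover have "f \<cdot> (r \<cdot> h) = v"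
        using Comp_assoc[OF h(1) r f] Comp_assoc[OF h(1) g r'] h(3) eq(4) Comp_assoc[OF v s' r'] eq(2) v by simp
      ultimately show "\<exists>h\<in>hom C (Cod C k) (Dom C f). h \<cdot> k = u \<and> f \<cdot> h = v" using Comp_in[OF h(1) r] by blast
    qed
  qed
  with in_hom(1)[OF f] show ?thesis unfolding rlp_def by blast
qed

text \<open>The retract argument: the square with \<open>i\<close> on top and the identity at the
  bottom has a diagonal, which is a section of \<open>p\<close> and carries
  \<open>p \<cdot> i\<close> to \<open>i\<close>.\<close>

lemma retract_of_factorization:
  assumes i: "i \<in> hom C A Z" and p: "p \<in> hom C Z B" and l: "has_lift C (p \<cdot> i) p"
  shows "is_retract C (p \<cdot> i) i"
proof -
  have f: "p \<cdot> i \<in> hom C A B" using i p by (rule Comp_in)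
  note ob = Ob_of_hom[OF i] Ob_of_hom[OF p]
  obtain h where h: "h \<in> hom C B Z" "h \<cdot> (p \<cdot> i) = i" "p \<cdot> h = Idt C B"
    by (rule has_liftD[OF l f p i Idt_in[OF ob(4)]]) (use f in simp_all)
  show ?thesis
    unfolding is_retract_def in_hom[OF i] in_hom[OF f]
  proof (intro conjI bexI)
    show "Idt C A \<cdot> Idt C A = Idt C A" "Idt C A \<in> hom C A A" using ob by (simp_all add: Idt_in)
    show "p \<cdot> h = Idt C B" "h \<in> hom C B Z" "p \<in> hom C Z B" by fact+
    show "i \<cdot> Idt C A = h \<cdot> (p \<cdot> i)" using i h by simp
    show "(p \<cdot> i) \<cdot> Idt C A = p \<cdot> i" using f by simp
  qed (use i f ob in \<open>simp_all add: in_hom Idt_in\<close>)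
qed

end

section \<open>The small object argument\<close>

text \<open>What a single stage of the small object argument achieves: squares against
  \<open>f\<close> acquire diagonals only after the old object is mapped by \<open>s\<close> into
  the new one.\<close>

definition solves_lifting :: "('o, 'm) category \<Rightarrow> 'm set \<Rightarrow> 'm \<Rightarrow> 'm \<Rightarrow> 'm \<Rightarrow> bool" where
  "solves_lifting C K f s p \<longleftrightarrow>
     (\<forall>k\<in>K. \<forall>u\<in>hom C (Dom C k) (Dom C f). \<forall>v\<in>hom C (Cod C k) (Cod C f).
        f \<cdot>\<^bsub>C\<^esub> u = v \<cdot>\<^bsub>C\<^esub> k \<longrightarrow>
        (\<exists>w\<in>hom C (Cod C k) (Dom C p). w \<cdot>\<^bsub>C\<^esub> k = s \<cdot>\<^bsub>C\<^esub> u \<and> p \<cdot>\<^bsub>C\<^esub> w = v))"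

lemma solves_liftingD:
  assumes "solves_lifting C K f s p" "k \<in> K" "f \<in> hom C X Y" "p \<in> hom C Z Y"
    "u \<in> hom C (Dom C k) X" "v \<in> hom C (Cod C k) Y" "f \<cdot>\<^bsub>C\<^esub> u = v \<cdot>\<^bsub>C\<^esub> k"
  obtains w where "w \<in> hom C (Cod C k) Z" "w \<cdot>\<^bsub>C\<^esub> k = s \<cdot>\<^bsub>C\<^esub> u" "p \<cdot>\<^bsub>C\<^esub> w = v"
proof -
  have "Dom C f = X" "Cod C f = Y" "Dom C p = Z" using assms(3,4) by (simp_all add: hom_def)
  with assms that show ?thesis unfolding solves_lifting_def by blast
qed

context bicomplete_category
begin

text \<open>One cell is attached for every commuting square from a generator to \<open>f\<close>,
  all simultaneously, so that each of these squares has a diagonal in the new object.\<close>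

lemma one_step:
  fixes k :: "nat \<Rightarrow> 'b"
  assumes K: "K = range k" "K \<subseteq> Arr C" and ls: "locally_small U C" and f: "f \<in> hom C X Y"
  obtains Z s p where "s \<in> pushouts_of_maps C (coproducts_of_maps U C K)" "s \<in> hom C X Z" "p \<in> hom C Z Y"
    "p \<cdot> s = f" "solves_lifting C K f s p"
proof -
  have k: "k n \<in> hom C (Dom C (k n)) (Cod C (k n))" for n using K by (auto simp: hom_def)
  note obk = Ob_of_hom[OF k] and ob = Ob_of_hom[OF f]
  \<comment> \<open>Countably many generators and small hom sets make the set of squares
    small.\<close>
  define Sq where "Sq = {(n, u, v). u \<in> hom C (Dom C (k n)) X \<and> v \<in> hom C (Cod C (k n)) Y \<and> f \<cdot> u = v \<cdot> k n}"
  have "Sq \<subseteq> (SIGMA n : UNIV. hom C (Dom C (k n)) X \<times> hom C (Cod C (k n)) Y)" unfolding Sq_def by auto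
  then have "small U Sq"
    by (rule small_subset) 
      (intro small_Sigma_nat[OF universe] small_Times[OF universe], use ls obk ob in \<open>auto simp: locally_small_def\<close>)
  then obtain e :: "nat \<times> 'b \<times> 'b \<Rightarrow> 'u" where e: "inj_on e Sq" "small U (e ` Sq)"
    by (rule small_copy) blast
  define S where "S = e ` Sq"
  define nn where "nn = (\<lambda>s. fst (inv_into Sq e s))"
  define uu where "uu = (\<lambda>s. fst (snd (inv_into Sq e s)))"
  define vv where "vv = (\<lambda>s. snd (snd (inv_into Sq e s)))"
  have sq: "uu s \<in> hom C (Dom C (k (nn s))) X" "vv s \<in> hom C (Cod C (k (nn s))) Y" "f \<cdot> uu s = vv s \<cdot> k (nn s)"
    if "s \<in> S" for s
    using inv_into_into[of s e Sq] that unfolding S_def Sq_def nn_def uu_def vv_def by (auto simp: case_prod_beta)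
  obtain P a where P: "is_coproduct C S (\<lambda>s. Dom C (k (nn s))) P a"
    using coproduct_exists[of S "\<lambda>s. Dom C (k (nn s))"] e(2) obk unfolding S_def by blast
  obtain Q b where Q: "is_coproduct C S (\<lambda>s. Cod C (k (nn s))) Q b"
    using coproduct_exists[of S "\<lambda>s. Cod C (k (nn s))"] e(2) obk unfolding S_def by blast
  have a: "\<And>s. s \<in> S \<Longrightarrow> a s \<in> hom C (Dom C (k (nn s))) P" and b: "\<And>s. s \<in> S \<Longrightarrow> b s \<in> hom C (Cod C (k (nn s))) Q"
    and PQ: "P \<in> Ob C" "Q \<in> Ob C"
    using P Q unfolding is_coproduct_def by blast+
  obtain h where h: "h \<in> hom C P Q" "\<And>s. s \<in> S \<Longrightarrow> h \<cdot> a s = b s \<cdot> k (nn s)"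
    using coproduct_mediating[OF P PQ(2), of "\<lambda>s. b s \<cdot> k (nn s)"] Comp_in[OF k b] by blast
  obtain \<phi> where \<phi>: "\<phi> \<in> hom C P X" "\<And>s. s \<in> S \<Longrightarrow> \<phi> \<cdot> a s = uu s"
    using coproduct_mediating[OF P ob(1), of uu] sq(1) by blast
  obtain \<psi> where \<psi>: "\<psi> \<in> hom C Q Y" "\<And>s. s \<in> S \<Longrightarrow> \<psi> \<cdot> b s = vv s"
    using coproduct_mediating[OF Q ob(2), of vv] sq(2) by blast
  obtain Z s g where Z: "is_pushout C \<phi> h s g" and s: "s \<in> hom C X Z" and g: "g \<in> hom C Q Z"
    using pushout_exists[OF \<phi>(1) h(1)] by blast
  have "f \<cdot> \<phi> = \<psi> \<cdot> h"
  proof (rule coproduct_eqI[OF P Comp_in[OF \<phi>(1) f] Comp_in[OF h(1) \<psi>(1)]])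
    fix i assume i: "i \<in> S"
    show "(f \<cdot> \<phi>) \<cdot> a i = (\<psi> \<cdot> h) \<cdot> a i"
      using Comp_assoc[OF a[OF i] \<phi>(1) f] Comp_assoc[OF a[OF i] h(1) \<psi>(1)] Comp_assoc[OF k b[OF i] \<psi>(1)]
        \<phi>(2)[OF i] \<psi>(2)[OF i] h(2)[OF i] sq(3)[OF i] by simp
  qed
  then obtain p where p: "p \<in> hom C Z Y" "p \<cdot> s = f" "p \<cdot> g = \<psi>"
    using pushout_mediating[OF Z, of f Y \<psi>] f \<psi>(1) in_hom[OF \<phi>(1)] in_hom[OF h(1)] in_hom[OF s] by auto
  have "h \<in> coproducts_of_maps U C K"
    unfolding coproducts_of_maps_def mem_Collect_eq
    by (rule exI[of _ S], rule exI[of _ "\<lambda>s. k (nn s)"], rule exI[of _ P], rule exI[of _ a], rule exI[of _ Q], rule exI[of _ b])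
      (use P Q h e(2) K in \<open>auto simp: S_def\<close>)
  then have "s \<in> pushouts_of_maps C (coproducts_of_maps U C K)"
    using Z unfolding pushouts_of_maps_def by blast
  moreover have "solves_lifting C K f s p"
    unfolding solves_lifting_def
  proof (intro ballI impI)
    fix k' u v assume k': "k' \<in> K" and "u \<in> hom C (Dom C k') (Dom C f)" "v \<in> hom C (Cod C k') (Cod C f)" "f \<cdot> u = v \<cdot> k'"
    then obtain n where n: "k' = k n" and "(n, u, v) \<in> Sq" unfolding K(1) Sq_def in_hom[OF f] by auto
    then have i: "e (n, u, v) \<in> S" and inv: "inv_into Sq e (e (n, u, v)) = (n, u, v)" using e(1) by (auto simp: S_def)
    define i where "i = e (n, u, v)"
    have i: "i \<in> S" "nn i = n" "uu i = u" "vv i = v" using i inv by (simp_all add: i_def nn_def uu_def vv_def)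
    have bi: "b i \<in> hom C (Cod C (k n)) Q" and ai: "a i \<in> hom C (Dom C (k n)) P" using a[OF i(1)] b[OF i(1)] i by auto
    \<comment> \<open>The diagonal is \<open>g \<cdot> b i\<close>, the cell attached along this
      very square.\<close>
    have "(g \<cdot> b i) \<cdot> k n = g \<cdot> (h \<cdot> a i)" using Comp_assoc[OF k bi g] h(2)[OF i(1)] i by simp
    also have "\<dots> = (s \<cdot> \<phi>) \<cdot> a i" using Comp_assoc[OF ai h(1) g] pushoutD(5)[OF Z] by simp
    also have "\<dots> = s \<cdot> u" using Comp_assoc[OF ai \<phi>(1) s] \<phi>(2)[OF i(1)] i by simp
    finally have "(g \<cdot> b i) \<cdot> k' = s \<cdot> u" using n by simp
    moreover have "p \<cdot> (g \<cdot> b i) = v" using Comp_assoc[OF bi g p(1)] p(3) \<psi>(2)[OF i(1)] i by simp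
    ultimately show "\<exists>w\<in>hom C (Cod C k') (Dom C p). w \<cdot> k' = s \<cdot> u \<and> p \<cdot> w = v"
      using Comp_in[OF bi g] in_hom[OF p(1)] n by auto
  qed
  ultimately show ?thesis using s p that by blast
qed

text \<open>Smallness is assumed relative to \<open>cell\<close>, while the steps of the
  construction are single pushouts; a two-stage sequence exhibits each of them as a member of
  \<open>cell\<close>.\<close>

lemma step_in_transfinite_compositions:
  assumes f: "f \<in> hom C A B" and D: "f \<in> D"
  shows "f \<in> transfinite_compositions U C D"
proof -
  note ob = Ob_of_hom[OF f]
  obtain a :: 'u where True by blast
  \<comment> \<open>A second index exists because the universe is infinite.\<close>
  obtain b :: 'u where ab: "b \<noteq> a"
    using infinite_universe[OF universe] by (metis (full_types) UNIV_I ex_new_if_finite finite.emptyI finite_insert singleton_iff)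
  define r where "r = {(a, a), (b, b), (a, b)}"
  have Fr: "Field r = {a, b}" by (auto simp: r_def Field_def)
  have un: "underS r a = {}" "underS r b = {a}" using ab by (auto simp: r_def underS_def)
  define X where "X = \<lparr>onOb = (\<lambda>x. if x = a then A else B),
    onArr = (\<lambda>(x, y). if x = y then Idt C (if x = a then A else B) else f)\<rparr>"
  have "Well_order r"
    unfolding well_order_on_def linear_order_on_def partial_order_on_def preorder_on_def Fr
    using ab by (auto simp: r_def refl_on_def trans_def antisym_def total_on_def intro!: finite_acyclic_wf)
      (auto simp: acyclic_def dest: tranclD tranclD2)
  moreover have F: "is_functor (poset_category r) C X"
    using f ob ab by (auto simp: is_functor_poset Fr) (auto simp: r_def X_def Idt_in)
  moreover have succ: "succ_in r x y \<longleftrightarrow> x = a \<and> y = b" for x y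
    using ab un by (auto simp: succ_in_def r_def underS_def)
  moreover have "\<not> limit_in r y" for y using un succ unfolding limit_in_def Fr by auto
  ultimately have X: "transfinite_sequence C r X" unfolding transfinite_sequence_def Fr by auto
  \<comment> \<open>The second stage is the last one and therefore the colimit.\<close>
  define t where "t = (\<lambda>x. if x = a then f else Idt C B)"
  have cc: "is_cocone C (poset_category r) X Y q \<longleftrightarrow> q b \<in> hom C B Y \<and> q a = q b \<cdot> f" for Y q
    using ab f ob Ob_of_hom[of "q b" B Y] Comp_Idt[OF Comp_in[OF f, of "q b" Y]] unfolding is_cocone_poset Fr
    by (auto simp: r_def X_def intro: Comp_in)
  have "is_colimit C (poset_category r) X B t"
    unfolding is_colimit_def
  proof (intro conjI allI impI)
    show "is_cocone C (poset_category r) X B t" unfolding cc using f ob ab by (simp add: t_def Idt_in)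
    fix Y q assume "is_cocone C (poset_category r) X Y q"
    then show "\<exists>!h. h \<in> hom C B Y \<and> (\<forall>j\<in>Ob (poset_category r). h \<cdot> t j = q j)"
      unfolding cc using ab by (intro ex1I[of _ "q b"]) (auto simp: Fr t_def)
  qed
  moreover have "steps_in r X D" unfolding steps_in_def succ using D ab by (simp add: X_def)
  moreover have "small U (Field r)" unfolding Fr by (rule small_finite[OF universe]) simp
  moreover have "f = t a" "a \<in> Field r" by (simp_all add: t_def Fr)
  ultimately show ?thesis using X un(1) unfolding transfinite_compositions_def by blast
qed

text \<open>The diagram is the one assembled by the recursion below \<open>y\<close>; changing the
  recursion at other stages does not affect its colimits.\<close>

lemma colimit_eq_restrict:
  assumes r: "Well_order r" and eq: "\<And>z. z \<in> underS r y \<Longrightarrow> s z = s' z" "\<And>z. z \<in> underS r y \<Longrightarrow> t z = t' z"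
  shows "is_colimit C (poset_category (Restr r (underS r y))) \<lparr>onOb = fst \<circ> s, onArr = (\<lambda>(z, w). snd (snd (s w)) z)\<rparr> L t \<longleftrightarrow>
    is_colimit C (poset_category (Restr r (underS r y))) \<lparr>onOb = fst \<circ> s', onArr = (\<lambda>(z, w). snd (snd (s' w)) z)\<rparr> L t'"
proof (rule is_colimit_cong)
  show "category (poset_category (Restr r (underS r y)))"
    using well_order_simps(1,2)[OF r] underS_Field[OF r]
    by (intro category_poset) (auto simp: Field_Restr_underS[OF r] trans_Restr)
qed (use eq in \<open>auto simp: Field_Restr_underS[OF r]\<close>)

text \<open>\<open>one_step\<close> is iterated along \<open>r\<close>, with colimits at limit
  stages. Every stage keeps its map to \<open>Y\<close>, because the lifting problems to be solved
  next are those of that map.\<close>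

lemma iterated_steps:
  fixes k :: "nat \<Rightarrow> 'b" and r :: "'u rel"
  assumes K: "K = range k" "K \<subseteq> Arr C" and ls: "locally_small U C" and f: "f \<in> hom C X0 Y"
    and r: "Well_order r" "small U (Field r)" and b: "b \<in> Field r" "underS r b = {}"
  obtains X p where "transfinite_sequence C r X" "steps_in r X (pushouts_of_maps C (coproducts_of_maps U C K))"
    "\<And>y. y \<in> Field r \<Longrightarrow> p y \<in> hom C (onOb X y) Y"
    "\<And>x y. (x, y) \<in> r \<Longrightarrow> p y \<cdot> onArr X (x, y) = p x"
    "\<And>x y. succ_in r x y \<Longrightarrow> solves_lifting C K (p x) (onArr X (x, y)) (p y)"
    "onOb X b = X0" "p b = f"
proof -
  note wo = well_order_simps[OF r(1)] and uF = underS_Field[OF r(1)]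
  \<comment> \<open>The recursion yields at each stage an object, its map to \<open>Y\<close>, and the transition maps into it from earlier stages.\<close>
  define ob :: "('a \<times> 'b \<times> ('u \<Rightarrow> 'b)) \<Rightarrow> 'a" where "ob = fst"
  define pr :: "('a \<times> 'b \<times> ('u \<Rightarrow> 'b)) \<Rightarrow> 'b" where "pr = fst \<circ> snd"
  define al :: "('a \<times> 'b \<times> ('u \<Rightarrow> 'b)) \<Rightarrow> 'u \<Rightarrow> 'b" where "al = snd \<circ> snd"
  define D :: "('u \<Rightarrow> 'a \<times> 'b \<times> ('u \<Rightarrow> 'b)) \<Rightarrow> ('u, 'u \<times> 'u, 'a, 'b) ftor"
    where "D = (\<lambda>s. \<lparr>onOb = fst \<circ> s, onArr = (\<lambda>(z, w). snd (snd (s w)) z)\<rparr>)"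
  have D_simps: "onOb (D s) z = ob (s z)" "onArr (D s) (z, w) = al (s w) z" for s z w
    by (simp_all add: D_def ob_def al_def)
  \<comment> \<open>\<open>G\<close> holds what all stages share, functoriality and compatibility
    over \<open>Y\<close>; \<open>P\<close> adds the clause for the kind of stage that
    \<open>y\<close> is.\<close>
  define G where "G = (\<lambda>s y v. ob v \<in> Ob C \<and> pr v \<in> hom C (ob v) Y \<and> al v y = Idt C (ob v) \<and>
    (\<forall>z\<in>underS r y. al v z \<in> hom C (ob (s z)) (ob v) \<and> pr v \<cdot> al v z = pr (s z) \<and>
       (\<forall>w\<in>underS r z. al v w = al v z \<cdot> al (s z) w)))"
  define P where "P = (\<lambda>s y v. y \<in> Field r \<longrightarrow> G s y v \<and>
    (y = b \<longrightarrow> ob v = X0 \<and> pr v = f) \<and>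
    (\<forall>x. succ_in r x y \<longrightarrow> al v x \<in> pushouts_of_maps C (coproducts_of_maps U C K) \<and>
       solves_lifting C K (pr (s x)) (al v x) (pr v)) \<and>
    (limit_in r y \<longrightarrow> is_colimit C (poset_category (Restr r (underS r y))) (D s) (ob v) (al v)))"
  have "\<exists>s. \<forall>y. P s y (s y)"
  proof (rule dependent_wf_choice[OF wo(5)])
    fix s s' :: "'u \<Rightarrow> 'a \<times> 'b \<times> ('u \<Rightarrow> 'b)" and y v assume eq: "\<And>z. (z, y) \<in> r - Id \<Longrightarrow> s z = s' z"
    then have eq': "\<And>z. z \<in> underS r y \<Longrightarrow> s z = s' z" unfolding underS_def by blast
    have "G s y v = G s' y v" unfolding G_def using eq' by auto
    moreover have "is_colimit C (poset_category (Restr r (underS r y))) (D s) L t =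
        is_colimit C (poset_category (Restr r (underS r y))) (D s') L t" for L t
      unfolding D_def by (rule colimit_eq_restrict[OF r(1) eq']) auto
    moreover have "succ_in r x y \<Longrightarrow> s x = s' x" for x using eq' unfolding succ_in_def by blast
    ultimately show "P s y v = P s' y v" unfolding P_def by auto
  next
    fix y and s :: "'u \<Rightarrow> 'a \<times> 'b \<times> ('u \<Rightarrow> 'b)" assume "\<And>z. (z, y) \<in> r - Id \<Longrightarrow> P s z (s z)"
    then have G: "G s z (s z)" if "z \<in> underS r y" for z
      using that uF[OF that] unfolding P_def underS_def by blast
    have s: "ob (s z) \<in> Ob C" "pr (s z) \<in> hom C (ob (s z)) Y" "al (s z) z = Idt C (ob (s z))" if "z \<in> underS r y" for z
      using G[OF that] unfolding G_def by auto
    have s_le: "al (s z) w \<in> hom C (ob (s w)) (ob (s z))" "pr (s z) \<cdot> al (s z) w = pr (s w)"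
      if "z \<in> underS r y" "(w, z) \<in> r" for w z
    proof -
      have "w = z \<or> w \<in> underS r z" using that(2) le_iff_underS[OF r(1)] by blast
      then show "al (s z) w \<in> hom C (ob (s w)) (ob (s z))" "pr (s z) \<cdot> al (s z) w = pr (s w)"
        using G[OF that(1)] s[OF that(1)] unfolding G_def by (auto simp: Idt_in)
    qed
    have s_comp: "al (s z) w = al (s z) x \<cdot> al (s x) w" if z: "z \<in> underS r y" and xz: "(x, z) \<in> r" and wx: "(w, x) \<in> r" for w x z
    proof -
      have x: "x \<in> underS r y" using underS_trans(2)[OF r(1) xz z] .
      show ?thesis
      proof (cases "w = x \<or> x = z")
        case True
        then show ?thesis using s(3)[OF x] s(3)[OF z] s_le(1)[OF z xz] s_le(1)[OF x wx] by auto
      next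
        case False
        then show ?thesis using G[OF z] xz wx unfolding G_def le_iff_underS[OF r(1)] by blast
      qed
    qed
    show "\<exists>v. P s y v"
    proof (cases "y \<in> Field r")
      case False
      then show ?thesis by (simp add: P_def)
    next
      case y: True
      then show ?thesis
      proof (cases rule: well_order_cases)
        case 1
        then have "y = b" using least_unique[OF r(1) b y] by simp
        moreover have "\<not> succ_in r x b" "\<not> limit_in r b" for x using b(2) by (auto simp: succ_in_def limit_in_def)
        ultimately have "P s y (X0, f, \<lambda>_. Idt C X0)"
          using b f Ob_of_hom[OF f] unfolding P_def G_def by (simp add: ob_def pr_def al_def)
        then show ?thesis ..
      next
        case (2 x)
        then have x: "x \<in> underS r y" and zx: "\<And>z. z \<in> underS r y \<Longrightarrow> (z, x) \<in> r" unfolding succ_in_def by blast+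
        obtain Z st p where st: "st \<in> pushouts_of_maps C (coproducts_of_maps U C K)" "st \<in> hom C (ob (s x)) Z"
          and p: "p \<in> hom C Z Y" "p \<cdot> st = pr (s x)" and sol: "solves_lifting C K (pr (s x)) st p"
          by (rule one_step[OF K ls s(2)[OF x]]) blast
        \<comment> \<open>At \<open>y\<close> itself the value must be the identity, as the
          reflexive arrows of the poset belong to the diagram; older stages reach \<open>Z\<close>
          through \<open>x\<close>.\<close>
        define v where "v = (Z, p, \<lambda>z. if z = y then Idt C Z else st \<cdot> al (s x) z)"
        have v: "ob v = Z" "pr v = p" "al v y = Idt C Z" "\<And>z. z \<in> underS r y \<Longrightarrow> al v z = st \<cdot> al (s x) z"
          by (auto simp: v_def ob_def pr_def al_def underS_def)
        have "G s y v"
          unfolding G_def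
        proof (intro conjI ballI)
          show "ob v \<in> Ob C" "pr v \<in> hom C (ob v) Y" "al v y = Idt C (ob v)" using v p Ob_of_hom[OF p(1)] by auto
          fix z assume z: "z \<in> underS r y"
          note sz = s_le[OF x zx[OF z]]
          show "al v z \<in> hom C (ob (s z)) (ob v)" using v z Comp_in[OF sz(1) st(2)] by simp
          show "pr v \<cdot> al v z = pr (s z)" using v z Comp_assoc[OF sz(1) st(2) p(1)] sz(2) p(2) by simp
          fix w assume w: "w \<in> underS r z"
          then have "(w, z) \<in> r" "w \<in> underS r y" using underS_trans[OF r(1)] z uF by blast+
          then show "al v w = al v z \<cdot> al (s z) w"
            using v(4) z s_comp[OF x zx[OF z]] Comp_assoc[OF s_le(1)[OF z] sz(1) st(2)] by simp
        qed
        moreover have "al v x = st" using v(4)[OF x] s(3)[OF x] st(2) by simp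
        moreover have "y \<noteq> b" "\<not> limit_in r y" using 2 b(2) x unfolding limit_in_def by auto
        ultimately have "P s y v" unfolding P_def using st(1) sol v(2) succ_unique[OF r(1) 2] by auto
        then show ?thesis ..
      next
        case 3
        let ?J = "Restr r (underS r y)"
        have FJ: "Field ?J = underS r y" by (rule Field_Restr_underS[OF r(1)])
        have F: "is_functor (poset_category ?J) C (D s)"
          unfolding is_functor_poset FJ D_simps using s s_le s_comp uF by blast
        have "small U (Field ?J)" unfolding FJ using r(2) by (rule small_subset[rotated]) (use uF in blast)
        then obtain L t where L: "is_colimit C (poset_category ?J) (D s) L t"
          using poset_limits(2)[of ?J "D s"] F wo(1,2) uF unfolding FJ by (auto simp: trans_Restr)
        have t: "L \<in> Ob C" "\<And>z. z \<in> underS r y \<Longrightarrow> t z \<in> hom C (ob (s z)) L"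
          "\<And>z w. z \<in> underS r y \<Longrightarrow> (w, z) \<in> r \<Longrightarrow> t z \<cdot> al (s z) w = t w"
          using L underS_trans(2)[OF r(1), of _ _ y] unfolding is_colimit_def is_cocone_poset FJ D_simps by auto
        obtain p where p: "p \<in> hom C L Y" "\<And>z. z \<in> underS r y \<Longrightarrow> p \<cdot> t z = pr (s z)"
          by (rule colimit_mediating[OF L Ob_of_hom(2)[OF f], of "pr \<circ> s"]) 
            (use s(2) s_le(2) in \<open>auto simp: FJ D_simps\<close>)
        define v where "v = (L, p, \<lambda>z. if z = y then Idt C L else t z)"
        have v: "ob v = L" "pr v = p" "al v y = Idt C L" "\<And>z. z \<in> underS r y \<Longrightarrow> al v z = t z"
          by (auto simp: v_def ob_def pr_def al_def underS_def)
        have "G s y v"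
          unfolding G_def
        proof (intro conjI ballI)
          show "ob v \<in> Ob C" "pr v \<in> hom C (ob v) Y" "al v y = Idt C (ob v)" using v p t by auto
          fix z assume z: "z \<in> underS r y"
          show "al v z \<in> hom C (ob (s z)) (ob v)" "pr v \<cdot> al v z = pr (s z)" using v z p t by auto
          fix w assume w: "w \<in> underS r z"
          then have "(w, z) \<in> r" "w \<in> underS r y" using underS_trans[OF r(1)] z uF by blast+
          then show "al v w = al v z \<cdot> al (s z) w" using v(4) z t(3) by simp
        qed
        moreover have "is_colimit C (poset_category ?J) (D s) (ob v) (al v)"
          using L v(1) colimit_eq_restrict[OF r(1), of y s s t "al v" L] v(4) unfolding D_def by simp
        moreover have "y \<noteq> b" "\<not> succ_in r x y" for x using 3 b(2) unfolding limit_in_def by auto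
        ultimately have "P s y v" unfolding P_def by auto
        then show ?thesis ..
      qed
    qed
  qed
  then obtain s where s: "\<And>y. y \<in> Field r \<Longrightarrow> G s y (s y)"
    "ob (s b) = X0" "pr (s b) = f"
    "\<And>x y. succ_in r x y \<Longrightarrow> y \<in> Field r \<Longrightarrow> al (s y) x \<in> pushouts_of_maps C (coproducts_of_maps U C K) \<and>
       solves_lifting C K (pr (s x)) (al (s y) x) (pr (s y))"
    "\<And>y. limit_in r y \<Longrightarrow> is_colimit C (poset_category (Restr r (underS r y))) (D s) (ob (s y)) (al (s y))"
    using b(1) unfolding P_def limit_in_def by blast
  have le: "al (s z) w \<in> hom C (ob (s w)) (ob (s z)) \<and> pr (s z) \<cdot> al (s z) w = pr (s w)" if "(w, z) \<in> r" for w z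
    using s(1)[OF FieldI2[OF that]] that unfolding G_def le_iff_underS[OF r(1)] by (auto simp: Idt_in)
  have comp: "al (s z) w = al (s z) x \<cdot> al (s x) w" if xz: "(x, z) \<in> r" and wx: "(w, x) \<in> r" for w x z
  proof (cases "w = x \<or> x = z")
    case True
    then show ?thesis
      using s(1)[OF FieldI1[OF xz]] s(1)[OF FieldI2[OF xz]] le[OF xz] le[OF wx] unfolding G_def by auto
  next
    case False
    then show ?thesis using s(1)[OF FieldI2[OF xz]] xz wx unfolding G_def le_iff_underS[OF r(1)] by blast
  qed
  have sF: "y \<in> Field r" if "succ_in r x y" for x y using that uF unfolding succ_in_def by blast
  show ?thesis
  proof (rule that[of "D s" "pr \<circ> s"])
    show "transfinite_sequence C r (D s)"
      unfolding transfinite_sequence_def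
    proof (intro conjI allI impI)
      show "is_functor (poset_category r) C (D s)"
        unfolding is_functor_poset D_simps using s(1) le comp unfolding G_def by blast
      show "is_colimit C (poset_category (Restr r (underS r y))) (D s) (onOb (D s) y) (\<lambda>x. onArr (D s) (x, y))"
        if "limit_in r y" for y
        using s(5)[OF that] unfolding D_simps .
    qed (use r b in auto)
    show "steps_in r (D s) (pushouts_of_maps C (coproducts_of_maps U C K))"
      unfolding steps_in_def D_simps using s(4) sF by blast
  qed (use s le sF in \<open>auto simp: D_simps G_def\<close>)
qed

text \<open>By smallness, a map from the domain of a generator to the colimit comes from some stage,
  and the lifting problem seen there is solved one stage later.\<close>

theorem small_object_argument:
  fixes k :: "nat \<Rightarrow> 'b"
  assumes K: "K = range k" "K \<subseteq> Arr C" and ls: "locally_small U C"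
    and sm: "\<And>n. small_relative_to U C (Dom C (k n)) (cell U C K)"
    and f: "f \<in> hom C A B"
  obtains i p Z where "i \<in> cell U C K" "p \<in> rlp C K" "i \<in> hom C A Z" "p \<in> hom C Z B" "f = p \<cdot> i"
proof -
  let ?D = "pushouts_of_maps C (coproducts_of_maps U C K)"
  have ex: "\<exists>N :: 'u set. small U N \<and>
       (\<forall>(r :: 'u rel) X L t.
          small U (Field r) \<and> filtered_ordinal N r \<and> transfinite_sequence C r X \<and>
          steps_in r X (cell U C K) \<and> is_colimit C (poset_category r) X L t \<longrightarrow>
            (\<forall>f\<in>hom C (Dom C (k n)) L. \<exists>x\<in>Field r. \<exists>g\<in>hom C (Dom C (k n)) (onOb X x). t x \<cdot> g = f))" for n
    using sm[of n] unfolding small_relative_to_def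
  proof (elim conjE exE, goal_cases)
    case (1 N)
    note N = 1
    show ?case
    proof (rule exI[of _ N], intro conjI allI impI N(2), goal_cases)
      case (1 r X L t)
      show ?case using N(3)[rule_format, OF 1] by blast
    qed
  qed
  have "\<exists>N :: nat \<Rightarrow> 'u set. \<forall>n. small U (N n) \<and>
       (\<forall>(r :: 'u rel) X L t.
          small U (Field r) \<and> filtered_ordinal (N n) r \<and> transfinite_sequence C r X \<and>
          steps_in r X (cell U C K) \<and> is_colimit C (poset_category r) X L t \<longrightarrow>
            (\<forall>f\<in>hom C (Dom C (k n)) L. \<exists>x\<in>Field r. \<exists>g\<in>hom C (Dom C (k n)) (onOb X x). t x \<cdot> g = f))"
    by (intro choice allI ex)
  then obtain N :: "nat \<Rightarrow> 'u set" where N: "\<And>n. small U (N n)" "\<And>n (r :: 'u rel) X L t u.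
      small U (Field r) \<Longrightarrow> filtered_ordinal (N n) r \<Longrightarrow> transfinite_sequence C r X \<Longrightarrow>
      steps_in r X (cell U C K) \<Longrightarrow> is_colimit C (poset_category r) X L t \<Longrightarrow> u \<in> hom C (Dom C (k n)) L \<Longrightarrow>
      \<exists>x\<in>Field r. \<exists>g\<in>hom C (Dom C (k n)) (onOb X x). t x \<cdot> g = u"
    by blast
  \<comment> \<open>One length has to serve all generators, so \<open>r\<close> is filtered for
    every \<open>N n\<close> simultaneously.\<close>
  obtain r :: "'u rel" where r: "small U (Field r)" "\<And>n. filtered_ordinal (N n) r"
    using filtered_ordinal_exists[OF universe, of N] N(1) by blast
  have wo: "Well_order r" and ne: "Field r \<noteq> {}" and nomax: "\<And>x. x \<in> Field r \<Longrightarrow> \<exists>y. x \<in> underS r y"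
    using r(2)[of 0] unfolding filtered_ordinal_def by blast+
  obtain b where b: "b \<in> Field r" "underS r b = {}"
  proof -
    from ne obtain x where "x \<in> Field r" by blast
    then obtain b where "b \<in> Field r" "underS r b \<inter> Field r = {}"
      by (rule least_above[OF wo]) auto
    then show ?thesis using that underS_Field[OF wo] by blast
  qed
  obtain X p where X: "transfinite_sequence C r X" "steps_in r X ?D"
    and p: "\<And>y. y \<in> Field r \<Longrightarrow> p y \<in> hom C (onOb X y) B"
      "\<And>x y. (x, y) \<in> r \<Longrightarrow> p y \<cdot> onArr X (x, y) = p x"
      "\<And>x y. succ_in r x y \<Longrightarrow> solves_lifting C K (p x) (onArr X (x, y)) (p y)"
    and Xb: "onOb X b = A" "p b = f"
    by (rule iterated_steps[OF K ls f wo r(1) b]) blast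
  have F: "is_functor (poset_category r) C X" using X(1) unfolding transfinite_sequence_def by blast
  have Xa: "\<And>x y. (x, y) \<in> r \<Longrightarrow> onArr X (x, y) \<in> hom C (onOb X x) (onOb X y)"
    using F unfolding is_functor_poset by blast
  obtain Z t where Z: "is_colimit C (poset_category r) X Z t"
    using poset_limits(2)[OF r(1) well_order_simps(1,2)[OF wo] F] by blast
  have t: "\<And>x. x \<in> Field r \<Longrightarrow> t x \<in> hom C (onOb X x) Z"
    "\<And>x y. (x, y) \<in> r \<Longrightarrow> t y \<cdot> onArr X (x, y) = t x"
    using Z unfolding is_colimit_def is_cocone_poset by blast+
  obtain q where q: "q \<in> hom C Z B" "\<And>x. x \<in> Field r \<Longrightarrow> q \<cdot> t x = p x"
    using colimit_mediating[OF Z Ob_of_hom(2)[OF f], of p] p(1,2) by blast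
  have cell: "t b \<in> cell U C K"
    using X Z r(1) b unfolding cell_def transfinite_compositions_def by blast
  have "?D \<subseteq> cell U C K"
  proof
    fix d assume d: "d \<in> ?D"
    then have "d \<in> hom C (Dom C d) (Cod C d)"
      unfolding pushouts_of_maps_def is_pushout_def by (auto simp: hom_def)
    then show "d \<in> cell U C K" unfolding cell_def using d by (rule step_in_transfinite_compositions)
  qed
  then have steps: "steps_in r X (cell U C K)" using X(2) unfolding steps_in_def by blast
  have "q \<in> rlp C K"
    unfolding rlp_def mem_Collect_eq
  proof (intro conjI ballI)
    show "q \<in> Arr C" using in_hom[OF q(1)] by blast
    fix i assume "i \<in> K"
    then obtain n where n: "i = k n" using K(1) by blast
    have i: "i \<in> hom C (Dom C i) (Cod C i)" using \<open>i \<in> K\<close> K(2) by (auto simp: hom_def)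
    show "has_lift C i q"
    proof (rule has_liftI[OF i q(1)])
      fix u v assume u: "u \<in> hom C (Dom C i) Z" and v: "v \<in> hom C (Cod C i) B" and uv: "q \<cdot> u = v \<cdot> i"
      obtain x g where x: "x \<in> Field r" and g: "g \<in> hom C (Dom C i) (onOb X x)" "t x \<cdot> g = u"
        using N(2)[OF r(1) r(2) X(1) steps Z] u unfolding n by blast
      \<comment> \<open>The problem appears at stage \<open>x\<close> and is solved at its
        successor, which exists because a filtered ordinal has no last element.\<close>
      obtain y where y: "succ_in r x y" using nomax[OF x] succ_exists[OF wo] by blast
      then have xy: "(x, y) \<in> r" "y \<in> Field r" using underS_Field[OF wo] unfolding succ_in_def by blast+
      have "p x \<cdot> g = v \<cdot> i" using uv g(2) Comp_assoc[OF g(1) t(1)[OF x] q(1)] q(2)[OF x] by simp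
      then obtain w where w: "w \<in> hom C (Cod C i) (onOb X y)" "w \<cdot> i = onArr X (x, y) \<cdot> g" "p y \<cdot> w = v"
        by (rule solves_liftingD[OF p(3)[OF y] \<open>i \<in> K\<close> p(1)[OF x] p(1)[OF xy(2)] g(1) v]) blast
      have "(t y \<cdot> w) \<cdot> i = u"
        using Comp_assoc[OF i w(1) t(1)[OF xy(2)]] w(2) Comp_assoc[OF g(1) Xa[OF xy(1)] t(1)[OF xy(2)]] t(2)[OF xy(1)] g(2) by simp
      moreover have "q \<cdot> (t y \<cdot> w) = v" using Comp_assoc[OF w(1) t(1)[OF xy(2)] q(1)] q(2)[OF xy(2)] w(3) by simp
      ultimately show "\<exists>h\<in>hom C (Cod C i) Z. h \<cdot> i = u \<and> q \<cdot> h = v" using Comp_in[OF w(1) t(1)[OF xy(2)]] by blast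
    qed
  qed
  with cell t(1)[OF b(1)] q(1) q(2)[OF b(1)] Xb show ?thesis by (intro that) auto
qed

lemma cell_cof:
  assumes "i \<in> cell U C K" "i \<in> hom C A B"
  shows "i \<in> cof U C K"
proof -
  note ob = Ob_of_hom[OF assms(2)]
  have "is_retract C i i"
    unfolding is_retract_def in_hom[OF assms(2)]
    by (intro conjI bexI[of _ "Idt C A"] bexI[of _ "Idt C B"])
      (use assms(2) ob in \<open>simp_all add: in_hom Idt_in\<close>)
  with assms(1) show ?thesis unfolding cof_def by blast
qed

end

section \<open>Binary products\<close>

context bicomplete_category
begin

lemma product_cone_is_product:
  assumes "A \<in> Ob C" "B \<in> Ob C"
  shows "is_product C A B (times_ob C A B) (pr1 C A B) (pr2 C A B)"
proof -
  obtain P p q where "is_product C A B P p q" using product_exists[OF assms] .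
  then have "case product_cone C A B of (P, p, q) \<Rightarrow> is_product C A B P p q"
    unfolding product_cone_def by (intro someI[of "\<lambda>(P, p, q). is_product C A B P p q" "(P, p, q)"]) simp
  then show ?thesis by (simp add: times_ob_def pr1_def pr2_def case_prod_beta)
qed

lemma times_ob_in: "A \<in> Ob C \<Longrightarrow> B \<in> Ob C \<Longrightarrow> times_ob C A B \<in> Ob C"
  and pr1_in: "A \<in> Ob C \<Longrightarrow> B \<in> Ob C \<Longrightarrow> pr1 C A B \<in> hom C (times_ob C A B) A"
  and pr2_in: "A \<in> Ob C \<Longrightarrow> B \<in> Ob C \<Longrightarrow> pr2 C A B \<in> hom C (times_ob C A B) B"
  using product_cone_is_product[of A B] unfolding is_product_def by blast+

lemma product_eqI:
  assumes "A \<in> Ob C" "B \<in> Ob C" "h \<in> hom C X (times_ob C A B)" "k \<in> hom C X (times_ob C A B)"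
    "pr1 C A B \<cdot> h = pr1 C A B \<cdot> k" "pr2 C A B \<cdot> h = pr2 C A B \<cdot> k"
  shows "h = k"
proof -
  have "\<exists>!h. h \<in> hom C X (times_ob C A B) \<and> pr1 C A B \<cdot> h = pr1 C A B \<cdot> k \<and> pr2 C A B \<cdot> h = pr2 C A B \<cdot> k"
    using product_cone_is_product[OF assms(1,2)] Comp_in[OF assms(4) pr1_in[OF assms(1,2)]]
      Comp_in[OF assms(4) pr2_in[OF assms(1,2)]] Ob_of_hom[OF assms(3)]
    unfolding is_product_def by blast
  with assms(3-) show ?thesis by blast
qed

lemma
  assumes f: "f \<in> hom C X A" and g: "g \<in> hom C X B"
  shows pairing_in: "pairing C f g \<in> hom C X (times_ob C A B)"
    and pr1_pairing: "pr1 C A B \<cdot> pairing C f g = f"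
    and pr2_pairing: "pr2 C A B \<cdot> pairing C f g = g"
proof -
  have "\<exists>!h. h \<in> hom C X (times_ob C A B) \<and> pr1 C A B \<cdot> h = f \<and> pr2 C A B \<cdot> h = g"
    using product_cone_is_product[OF Ob_of_hom(2)[OF f] Ob_of_hom(2)[OF g]] f g Ob_of_hom[OF f]
    unfolding is_product_def by blast
  from theI'[OF this] show "pairing C f g \<in> hom C X (times_ob C A B)"
    "pr1 C A B \<cdot> pairing C f g = f" "pr2 C A B \<cdot> pairing C f g = g"
    unfolding pairing_def in_hom[OF f] in_hom[OF g] by blast+
qed

lemma pairing_comp:
  assumes f: "f \<in> hom C X A" and g: "g \<in> hom C X B" and h: "h \<in> hom C Y X"
  shows "pairing C f g \<cdot> h = pairing C (f \<cdot> h) (g \<cdot> h)"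
proof (rule product_eqI)
  note ob = Ob_of_hom[OF f] Ob_of_hom[OF g] 
  show "A \<in> Ob C" "B \<in> Ob C" by (fact ob)+
  note fh = Comp_in[OF h f] and gh = Comp_in[OF h g] and fg = pairing_in[OF f g]
  show "pairing C f g \<cdot> h \<in> hom C Y (times_ob C A B)" "pairing C (f \<cdot> h) (g \<cdot> h) \<in> hom C Y (times_ob C A B)"
    using Comp_in[OF h fg] pairing_in[OF fh gh] .
  show "pr1 C A B \<cdot> (pairing C f g \<cdot> h) = pr1 C A B \<cdot> pairing C (f \<cdot> h) (g \<cdot> h)"
    by (simp only: Comp_assoc[OF h fg pr1_in[OF ob(2,4)], symmetric] pr1_pairing[OF f g] pr1_pairing[OF fh gh])
  show "pr2 C A B \<cdot> (pairing C f g \<cdot> h) = pr2 C A B \<cdot> pairing C (f \<cdot> h) (g \<cdot> h)"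
    by (simp only: Comp_assoc[OF h fg pr2_in[OF ob(2,4)], symmetric] pr2_pairing[OF f g] pr2_pairing[OF fh gh])
qed

lemma
  assumes f: "f \<in> hom C A A'" and g: "g \<in> hom C B B'"
  shows times_arr_in: "times_arr C f g \<in> hom C (times_ob C A B) (times_ob C A' B')"
    and pr1_times_arr: "pr1 C A' B' \<cdot> times_arr C f g = f \<cdot> pr1 C A B"
    and pr2_times_arr: "pr2 C A' B' \<cdot> times_arr C f g = g \<cdot> pr2 C A B"
proof -
  have *: "f \<cdot> pr1 C A B \<in> hom C (times_ob C A B) A'" "g \<cdot> pr2 C A B \<in> hom C (times_ob C A B) B'"
    using Comp_in[OF pr1_in f] Comp_in[OF pr2_in g] Ob_of_hom[OF f] Ob_of_hom[OF g] by blast+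
  show "times_arr C f g \<in> hom C (times_ob C A B) (times_ob C A' B')"
    "pr1 C A' B' \<cdot> times_arr C f g = f \<cdot> pr1 C A B" "pr2 C A' B' \<cdot> times_arr C f g = g \<cdot> pr2 C A B"
    unfolding times_arr_def in_hom[OF f] in_hom[OF g] using pairing_in[OF *] pr1_pairing[OF *] pr2_pairing[OF *] by this
qed

lemma times_arr_pairing:
  assumes f: "f \<in> hom C A A'" and g: "g \<in> hom C B B'" and a: "a \<in> hom C X A" and b: "b \<in> hom C X B"
  shows "times_arr C f g \<cdot> pairing C a b = pairing C (f \<cdot> a) (g \<cdot> b)"
proof (rule product_eqI)
  note ob = Ob_of_hom[OF f] Ob_of_hom[OF g]
  show "A' \<in> Ob C" "B' \<in> Ob C" by (fact ob)+
  note fa = Comp_in[OF a f] and gb = Comp_in[OF b g] and ab = pairing_in[OF a b] and fg = times_arr_in[OF f g]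
  show "times_arr C f g \<cdot> pairing C a b \<in> hom C X (times_ob C A' B')"
    "pairing C (f \<cdot> a) (g \<cdot> b) \<in> hom C X (times_ob C A' B')" using Comp_in[OF ab fg] pairing_in[OF fa gb] .
  show "pr1 C A' B' \<cdot> (times_arr C f g \<cdot> pairing C a b) = pr1 C A' B' \<cdot> pairing C (f \<cdot> a) (g \<cdot> b)"
    by (simp only: Comp_assoc[OF ab fg pr1_in[OF ob(2,4)], symmetric] pr1_times_arr[OF f g]
        Comp_assoc[OF ab pr1_in[OF ob(1,3)] f] pr1_pairing[OF a b] pr1_pairing[OF fa gb])
  show "pr2 C A' B' \<cdot> (times_arr C f g \<cdot> pairing C a b) = pr2 C A' B' \<cdot> pairing C (f \<cdot> a) (g \<cdot> b)"
    by (simp only: Comp_assoc[OF ab fg pr2_in[OF ob(2,4)], symmetric] pr2_times_arr[OF f g]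
        Comp_assoc[OF ab pr2_in[OF ob(1,3)] g] pr2_pairing[OF a b] pr2_pairing[OF fa gb])
qed

lemma times_arr_eq_pairing:
  assumes f: "f \<in> hom C A A'" and g: "g \<in> hom C B B'"
  shows "times_arr C f g = pairing C (f \<cdot> pr1 C A B) (g \<cdot> pr2 C A B)"
  unfolding times_arr_def in_hom[OF f] in_hom[OF g] ..

lemma times_arr_comp:
  assumes f: "f \<in> hom C A A'" and g: "g \<in> hom C B B'" and f': "f' \<in> hom C A' A''" and g': "g' \<in> hom C B' B''"
  shows "times_arr C f' g' \<cdot> times_arr C f g = times_arr C (f' \<cdot> f) (g' \<cdot> g)"
proof -
  note p = pr1_in[OF Ob_of_hom(1)[OF f] Ob_of_hom(1)[OF g]] pr2_in[OF Ob_of_hom(1)[OF f] Ob_of_hom(1)[OF g]]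
  show ?thesis
    unfolding times_arr_eq_pairing[OF f g] times_arr_eq_pairing[OF Comp_in[OF f f'] Comp_in[OF g g']]
    by (simp add: times_arr_pairing[OF f' g' Comp_in[OF p(1) f] Comp_in[OF p(2) g]]
        Comp_assoc[OF p(1) f f'] Comp_assoc[OF p(2) g g'])
qed

lemma times_arr_Idt:
  assumes "A \<in> Ob C" "B \<in> Ob C"
  shows "times_arr C (Idt C A) (Idt C B) = Idt C (times_ob C A B)"
  by (rule product_eqI[OF assms])
    (use assms times_arr_in[OF Idt_in Idt_in, of A B] pr1_times_arr[OF Idt_in Idt_in, of A B]
       pr2_times_arr[OF Idt_in Idt_in, of A B] pr1_in[of A B] pr2_in[of A B]
       Idt_in[OF times_ob_in, of A B] in simp_all)

text \<open>Lifting against a pushout product becomes an extension problem for two maps that agree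
  on their overlap, so that later arguments never name the corner object.\<close>

lemma pushout_product_lift:
  assumes lift: "\<And>h. is_pushout_product C f g h \<Longrightarrow> has_lift C h p"
    and f: "f \<in> hom C X Y" and g: "g \<in> hom C A B" and p: "p \<in> hom C E F"
    and a: "a \<in> hom C (times_ob C Y A) E" and b: "b \<in> hom C (times_ob C X B) E"
    and c: "c \<in> hom C (times_ob C Y B) F"
    and ab: "a \<cdot> times_arr C f (Idt C A) = b \<cdot> times_arr C (Idt C X) g"
    and ca: "p \<cdot> a = c \<cdot> times_arr C (Idt C Y) g" and cb: "p \<cdot> b = c \<cdot> times_arr C f (Idt C B)"
  obtains m where "m \<in> hom C (times_ob C Y B) E" "m \<cdot> times_arr C (Idt C Y) g = a"
    "m \<cdot> times_arr C f (Idt C B) = b" "p \<cdot> m = c"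
proof -
  note ob = Ob_of_hom[OF f] Ob_of_hom[OF g]
  note fA = times_arr_in[OF f Idt_in[OF ob(3)]] and Xg = times_arr_in[OF Idt_in[OF ob(1)] g]
    and fB = times_arr_in[OF f Idt_in[OF ob(4)]] and Yg = times_arr_in[OF Idt_in[OF ob(2)] g]
  obtain P i j where P: "is_pushout C (times_arr C f (Idt C A)) (times_arr C (Idt C X) g) i j"
    and i: "i \<in> hom C (times_ob C Y A) P" and j: "j \<in> hom C (times_ob C X B) P"
    using pushout_exists[OF fA Xg] .
  note cods = in_hom(3)[OF i] in_hom(3)[OF fA] in_hom(3)[OF Xg]
  have "times_arr C (Idt C Y) g \<cdot> times_arr C f (Idt C A) = times_arr C f (Idt C B) \<cdot> times_arr C (Idt C X) g"
    using times_arr_comp[OF f Idt_in[OF ob(3)] Idt_in[OF ob(2)] g] times_arr_comp[OF Idt_in[OF ob(1)] g f Idt_in[OF ob(4)]]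
      f g by simp
  then obtain h where h: "h \<in> hom C P (times_ob C Y B)" "h \<cdot> i = times_arr C (Idt C Y) g" "h \<cdot> j = times_arr C f (Idt C B)"
    using pushout_mediating[OF P, unfolded cods, OF Yg fB] by blast
  have "is_pushout_product C f g h"
    unfolding is_pushout_product_def in_hom[OF f] in_hom[OF g]
    using P h in_hom[OF f] in_hom[OF g] in_hom[OF i] by auto
  then have hp: "has_lift C h p" by (rule lift)
  obtain d where d: "d \<in> hom C P E" "d \<cdot> i = a" "d \<cdot> j = b"
    using pushout_mediating[OF P, unfolded cods, OF a b ab] by blast
  have "p \<cdot> d = c \<cdot> h"
  proof (rule pushout_eqI[OF P, unfolded cods, OF Comp_in[OF d(1) p] Comp_in[OF h(1) c]])
    show "(p \<cdot> d) \<cdot> i = (c \<cdot> h) \<cdot> i" using Comp_assoc[OF i d(1) p] Comp_assoc[OF i h(1) c] d h ca by simp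
    show "(p \<cdot> d) \<cdot> j = (c \<cdot> h) \<cdot> j" using Comp_assoc[OF j d(1) p] Comp_assoc[OF j h(1) c] d h cb by simp
  qed
  then obtain m where m: "m \<in> hom C (times_ob C Y B) E" "m \<cdot> h = d" "p \<cdot> m = c"
    by (rule has_liftD[OF hp h(1) p d(1) c]) blast
  have "m \<cdot> times_arr C (Idt C Y) g = a" using Comp_assoc[OF i h(1) m(1)] m h d by simp
  moreover have "m \<cdot> times_arr C f (Idt C B) = b" using Comp_assoc[OF j h(1) m(1)] m h d by simp
  ultimately show ?thesis using that m by blast
qed

text \<open>The cylinder has the interval on the right, while a pushout product with a generating
  trivial cofibration has the boundary inclusion on the left; the symmetry mediates between
  them.\<close>

definition swap :: "'a \<Rightarrow> 'a \<Rightarrow> 'b" where "swap A B = pairing C (pr2 C A B) (pr1 C A B)"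

lemma swap_in: "A \<in> Ob C \<Longrightarrow> B \<in> Ob C \<Longrightarrow> swap A B \<in> hom C (times_ob C A B) (times_ob C B A)"
  unfolding swap_def by (intro pairing_in pr1_in pr2_in)

lemma swap_times_arr:
  assumes f: "f \<in> hom C A A'" and g: "g \<in> hom C B B'"
  shows "swap A' B' \<cdot> times_arr C f g = times_arr C g f \<cdot> swap A B"
proof -
  note ob = Ob_of_hom[OF f] Ob_of_hom[OF g]
  show ?thesis unfolding swap_def
    by (simp only: pairing_comp[OF pr2_in[OF ob(2,4)] pr1_in[OF ob(2,4)] times_arr_in[OF f g]]
        times_arr_pairing[OF g f pr2_in[OF ob(1,3)] pr1_in[OF ob(1,3)]] pr1_times_arr[OF f g] pr2_times_arr[OF f g])
qed

lemma swap_swap: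
  assumes "A \<in> Ob C" "B \<in> Ob C"
  shows "swap B A \<cdot> swap A B = Idt C (times_ob C A B)"
proof (rule product_eqI[OF assms])
  note p = pr1_in[OF assms] pr2_in[OF assms] and p' = pr1_in[OF assms(2,1)] pr2_in[OF assms(2,1)]
    and s = swap_in[OF assms] swap_in[OF assms(2,1)]
  show "swap B A \<cdot> swap A B \<in> hom C (times_ob C A B) (times_ob C A B)" by (rule Comp_in[OF s])
  show "Idt C (times_ob C A B) \<in> hom C (times_ob C A B) (times_ob C A B)" by (rule Idt_in[OF times_ob_in[OF assms]])
  have 1: "pr1 C A B \<cdot> swap B A = pr2 C B A" "pr2 C A B \<cdot> swap B A = pr1 C B A"
    "pr2 C B A \<cdot> swap A B = pr1 C A B" "pr1 C B A \<cdot> swap A B = pr2 C A B"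
    unfolding swap_def by (rule pr1_pairing[OF p'(2,1)] pr2_pairing[OF p'(2,1)] pr2_pairing[OF p(2,1)] pr1_pairing[OF p(2,1)])+
  show "pr1 C A B \<cdot> (swap B A \<cdot> swap A B) = pr1 C A B \<cdot> Idt C (times_ob C A B)"
    using Comp_assoc[OF s p(1)] Comp_Idt[OF p(1)] 1 by simp
  show "pr2 C A B \<cdot> (swap B A \<cdot> swap A B) = pr2 C A B \<cdot> Idt C (times_ob C A B)"
    using Comp_assoc[OF s p(2)] Comp_Idt[OF p(2)] 1 by simp
qed

end

section \<open>Maps between cubes\<close>

lemma topspace_cube: "topspace (cube n) = {x. (\<forall>i<n. 0 \<le> x i \<and> x i \<le> 1) \<and> (\<forall>i\<ge>n. x i = 0)}"
  by (auto simp: cube_def topspace_Euclidean_space)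

lemma topspace_cube_boundary: "topspace (cube_boundary n) = topspace (cube n) \<inter> {x. \<exists>i<n. x i = 0 \<or> x i = 1}"
  by (simp add: cube_boundary_def)

text \<open>Euclidean space is a subspace of a product of lines, whose topology is the standard one
  on functions \<open>nat \<Rightarrow> real\<close>; continuity can thus be checked by
  \<open>continuous_on\<close>.\<close>

lemma Box_object:
  assumes "X \<in> range cube \<union> range cube_boundary"
  shows "X = top_of_set (topspace X)"
proof -
  have c: "cube n = top_of_set (topspace (cube n))" for n
    unfolding cube_def Euclidean_space_def euclidean_product_topology subtopology_subtopology by simp
  have "cube_boundary n = top_of_set (topspace (cube_boundary n))" for n
    using arg_cong[OF c[of n], of "\<lambda>X. subtopology X {x. \<exists>i<n. x i = 0 \<or> x i = 1}"]
    unfolding topspace_cube_boundary by (simp only: cube_boundary_def subtopology_subtopology)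
  with c show ?thesis using assms by blast
qed

definition box_map :: "box_ob \<Rightarrow> ((nat \<Rightarrow> real) \<Rightarrow> (nat \<Rightarrow> real)) \<Rightarrow> box_ob \<Rightarrow> box_arr" where
  "box_map X f Y = (X, restrict f (topspace X), Y)"

lemma Box_simps [simp]:
  "Ob Box = range cube \<union> range cube_boundary"
  "Dom Box (box_map X f Y) = X" "Cod Box (box_map X f Y) = Y" "Idt Box X = box_map X (\<lambda>x. x) X"
  by (simp_all add: Box_def full_subcategory_def top_category_def box_map_def)

lemma box_map_in:
  assumes "X \<in> Ob Box" "Y \<in> Ob Box" "continuous_on (topspace X) f" "f \<in> topspace X \<rightarrow> topspace Y"
  shows "box_map X f Y \<in> hom Box X Y"
proof -
  have X: "X = top_of_set (topspace X)" and Y: "Y = top_of_set (topspace Y)"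
    using assms(1,2) Box_object by simp_all
  have "continuous_map (top_of_set (topspace X)) (top_of_set (topspace Y)) (restrict f (topspace X))"
    using assms(3,4) by (auto simp: continuous_map_subtopology_eu Pi_iff cong: continuous_on_cong)
  then have "continuous_map X Y (restrict f (topspace X))" using X Y by metis
  then show ?thesis
    using assms(1,2) by (auto simp: hom_def Box_def full_subcategory_def top_category_def box_map_def)
qed

lemma box_map_comp:
  assumes "f \<in> topspace X \<rightarrow> topspace Y"
  shows "box_map Y g Z \<cdot>\<^bsub>Box\<^esub> box_map X f Y = box_map X (\<lambda>x. g (f x)) Z"
  using assms by (auto simp: Box_def full_subcategory_def top_category_def box_map_def compose_def Pi_iff fun_eq_iff)

lemma box_map_cong:
  assumes "\<And>x. x \<in> topspace X \<Longrightarrow> f x = g x"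
  shows "box_map X f Y = box_map X g Y"
  using assms by (auto simp: box_map_def restrict_def fun_eq_iff)

lemma inclusion_eq_box_map: "inclusion X Y = box_map X (\<lambda>x. x) Y"
  by (simp add: inclusion_def box_map_def)

lemma endpoint_eq_box_map: "endpoint k X = box_map (cube 0) (\<lambda>_. (\<lambda>i. if i = 0 then k else 0)) X"
  by (simp add: endpoint_def box_map_def)

lemma inclusion_in_Box:
  "inclusion (cube_boundary n) (cube n) \<in> hom Box (cube_boundary n) (cube n)"
  "inclusion (cube n) (cube (Suc n)) \<in> hom Box (cube n) (cube (Suc n))"
  "inclusion (cube_boundary 0) (cube_boundary n) \<in> hom Box (cube_boundary 0) (cube_boundary n)"
  unfolding inclusion_eq_box_map
  by (intro box_map_in; auto simp: topspace_cube topspace_cube_boundary less_Suc_eq)+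

lemma endpoint_in_Box:
  assumes "k = 0 \<or> k = 1"
  shows "endpoint k (cube 1) \<in> hom Box (cube 0) (cube 1)"
    "endpoint k (cube_boundary 1) \<in> hom Box (cube 0) (cube_boundary 1)"
  unfolding endpoint_eq_box_map
  by (intro box_map_in; use assms in \<open>auto simp: topspace_cube topspace_cube_boundary\<close>)+

lemma inclusion_endpoint:
  assumes "k = 0 \<or> k = 1"
  shows "inclusion (cube_boundary 1) (cube 1) \<cdot>\<^bsub>Box\<^esub> endpoint k (cube_boundary 1) = endpoint k (cube 1)"
  unfolding endpoint_eq_box_map inclusion_eq_box_map
  by (rule box_map_comp) (use assms in \<open>auto simp: topspace_cube topspace_cube_boundary\<close>)

text \<open>Places the endpoint 0 among the generating trivial cofibrations, which is what allows
  homotopies to be extended from their start.\<close>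

lemma inclusion_cube_0_1: "inclusion (cube 0) (cube (Suc 0)) = endpoint 0 (cube 1)"
  unfolding endpoint_eq_box_map inclusion_eq_box_map One_nat_def by (rule box_map_cong) (auto simp: topspace_cube)

text \<open>Time reversal on the interval. Homotopies are extended from time 0, and this involution
  transfers the outcome to time 1.\<close>

definition cube_reflection :: box_arr where
  "cube_reflection = box_map (cube 1) (\<lambda>x i. if i = 0 then 1 - x 0 else 0) (cube 1)"

lemma cube_reflection_in: "cube_reflection \<in> hom Box (cube 1) (cube 1)"
  unfolding cube_reflection_def
proof (intro box_map_in)
  have "continuous_on S (\<lambda>x (i :: nat). if i = 0 then 1 - x 0 else 0)" for S :: "(nat \<Rightarrow> real) set"
  proof (rule continuous_on_coordinatewise_then_product)
    fix i :: nat
    show "continuous_on S (\<lambda>x. if i = 0 then 1 - x 0 else 0)"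
      by (cases "i = 0") (simp_all add: continuous_on_diff continuous_on_subset[OF continuous_on_product_coordinates])
  qed
  then show "continuous_on (topspace (cube 1)) (\<lambda>x (i :: nat). if i = 0 then 1 - x 0 else 0)" .
qed (auto simp: topspace_cube)

lemma cube_reflection_endpoint:
  assumes "k = 0 \<or> k = 1"
  shows "cube_reflection \<cdot>\<^bsub>Box\<^esub> endpoint k (cube 1) = endpoint (1 - k) (cube 1)"
  unfolding endpoint_eq_box_map cube_reflection_def
  by (subst box_map_comp) (use assms in \<open>auto simp: topspace_cube intro!: box_map_cong\<close>)

lemma cube_reflection_involution: "cube_reflection \<cdot>\<^bsub>Box\<^esub> cube_reflection = Idt Box (cube 1)"
  unfolding cube_reflection_def Box_simps
  by (subst box_map_comp) (auto simp: topspace_cube fun_eq_iff intro!: box_map_cong)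

text \<open>Forgetting the last coordinate retracts \<open>cube (Suc n)\<close> onto
  \<open>cube n\<close>, the splitting that makes every object fibrant.\<close>

definition cube_projection :: "nat \<Rightarrow> box_arr" where
  "cube_projection n = box_map (cube (Suc n)) (\<lambda>x i. if i < n then x i else 0) (cube n)"

lemma cube_projection_in: "cube_projection n \<in> hom Box (cube (Suc n)) (cube n)"
  unfolding cube_projection_def
proof (intro box_map_in)
  have "continuous_on S (\<lambda>x i. if i < n then x i else 0)" for S :: "(nat \<Rightarrow> real) set"
  proof (rule continuous_on_coordinatewise_then_product)
    fix i :: nat
    show "continuous_on S (\<lambda>x. if i < n then x i else 0)"
      by (cases "i < n") (simp_all add: continuous_on_subset[OF continuous_on_product_coordinates])
  qed
  then show "continuous_on (topspace (cube (Suc n))) (\<lambda>x i. if i < n then x i else 0)" .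
qed (auto simp: topspace_cube)

lemma cube_projection_inclusion:
  "cube_projection n \<cdot>\<^bsub>Box\<^esub> inclusion (cube n) (cube (Suc n)) = Idt Box (cube n)"
  unfolding cube_projection_def inclusion_eq_box_map Box_simps
  by (subst box_map_comp) (auto simp: topspace_cube fun_eq_iff less_Suc_eq intro!: box_map_cong)

section \<open>Homotopies in a Q-structure\<close>

locale q_structure =
  fixes C :: "('o, 'm) category" (structure)
    and \<iota> :: "(box_ob, box_arr, 'o, 'm) ftor"
    and U :: "'u itself"
  assumes universe': "grothendieck_universe U" and Q: "Q_structure U C \<iota>"

sublocale q_structure \<subseteq> bicomplete_category C U
  using universe' Q unfolding bicomplete_category_def category_syntax_def bicomplete_category_axioms_def Q_structure_def
  by blast

context q_structure
begin

declare One_nat_def [simp del]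

abbreviation disk (\<open>\<D>\<close>) where "\<D> n \<equiv> onOb \<iota> (cube n)"
abbreviation sphere (\<open>\<S>\<close>) where "\<S> n \<equiv> onOb \<iota> (cube_boundary n)"
abbreviation interval (\<open>\<I>\<close>) where "\<I> \<equiv> \<D> 1"
abbreviation Cyl where "Cyl X \<equiv> times_ob C X \<I>"
abbreviation cyl where "cyl f \<equiv> times_arr C f (Idt C \<I>)"
abbreviation proj where "proj X \<equiv> pr1 C X \<I>"
abbreviation inc where "inc \<equiv> boundary_inclusion \<iota>"
abbreviation end_at where "end_at k X \<equiv> at_endpoint C \<iota> k (cube 1) X"
abbreviation Cof where "Cof \<equiv> cof U C (gen_cof \<iota>)"
abbreviation Cof\<^sub>J where "Cof\<^sub>J \<equiv> cof U C (gen_triv_cof \<iota>)"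
abbreviation Fib where "Fib \<equiv> rlp C (gen_triv_cof \<iota>)"
abbreviation Fib\<^sub>I where "Fib\<^sub>I \<equiv> rlp C (gen_cof \<iota>)"

section \<open>The axioms of a Q-structure in working form\<close>

lemma \<iota>_Ob [simp]: "\<D> n \<in> Ob C" "\<S> n \<in> Ob C"
  using Q unfolding Q_structure_def is_embedding_def is_functor_def by simp_all

lemma \<iota>_hom: "f \<in> hom Box X Y \<Longrightarrow> onArr \<iota> f \<in> hom C (onOb \<iota> X) (onOb \<iota> Y)"
  using Q unfolding Q_structure_def is_embedding_def is_functor_def by (auto simp: hom_def)

lemma \<iota>_comp: "f \<in> hom Box X Y \<Longrightarrow> g \<in> hom Box Y Z \<Longrightarrow> onArr \<iota> g \<cdot> onArr \<iota> f = onArr \<iota> (g \<cdot>\<^bsub>Box\<^esub> f)"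
  using Q unfolding Q_structure_def is_embedding_def is_functor_def by (auto simp: hom_def)

lemma \<iota>_Idt: "X \<in> Ob Box \<Longrightarrow> onArr \<iota> (Idt Box X) = Idt C (onOb \<iota> X)"
  using Q unfolding Q_structure_def is_embedding_def is_functor_def by blast

lemma locally_small: "locally_small U C"
  and initial: "is_initial C (\<S> 0)" and terminal: "is_terminal C (\<D> 0)"
  and coproduct_\<S>1: "X \<in> Ob C \<Longrightarrow> is_coproduct C {0, 1} (\<lambda>_. X)
        (times_ob C X (\<S> 1)) (\<lambda>k. at_endpoint C \<iota> k (cube_boundary 1) X)"
  and Q3: "pushout_products C (gen_cof \<iota>) (gen_cof \<iota>) \<subseteq> Cof"
     "pushout_products C (gen_cof \<iota>) (gen_triv_cof \<iota>) \<subseteq> Cof\<^sub>J"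
  and Q4: "gen_triv_cof \<iota> \<subseteq> Cof" "onArr \<iota> (inclusion (cube_boundary 0) (cube_boundary n)) \<in> Cof"
  and interval_exponentiable: "exponentiable C \<I>"
  and small_\<S>: "small_relative_to U C (\<S> n) (cell U C (gen_cof \<iota>))"
  and small_\<D>: "small_relative_to U C (\<D> n) (cell U C (gen_triv_cof \<iota>))"
  using Q unfolding Q_structure_def category_with_intervals_def by blast+

lemma inc_in: "inc n \<in> hom C (\<S> n) (\<D> n)"
  unfolding boundary_inclusion_def by (rule \<iota>_hom[OF inclusion_in_Box(1)])

lemma gen_triv_cof_in: "onArr \<iota> (inclusion (cube n) (cube (Suc n))) \<in> hom C (\<D> n) (\<D> (Suc n))"
  by (rule \<iota>_hom[OF inclusion_in_Box(2)])

lemma inc_simps [simp]: "inc n \<in> Arr C" "Dom C (inc n) = \<S> n" "Cod C (inc n) = \<D> n"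
  using in_hom[OF inc_in] .

lemma gen_cof_Arr: "gen_cof \<iota> \<subseteq> Arr C" and gen_triv_cof_Arr: "gen_triv_cof \<iota> \<subseteq> Arr C"
  using in_hom(1)[OF gen_triv_cof_in] by (auto simp: gen_cof_def gen_triv_cof_def)

definition bang :: "'o \<Rightarrow> 'm" where "bang X = (THE f. f \<in> hom C X (\<D> 0))"

lemma bang_in:
  assumes "X \<in> Ob C"
  shows "bang X \<in> hom C X (\<D> 0)"
proof -
  have "\<exists>!f. f \<in> hom C X (\<D> 0)" using terminal assms unfolding is_terminal_def by blast
  then show ?thesis unfolding bang_def by (rule theI')
qed

lemma bang_simps [simp]:
  "X \<in> Ob C \<Longrightarrow> bang X \<in> Arr C" "X \<in> Ob C \<Longrightarrow> Dom C (bang X) = X" "X \<in> Ob C \<Longrightarrow> Cod C (bang X) = \<D> 0"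
  by (simp_all add: in_hom[OF bang_in])

lemma terminal_eq: "f \<in> hom C X (\<D> 0) \<Longrightarrow> g \<in> hom C X (\<D> 0) \<Longrightarrow> f = g"
  using terminal Ob_of_hom(1)[of f X] unfolding is_terminal_def by blast

lemma bang_comp [simp]: "f \<in> Arr C \<Longrightarrow> Cod C f = Y \<Longrightarrow> bang Y \<cdot> f = bang (Dom C f)"
  by (rule terminal_eq) (auto simp: hom_def)

lemma product_simps [simp]:
  assumes "A \<in> Ob C" "B \<in> Ob C"
  shows "times_ob C A B \<in> Ob C"
    "pr1 C A B \<in> Arr C" "Dom C (pr1 C A B) = times_ob C A B" "Cod C (pr1 C A B) = A"
    "pr2 C A B \<in> Arr C" "Dom C (pr2 C A B) = times_ob C A B" "Cod C (pr2 C A B) = B"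
  using times_ob_in[OF assms] in_hom[OF pr1_in[OF assms]] in_hom[OF pr2_in[OF assms]] by simp_all

lemma times_arr_simps [simp]:
  assumes "f \<in> Arr C" "g \<in> Arr C"
  shows "times_arr C f g \<in> Arr C" "Dom C (times_arr C f g) = times_ob C (Dom C f) (Dom C g)"
    "Cod C (times_arr C f g) = times_ob C (Cod C f) (Cod C g)"
  using in_hom[OF times_arr_in[OF Arr_hom Arr_hom, OF assms]] by simp_all

text \<open>The graph of the constant map at \<open>e\<close>. Leaving the point arbitrary treats
  the endpoints of the interval, those of its boundary and the identity of the point alike.\<close>

definition point_section :: "'m \<Rightarrow> 'o \<Rightarrow> 'm" where
  "point_section e X = pairing C (Idt C X) (e \<cdot> bang X)"

lemma at_endpoint_eq: "at_endpoint C \<iota> k B X = point_section (onArr \<iota> (endpoint k B)) X"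
  by (simp add: at_endpoint_def point_section_def bang_def)

context
  fixes e B assumes e: "e \<in> hom C (\<D> 0) B"
begin

lemma point_section_in: "X \<in> Ob C \<Longrightarrow> point_section e X \<in> hom C X (times_ob C X B)"
  unfolding point_section_def by (intro pairing_in Idt_in Comp_in[OF bang_in e])

lemma pr1_point_section: "X \<in> Ob C \<Longrightarrow> pr1 C X B \<cdot> point_section e X = Idt C X"
  unfolding point_section_def by (intro pr1_pairing[OF Idt_in Comp_in[OF bang_in e]])

lemma times_arr_point_section:
  assumes f: "f \<in> hom C X Y"
  shows "times_arr C f (Idt C B) \<cdot> point_section e X = point_section e Y \<cdot> f"
proof -
  note ob = Ob_of_hom[OF f] Ob_of_hom[OF e]
  show ?thesis unfolding point_section_def
    using times_arr_pairing[OF f Idt_in[OF ob(4)] Idt_in[OF ob(1)] Comp_in[OF bang_in[OF ob(1)] e]]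
      pairing_comp[OF Idt_in[OF ob(2)] Comp_in[OF bang_in[OF ob(2)] e] f] ob
    by (simp add: in_hom[OF f] in_hom[OF e])
qed

lemma times_arr_Idt_point_section:
  assumes g: "g \<in> hom C B B'" and X: "X \<in> Ob C"
  shows "times_arr C (Idt C X) g \<cdot> point_section e X = point_section (g \<cdot> e) X"
  unfolding point_section_def
  using times_arr_pairing[OF Idt_in[OF X] g Idt_in[OF X] Comp_in[OF bang_in[OF X] e]] X
  by (simp add: in_hom[OF g] in_hom[OF e])

text \<open>The pushout product axioms involve the product of \<open>X\<close> with the point,
  homotopies involve \<open>X\<close> itself; terminality of the point makes the two inclusions
  correspond.\<close>

lemma point_section_pr1:
  assumes X: "X \<in> Ob C"
  shows "point_section e X \<cdot> pr1 C X (\<D> 0) = times_arr C (Idt C X) e"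
proof -
  have "bang X \<cdot> pr1 C X (\<D> 0) = pr2 C X (\<D> 0)"
    by (rule terminal_eq[of _ "times_ob C X (\<D> 0)"]) (use X in \<open>simp_all add: hom_def\<close>)
  then show ?thesis unfolding point_section_def times_arr_eq_pairing[OF Idt_in[OF X] e]
    using pairing_comp[OF Idt_in[OF X] Comp_in[OF bang_in[OF X] e] pr1_in[OF X \<iota>_Ob(1)]] X
    by (simp add: in_hom[OF e])
qed

end

section \<open>Endpoints of cylinders\<close>

lemma endpoint_in:
  assumes "k = 0 \<or> k = 1"
  shows "onArr \<iota> (endpoint k (cube 1)) \<in> hom C (\<D> 0) \<I>"
    "onArr \<iota> (endpoint k (cube_boundary 1)) \<in> hom C (\<D> 0) (\<S> 1)"
  using \<iota>_hom[OF endpoint_in_Box(1)[OF assms]] \<iota>_hom[OF endpoint_in_Box(2)[OF assms]] .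

text \<open>The endpoints of the interval factor through its boundary, which links the inclusions of
  the coproduct axiom with the ends of the cylinder.\<close>

lemma inc_end_at:
  assumes k: "k = 0 \<or> k = 1" and X: "X \<in> Ob C"
  shows "times_arr C (Idt C X) (inc 1) \<cdot> at_endpoint C \<iota> k (cube_boundary 1) X = end_at k X"
  using times_arr_Idt_point_section[OF endpoint_in(2)[OF k] inc_in X] inclusion_endpoint[OF k]
    \<iota>_comp[OF endpoint_in_Box(2)[OF k] inclusion_in_Box(1)]
  by (simp add: at_endpoint_eq boundary_inclusion_def)

lemma end_at_in: "k = 0 \<or> k = 1 \<Longrightarrow> X \<in> Ob C \<Longrightarrow> end_at k X \<in> hom C X (Cyl X)"
  unfolding at_endpoint_eq by (rule point_section_in[OF endpoint_in(1)])

lemma at_boundary_in: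
  "k = 0 \<or> k = 1 \<Longrightarrow> X \<in> Ob C \<Longrightarrow> at_endpoint C \<iota> k (cube_boundary 1) X \<in> hom C X (times_ob C X (\<S> 1))"
  unfolding at_endpoint_eq by (rule point_section_in[OF endpoint_in(2)])

lemma end_at_simps [simp]:
  assumes "k = 0 \<or> k = 1" "X \<in> Ob C"
  shows "end_at k X \<in> Arr C" "Dom C (end_at k X) = X" "Cod C (end_at k X) = Cyl X"
    "proj X \<cdot> end_at k X = Idt C X"
  using in_hom[OF end_at_in[OF assms]] pr1_point_section[OF endpoint_in(1)[OF assms(1)] assms(2)]
  by (simp_all add: at_endpoint_eq)

lemma proj_end_at_comp [simp]:
  "k = 0 \<or> k = 1 \<Longrightarrow> w \<in> Arr C \<Longrightarrow> Cod C w = X \<Longrightarrow> proj X \<cdot> (end_at k X \<cdot> w) = w"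
  by (subst Comp_assoc_simp[symmetric]) auto

lemma cyl_end_at [simp]:
  assumes "k = 0 \<or> k = 1" "f \<in> Arr C" "Dom C f = X"
  shows "cyl f \<cdot> end_at k X = end_at k (Cod C f) \<cdot> f"
  using times_arr_point_section[OF endpoint_in(1)[OF assms(1)] Arr_hom[OF assms(2)]] assms(3)
  by (simp add: at_endpoint_eq)

lemma cyl_end_at_comp [simp]:
  assumes "k = 0 \<or> k = 1" "f \<in> Arr C" "Dom C f = X" "w \<in> Arr C" "Cod C w = X"
  shows "cyl f \<cdot> (end_at k X \<cdot> w) = end_at k (Cod C f) \<cdot> (f \<cdot> w)"
  using cyl_end_at[OF assms(1-3)] assms by (subst Comp_assoc_simp[symmetric]) auto

lemma proj_cyl [simp]:
  assumes "f \<in> Arr C" "Cod C f = Y"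
  shows "proj Y \<cdot> cyl f = f \<cdot> proj (Dom C f)"
  using pr1_times_arr[OF Arr_hom[OF assms(1)] Idt_in[of \<I>]] assms(2) by simp

lemma proj_cyl_comp [simp]:
  assumes "f \<in> Arr C" "Cod C f = Y" "w \<in> Arr C" "Cod C w = Cyl (Dom C f)"
  shows "proj Y \<cdot> (cyl f \<cdot> w) = f \<cdot> (proj (Dom C f) \<cdot> w)"
  using proj_cyl[OF assms(1,2)] assms by (subst Comp_assoc_simp[symmetric]) auto

lemma cyl_comp:
  assumes "f \<in> Arr C" "g \<in> Arr C" "Dom C g = Cod C f"
  shows "cyl (g \<cdot> f) = cyl g \<cdot> cyl f"
  using times_arr_comp[of f "Dom C f" "Cod C f" "Idt C \<I>" \<I> \<I> g "Cod C g" "Idt C \<I>" \<I>] assms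
  by (simp add: hom_def)

lemma cyl_Idt [simp]: "X \<in> Ob C \<Longrightarrow> cyl (Idt C X) = Idt C (Cyl X)"
  by (simp add: times_arr_Idt)

subsection \<open>Path objects\<close>

text \<open>The exponential of \<open>Y\<close> by the interval, encoded by its evaluation map
  \<open>e\<close> and a universal property rather than by an adjoint functor.\<close>

definition is_path_object :: "'o \<Rightarrow> 'o \<Rightarrow> 'm \<Rightarrow> bool" where
  "is_path_object Y P e \<longleftrightarrow> P \<in> Ob C \<and> e \<in> hom C (Cyl P) Y \<and>
     (\<forall>X\<in>Ob C. \<forall>H\<in>hom C (Cyl X) Y. \<exists>!h. h \<in> hom C X P \<and> e \<cdot> cyl h = H)"

text \<open>The evaluation is the counit, the map that the adjunction sends to an identity.
  Naturality in \<open>X\<close> makes composing with it inverse to the bijection of the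
  adjunction.\<close>

lemma path_object_exists:
  assumes Y: "Y \<in> Ob C"
  obtains P e where "is_path_object Y P e"
proof -
  let ?F = "\<lparr>onOb = (\<lambda>X. Cyl X), onArr = (\<lambda>f. cyl f)\<rparr>"
  have "has_right_adjoint C C ?F" using interval_exponentiable unfolding exponentiable_def by blast
  then obtain G :: "('o, 'm, 'o, 'm) ftor" and \<phi> where G: "is_functor C C G"
    and \<phi>: "\<forall>X\<in>Ob C. \<forall>Y\<in>Ob C. bij_betw (\<phi> X Y) (hom C (Cyl X) Y) (hom C X (onOb G Y))"
    and nat: "\<forall>X\<in>Ob C. \<forall>X'\<in>Ob C. \<forall>Y\<in>Ob C. \<forall>Y'\<in>Ob C.
      \<forall>h\<in>hom C (Cyl X) Y. \<forall>a\<in>hom C X' X. \<forall>b\<in>hom C Y Y'.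
        \<phi> X' Y' (b \<cdot> (h \<cdot> cyl a)) = onArr G b \<cdot> (\<phi> X Y h \<cdot> a)"
    unfolding has_right_adjoint_def ftor.select_convs by blast
  let ?P = "onOb G Y"
  have P: "?P \<in> Ob C" and GI: "onArr G (Idt C Y) = Idt C ?P" using G Y unfolding is_functor_def by auto
  note bij = \<phi>[rule_format, OF _ Y]
  have nat': "\<phi> X' Y (h \<cdot> cyl a) = \<phi> X Y h \<cdot> a" if h: "h \<in> hom C (Cyl X) Y" and a: "a \<in> hom C X' X" for X X' h a
  proof -
    note ob = Ob_of_hom[OF a]
    have "\<phi> X Y h \<in> hom C X ?P" using bij[OF ob(2)] h by (auto simp: bij_betw_def)
    then show ?thesis
      using nat[rule_format, OF ob(2,1) Y Y h a Idt_in[OF Y]] GI P Y by (simp add: in_hom[OF h] in_hom[OF a] in_hom)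
  qed
  obtain e where e: "e \<in> hom C (Cyl ?P) Y" "\<phi> ?P Y e = Idt C ?P"
    using bij[OF P] Idt_in[OF P] unfolding bij_betw_def by (metis imageE)
  have key: "\<phi> X Y (e \<cdot> cyl h) = h" if "h \<in> hom C X ?P" for X h
    using nat'[OF e(1) that] e(2) that by simp
  have "\<exists>!h. h \<in> hom C X ?P \<and> e \<cdot> cyl h = H" if X: "X \<in> Ob C" and H: "H \<in> hom C (Cyl X) Y" for X H
  proof (rule ex1I[of _ "\<phi> X Y H"])
    have h: "\<phi> X Y H \<in> hom C X ?P" using bij[OF X] H by (auto simp: bij_betw_def)
    have "e \<cdot> cyl (\<phi> X Y H) \<in> hom C (Cyl X) Y"
      using times_arr_in[OF h Idt_in[of \<I>]] e(1) by (auto intro: Comp_in)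
    then have "e \<cdot> cyl (\<phi> X Y H) = H"
      using inj_onD[OF bij_betw_imp_inj_on[OF bij[OF X]], of "e \<cdot> cyl (\<phi> X Y H)" H] key[OF h] H by simp
    with h show "\<phi> X Y H \<in> hom C X ?P \<and> e \<cdot> cyl (\<phi> X Y H) = H" by blast
    show "h = \<phi> X Y H" if "h \<in> hom C X ?P \<and> e \<cdot> cyl h = H" for h using key that by metis
  qed
  with P e(1) show ?thesis by (intro that[of ?P e]) (simp add: is_path_object_def)
qed

definition Path :: "'o \<Rightarrow> 'o" where "Path Y = (SOME P. \<exists>e. is_path_object Y P e)"
definition path_eval :: "'o \<Rightarrow> 'm" where "path_eval Y = (SOME e. is_path_object Y (Path Y) e)"
definition path_of :: "'o \<Rightarrow> 'o \<Rightarrow> 'm \<Rightarrow> 'm" where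
  "path_of X Y H = (THE h. h \<in> hom C X (Path Y) \<and> path_eval Y \<cdot> cyl h = H)"
definition ev :: "real \<Rightarrow> 'o \<Rightarrow> 'm" where "ev k Y = path_eval Y \<cdot> end_at k (Path Y)"

lemma is_path_object: "Y \<in> Ob C \<Longrightarrow> is_path_object Y (Path Y) (path_eval Y)"
  unfolding path_eval_def Path_def by (rule someI_ex, rule someI_ex) (rule path_object_exists, blast+)

lemma path_simps [simp]:
  assumes "Y \<in> Ob C"
  shows "Path Y \<in> Ob C" "path_eval Y \<in> Arr C" "Dom C (path_eval Y) = Cyl (Path Y)" "Cod C (path_eval Y) = Y"
  using is_path_object[OF assms] unfolding is_path_object_def by (simp_all add: hom_def)

lemma
  assumes H: "H \<in> hom C (Cyl X) Y" and X: "X \<in> Ob C"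
  shows path_of_in: "path_of X Y H \<in> hom C X (Path Y)" and path_eval_path_of: "path_eval Y \<cdot> cyl (path_of X Y H) = H"
proof -
  have "\<exists>!h. h \<in> hom C X (Path Y) \<and> path_eval Y \<cdot> cyl h = H"
    using is_path_object[OF Ob_of_hom(2)[OF H]] H X unfolding is_path_object_def by blast
  from theI'[OF this] show "path_of X Y H \<in> hom C X (Path Y)" "path_eval Y \<cdot> cyl (path_of X Y H) = H"
    unfolding path_of_def by blast+
qed

lemma path_eqI:
  assumes h: "h \<in> hom C X (Path Y)" and k: "k \<in> hom C X (Path Y)" and Y: "Y \<in> Ob C"
    and eq: "path_eval Y \<cdot> cyl h = path_eval Y \<cdot> cyl k"
  shows "h = k"
proof -
  have "path_eval Y \<cdot> cyl k \<in> hom C (Cyl X) Y" using Y in_hom[OF k] by (simp add: hom_def)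
  then have "\<exists>!h. h \<in> hom C X (Path Y) \<and> path_eval Y \<cdot> cyl h = path_eval Y \<cdot> cyl k"
    using is_path_object[OF Y] Ob_of_hom[OF h] unfolding is_path_object_def by blast
  with h k eq show ?thesis by blast
qed

lemma path_of_simps [simp]:
  assumes "H \<in> Arr C" "Dom C H = Cyl X" "Cod C H = Y" "X \<in> Ob C"
  shows "path_of X Y H \<in> Arr C" "Dom C (path_of X Y H) = X" "Cod C (path_of X Y H) = Path Y"
    "path_eval Y \<cdot> cyl (path_of X Y H) = H"
  using in_hom[OF path_of_in[of H X Y]] path_eval_path_of[of H X Y] assms by (simp_all add: hom_def)

lemma ev_simps [simp]:
  assumes "k = 0 \<or> k = 1" "Y \<in> Ob C"
  shows "ev k Y \<in> Arr C" "Dom C (ev k Y) = Path Y" "Cod C (ev k Y) = Y"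
  using assms by (simp_all add: ev_def)

lemma path_eval_end [simp]:
  assumes "k = 0 \<or> k = 1" "Y \<in> Ob C"
  shows "path_eval Y \<cdot> end_at k (Path Y) = ev k Y"
    "w \<in> Arr C \<Longrightarrow> Cod C w = Path Y \<Longrightarrow> path_eval Y \<cdot> (end_at k (Path Y) \<cdot> w) = ev k Y \<cdot> w"
  using assms by (auto simp: ev_def)

lemma ev_path_of [simp]:
  assumes "k = 0 \<or> k = 1" "H \<in> Arr C" "Dom C H = Cyl X" "Cod C H = Y" "X \<in> Ob C"
  shows "ev k Y \<cdot> path_of X Y H = H \<cdot> end_at k X"
proof -
  have Y: "Y \<in> Ob C" using assms by auto
  have "H \<cdot> end_at k X = (path_eval Y \<cdot> cyl (path_of X Y H)) \<cdot> end_at k X" using assms by simp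
  also have "\<dots> = ev k Y \<cdot> path_of X Y H" using assms Y by (simp del: path_of_simps(4))
  finally show ?thesis ..
qed

lemma ev_path_of_comp [simp]:
  assumes "k = 0 \<or> k = 1" "H \<in> Arr C" "Dom C H = Cyl X" "Cod C H = Y" "X \<in> Ob C" "w \<in> Arr C" "Cod C w = X"
  shows "ev k Y \<cdot> (path_of X Y H \<cdot> w) = H \<cdot> (end_at k X \<cdot> w)"
proof -
  have Y: "Y \<in> Ob C" using assms by auto
  have "ev k Y \<cdot> (path_of X Y H \<cdot> w) = (ev k Y \<cdot> path_of X Y H) \<cdot> w"
    using assms Y by (subst Comp_assoc_simp) auto
  then show ?thesis using assms by simp
qed

lemma path_of_comp:
  assumes "H \<in> Arr C" "Dom C H = Cyl X" "Cod C H = Y" "X \<in> Ob C" "w \<in> Arr C" "Cod C w = X" "Dom C w = X'"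
  shows "path_of X Y H \<cdot> w = path_of X' Y (H \<cdot> cyl w)"
proof (rule path_eqI)
  have Y: "Y \<in> Ob C" and X': "X' \<in> Ob C" using assms by auto
  have "path_eval Y \<cdot> cyl (path_of X Y H \<cdot> w) = (path_eval Y \<cdot> cyl (path_of X Y H)) \<cdot> cyl w"
    using assms Y by (simp add: cyl_comp del: path_of_simps(4))
  then show "path_eval Y \<cdot> cyl (path_of X Y H \<cdot> w) = path_eval Y \<cdot> cyl (path_of X' Y (H \<cdot> cyl w))"
    using assms X' by simp
  show "path_of X Y H \<cdot> w \<in> hom C X' (Path Y)" "path_of X' Y (H \<cdot> cyl w) \<in> hom C X' (Path Y)"
    using assms X' by (simp_all add: hom_def)
qed (use assms in auto)

lemma path_of_path_eval [simp]:
  assumes "h \<in> Arr C" "Dom C h = X" "Cod C h = Path Y" "Y \<in> Ob C"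
  shows "path_of X Y (path_eval Y \<cdot> cyl h) = h"
  by (rule path_eqI[of _ X Y]) (use assms in \<open>auto simp: hom_def\<close>)

section \<open>Constant paths and paths carried along a map\<close>

definition const_path :: "'o \<Rightarrow> 'm" where "const_path Y = path_of Y Y (proj Y)"

lemma const_path_simps [simp]:
  assumes "Y \<in> Ob C"
  shows "const_path Y \<in> Arr C" "Dom C (const_path Y) = Y" "Cod C (const_path Y) = Path Y"
  using assms by (simp_all add: const_path_def)

lemma ev_const_path [simp]:
  assumes "k = 0 \<or> k = 1" "Y \<in> Ob C"
  shows "ev k Y \<cdot> const_path Y = Idt C Y"
  using assms by (simp add: const_path_def)

lemma ev_const_path_comp [simp]:
  assumes "k = 0 \<or> k = 1" "h \<in> Arr C" "Cod C h = Y"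
  shows "ev k Y \<cdot> (const_path Y \<cdot> h) = h"
  using assms by (auto simp: const_path_def)

lemma path_of_proj:
  assumes "h \<in> Arr C" "Cod C h = Y" "Dom C h = X"
  shows "path_of X Y (h \<cdot> proj X) = const_path Y \<cdot> h"
  using assms by (auto simp: const_path_def path_of_comp)

definition map_path :: "'m \<Rightarrow> 'm" where
  "map_path g = path_of (Path (Dom C g)) (Cod C g) (g \<cdot> path_eval (Dom C g))"

lemma map_path_simps [simp]:
  assumes "g \<in> Arr C"
  shows "map_path g \<in> Arr C" "Dom C (map_path g) = Path (Dom C g)" "Cod C (map_path g) = Path (Cod C g)"
  using assms by (simp_all add: map_path_def)

lemma ev_map_path [simp]:
  assumes "k = 0 \<or> k = 1" "g \<in> Arr C" "Cod C g = Y"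
  shows "ev k Y \<cdot> map_path g = g \<cdot> ev k (Dom C g)"
proof -
  have "ev k Y \<cdot> map_path g = (g \<cdot> path_eval (Dom C g)) \<cdot> end_at k (Path (Dom C g))"
    using assms by (auto simp: map_path_def)
  also have "\<dots> = g \<cdot> ev k (Dom C g)" using assms by auto
  finally show ?thesis .
qed

lemma ev_map_path_comp [simp]:
  assumes "k = 0 \<or> k = 1" "g \<in> Arr C" "Cod C g = Y" "w \<in> Arr C" "Cod C w = Path (Dom C g)"
  shows "ev k Y \<cdot> (map_path g \<cdot> w) = g \<cdot> (ev k (Dom C g) \<cdot> w)"
proof -
  have "ev k Y \<cdot> (map_path g \<cdot> w) = (ev k Y \<cdot> map_path g) \<cdot> w" using assms by (subst Comp_assoc_simp) auto
  then show ?thesis using assms by simp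
qed

subsection \<open>Lifting against cells and box filling\<close>

lemma has_lift_Cof: "i \<in> Cof \<Longrightarrow> p \<in> Fib\<^sub>I \<Longrightarrow> has_lift C i p"
  by (rule has_lift_cof[OF _ _ gen_cof_Arr])

lemma has_lift_Cof\<^sub>J: "i \<in> Cof\<^sub>J \<Longrightarrow> p \<in> Fib \<Longrightarrow> has_lift C i p"
  by (rule has_lift_cof[OF _ _ gen_triv_cof_Arr])

lemma factor_Cof:
  assumes f: "f \<in> hom C A B"
  obtains i p Z where "i \<in> cell U C (gen_cof \<iota>)" "i \<in> Cof" "p \<in> Fib\<^sub>I" "i \<in> hom C A Z" "p \<in> hom C Z B" "f = p \<cdot> i"
proof -
  have sm: "small_relative_to U C (Dom C (inc n)) (cell U C (gen_cof \<iota>))" for n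
    using small_\<S> by simp
  obtain i p Z where *: "i \<in> cell U C (gen_cof \<iota>)" "p \<in> Fib\<^sub>I" "i \<in> hom C A Z" "p \<in> hom C Z B" "f = p \<cdot> i"
    by (rule small_object_argument[OF gen_cof_def gen_cof_Arr locally_small sm f]) blast
  from that[OF *(1) cell_cof[OF *(1,3)] *(2-5)] show ?thesis .
qed

text \<open>The retract argument, applied to a factorization of \<open>i\<close> itself. It gives
  access to \<open>Cof\<close> without exhibiting a cell complex.\<close>

lemma Cof_I:
  assumes i: "i \<in> Arr C" and lift: "\<And>p. p \<in> Fib\<^sub>I \<Longrightarrow> has_lift C i p"
  shows "i \<in> Cof"
proof -
  obtain j p Z where *: "j \<in> cell U C (gen_cof \<iota>)" "p \<in> Fib\<^sub>I" "j \<in> hom C (Dom C i) Z" "p \<in> hom C Z (Cod C i)" "i = p \<cdot> j"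
    by (rule factor_Cof[OF Arr_hom[OF i]]) blast
  have "is_retract C i j" using retract_of_factorization[OF *(3,4)] lift[OF *(2)] unfolding *(5) .
  with *(1) show ?thesis unfolding cof_def by blast
qed

lemma factor_Cof\<^sub>J:
  assumes f: "f \<in> hom C A B"
  obtains i p Z where "i \<in> Cof\<^sub>J" "p \<in> Fib" "i \<in> hom C A Z" "p \<in> hom C Z B" "f = p \<cdot> i"
proof -
  have sm: "small_relative_to U C (Dom C (onArr \<iota> (inclusion (cube n) (cube (Suc n))))) (cell U C (gen_triv_cof \<iota>))" for n
    unfolding in_hom[OF gen_triv_cof_in] by (rule small_\<D>)
  obtain i p Z where *: "i \<in> cell U C (gen_triv_cof \<iota>)" "p \<in> Fib" "i \<in> hom C A Z" "p \<in> hom C Z B" "f = p \<cdot> i"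
    by (rule small_object_argument[OF gen_triv_cof_def gen_triv_cof_Arr locally_small sm f]) blast
  from that[OF cell_cof[OF *(1,3)] *(2-5)] show ?thesis .
qed

lemma Fib\<^sub>I_subset_Fib: "Fib\<^sub>I \<subseteq> Fib"
  using has_lift_Cof Q4(1) unfolding rlp_def[of _ "gen_triv_cof \<iota>"] by (auto simp: rlp_def)

text \<open>The axiom covers the generators only. The remaining members are reached through lifting,
  since every map in \<open>Fib\<^sub>I\<close> is a fibration.\<close>

lemma Cof\<^sub>J_subset_Cof: "Cof\<^sub>J \<subseteq> Cof"
proof
  fix i assume i: "i \<in> Cof\<^sub>J"
  then have "i \<in> Arr C" unfolding cof_def is_retract_def by blast
  then show "i \<in> Cof" by (rule Cof_I) (use i has_lift_Cof\<^sub>J Fib\<^sub>I_subset_Fib in blast)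
qed

text \<open>Each generating trivial cofibration is split by a cube projection, so a map from the
  smaller cube extends by composing with it.\<close>

lemma bang_Fib:
  assumes Y: "Y \<in> Ob C"
  shows "bang Y \<in> Fib"
  unfolding rlp_def mem_Collect_eq gen_triv_cof_def
proof (intro conjI ballI, goal_cases)
  case 1
  show ?case using Y by simp
next
  case (2 j)
  then obtain n where j: "j = onArr \<iota> (inclusion (cube n) (cube (Suc n)))" by blast
  have jh: "j \<in> hom C (\<D> n) (\<D> (Suc n))" unfolding j by (rule gen_triv_cof_in)
  let ?q = "onArr \<iota> (cube_projection n)"
  have q: "?q \<in> hom C (\<D> (Suc n)) (\<D> n)" by (rule \<iota>_hom[OF cube_projection_in])
  have qj: "?q \<cdot> j = Idt C (\<D> n)"
    unfolding j using \<iota>_comp[OF inclusion_in_Box(2) cube_projection_in] cube_projection_inclusion \<iota>_Idt[of "cube n"] by simp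
  show ?case
  proof (rule has_liftI[OF jh bang_in[OF Y]])
    fix u v assume u: "u \<in> hom C (\<D> n) Y" and v: "v \<in> hom C (\<D> (Suc n)) (\<D> 0)"
    have "(u \<cdot> ?q) \<cdot> j = u" using Comp_assoc[OF jh q u] qj u by simp
    moreover have "bang Y \<cdot> (u \<cdot> ?q) = v" by (rule terminal_eq[OF Comp_in[OF Comp_in[OF q u] bang_in[OF Y]] v])
    ultimately show "\<exists>h\<in>hom C (\<D> (Suc n)) Y. h \<cdot> j = u \<and> bang Y \<cdot> h = v" using Comp_in[OF q u] by blast
  qed
qed

text \<open>Homotopy extension and covering homotopies in one statement, because the pushout product
  of \<open>inc n\<close> with the inclusion of the endpoint 0 lies in
  \<open>Cof\<^sub>J\<close>.\<close>

lemma lift_cylinder: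
  assumes p: "p \<in> Fib" "p \<in> hom C E F" and a: "a \<in> hom C (\<D> n) E" and H: "H \<in> hom C (Cyl (\<S> n)) E"
    and G: "G \<in> hom C (Cyl (\<D> n)) F" and Ha: "H \<cdot> end_at 0 (\<S> n) = a \<cdot> inc n"
    and Ga: "G \<cdot> end_at 0 (\<D> n) = p \<cdot> a" and GH: "G \<cdot> cyl (inc n) = p \<cdot> H"
  obtains K where "K \<in> hom C (Cyl (\<D> n)) E" "K \<cdot> end_at 0 (\<D> n) = a" "K \<cdot> cyl (inc n) = H" "p \<cdot> K = G"
proof -
  define e where "e = onArr \<iota> (endpoint 0 (cube 1))"
  have e: "e \<in> hom C (\<D> 0) \<I>" unfolding e_def by (rule endpoint_in(1)) simp
  have end_at: "end_at 0 X = point_section e X" for X by (simp add: at_endpoint_eq e_def)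
  have "e \<in> gen_triv_cof \<iota>" unfolding e_def gen_triv_cof_def inclusion_cube_0_1[symmetric] by blast
  then have lift: "has_lift C h p" if "is_pushout_product C (inc n) e h" for h
    using that Q3(2) p(1) unfolding pushout_products_def gen_cof_def by (blast intro: has_lift_Cof\<^sub>J)
  have pr: "pr1 C (\<D> n) (\<D> 0) \<in> hom C (times_ob C (\<D> n) (\<D> 0)) (\<D> n)" by (intro pr1_in) simp_all
  have pr': "pr1 C (\<S> n) (\<D> 0) \<in> hom C (times_ob C (\<S> n) (\<D> 0)) (\<S> n)" by (intro pr1_in) simp_all
  note s = in_hom[OF a] in_hom[OF H] in_hom[OF G] in_hom[OF p(2)] in_hom[OF e]
  \<comment> \<open>The corner contains the product of the disk with the point, so \<open>a\<close>
    is first pulled back along the projection.\<close>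
  have 1: "(a \<cdot> pr1 C (\<D> n) (\<D> 0)) \<cdot> times_arr C (inc n) (Idt C (\<D> 0)) = H \<cdot> times_arr C (Idt C (\<S> n)) e"
  proof -
    have "(a \<cdot> pr1 C (\<D> n) (\<D> 0)) \<cdot> times_arr C (inc n) (Idt C (\<D> 0)) = (a \<cdot> inc n) \<cdot> pr1 C (\<S> n) (\<D> 0)"
      using pr1_times_arr[OF inc_in[of n] Idt_in[of "\<D> 0"]] by (simp add: s)
    also have "\<dots> = H \<cdot> (point_section e (\<S> n) \<cdot> pr1 C (\<S> n) (\<D> 0))"
      unfolding Ha[symmetric] by (simp add: s end_at[symmetric])
    finally show ?thesis using point_section_pr1[OF e, of "\<S> n"] by simp
  qed
  have 2: "p \<cdot> (a \<cdot> pr1 C (\<D> n) (\<D> 0)) = G \<cdot> times_arr C (Idt C (\<D> n)) e"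
  proof -
    have "p \<cdot> (a \<cdot> pr1 C (\<D> n) (\<D> 0)) = (p \<cdot> a) \<cdot> pr1 C (\<D> n) (\<D> 0)" by (simp add: s)
    also have "\<dots> = G \<cdot> (point_section e (\<D> n) \<cdot> pr1 C (\<D> n) (\<D> 0))"
      unfolding Ga[symmetric] by (simp add: s end_at[symmetric])
    finally show ?thesis using point_section_pr1[OF e, of "\<D> n"] by simp
  qed
  obtain K where K: "K \<in> hom C (Cyl (\<D> n)) E" "K \<cdot> times_arr C (Idt C (\<D> n)) e = a \<cdot> pr1 C (\<D> n) (\<D> 0)"
    "K \<cdot> cyl (inc n) = H" "p \<cdot> K = G"
    using pushout_product_lift[OF lift inc_in e p(2) Comp_in[OF pr a] H G 1 2 GH[symmetric]] by blast
  \<comment> \<open>The inverse of that projection brings the result back to the disk.\<close>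
  define \<sigma> where "\<sigma> = point_section (Idt C (\<D> 0)) (\<D> n)"
  have \<sigma>: "\<sigma> \<in> hom C (\<D> n) (times_ob C (\<D> n) (\<D> 0))" "pr1 C (\<D> n) (\<D> 0) \<cdot> \<sigma> = Idt C (\<D> n)"
    unfolding \<sigma>_def by (simp_all add: point_section_in pr1_point_section Idt_in)
  have "times_arr C (Idt C (\<D> n)) e \<cdot> \<sigma> = end_at 0 (\<D> n)"
    unfolding \<sigma>_def end_at using times_arr_Idt_point_section[OF Idt_in[of "\<D> 0"] e, of "\<D> n"] e by simp
  then have "K \<cdot> end_at 0 (\<D> n) = (K \<cdot> times_arr C (Idt C (\<D> n)) e) \<cdot> \<sigma>"
    by (simp add: in_hom[OF K(1)] in_hom[OF \<sigma>(1)] s)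
  also have "\<dots> = a" unfolding K(2) by (simp add: in_hom[OF \<sigma>(1)] s \<sigma>(2))
  finally show ?thesis using K that by blast
qed

text \<open>By adjunction a square against \<open>ev 0 Y\<close> is a homotopy on the sphere whose
  start is extended to the disk; as \<open>Y\<close> is fibrant, the whole homotopy extends.\<close>

lemma ev_0_Fib\<^sub>I:
  assumes Y: "Y \<in> Ob C"
  shows "ev 0 Y \<in> Fib\<^sub>I"
  unfolding rlp_def mem_Collect_eq gen_cof_def
proof (intro conjI ballI, goal_cases)
  case 1
  show ?case using Y by simp
next
  case (2 i)
  then obtain n where i: "i = inc n" by blast
  have "ev 0 Y \<in> hom C (Path Y) Y" using Y by (simp add: hom_def)
  from inc_in this show ?case unfolding i
  proof (rule has_liftI)
    fix u v assume u: "u \<in> hom C (\<S> n) (Path Y)" and v: "v \<in> hom C (\<D> n) Y" and uv: "ev 0 Y \<cdot> u = v \<cdot> inc n"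
    note s = in_hom[OF u] in_hom[OF v] Y
    obtain K where K: "K \<in> hom C (Cyl (\<D> n)) Y" "K \<cdot> end_at 0 (\<D> n) = v" "K \<cdot> cyl (inc n) = path_eval Y \<cdot> cyl u"
      by (rule lift_cylinder[OF bang_Fib[OF Y] bang_in[OF Y] v, of "path_eval Y \<cdot> cyl u" "bang (Cyl (\<D> n))"])
        (use uv in \<open>simp_all add: s hom_def\<close>)
    show "\<exists>h\<in>hom C (\<D> n) (Path Y). h \<cdot> inc n = u \<and> ev 0 Y \<cdot> h = v"
      using K by (intro bexI[of _ "path_of (\<D> n) Y K"]) (simp_all add: s hom_def path_of_comp)
  qed
qed

text \<open>The reflection of the interval exchanges the two evaluations.\<close>

lemma ev_Fib\<^sub>I:
  assumes Y: "Y \<in> Ob C" and k: "k = 0 \<or> k = 1"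
  shows "ev k Y \<in> Fib\<^sub>I"
proof (cases "k = 0")
  case True
  then show ?thesis using ev_0_Fib\<^sub>I[OF Y] by simp
next
  case False
  with k have k: "k = 1" by simp
  let ?P = "Path Y" and ?e = "path_eval Y"
  have P: "?P \<in> Ob C" using Y by simp
  define \<rho> where "\<rho> = onArr \<iota> cube_reflection"
  have \<rho>: "\<rho> \<in> hom C \<I> \<I>" unfolding \<rho>_def by (rule \<iota>_hom[OF cube_reflection_in])
  have \<rho>\<rho>: "\<rho> \<cdot> \<rho> = Idt C \<I>"
    unfolding \<rho>_def using \<iota>_comp[OF cube_reflection_in cube_reflection_in] cube_reflection_involution \<iota>_Idt[of "cube 1"] by simp
  define R where "R = times_arr C (Idt C ?P) \<rho>"
  have R: "R \<in> hom C (Cyl ?P) (Cyl ?P)" unfolding R_def by (rule times_arr_in[OF Idt_in[OF P] \<rho>])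
  have RR: "R \<cdot> R = Idt C (Cyl ?P)"
    unfolding R_def using times_arr_comp[OF Idt_in[OF P] \<rho> Idt_in[OF P] \<rho>] \<rho>\<rho> P by simp
  have R_end: "R \<cdot> end_at l ?P = end_at (1 - l) ?P" if l: "l = 0 \<or> l = 1" for l
    unfolding R_def at_endpoint_eq times_arr_Idt_point_section[OF endpoint_in(1)[OF l] \<rho> P]
    using \<iota>_comp[OF endpoint_in_Box(1)[OF l] cube_reflection_in] cube_reflection_endpoint[OF l] by (simp add: \<rho>_def)
  \<comment> \<open>Path reversal, the transpose of evaluating after time has been
    reflected.\<close>
  define flip where "flip = path_of ?P Y (?e \<cdot> R)"
  note s = in_hom[OF R] Y
  have flip: "flip \<in> hom C ?P ?P" "?e \<cdot> cyl flip = ?e \<cdot> R" unfolding flip_def by (simp_all add: s hom_def)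
  have ev_flip: "ev l Y \<cdot> flip = ev (1 - l) Y" if l: "l = 0 \<or> l = 1" for l
    unfolding flip_def using l R_end[OF l] by (auto simp: s)
  have commute: "R \<cdot> cyl flip = cyl flip \<cdot> R"
    unfolding R_def
    using times_arr_comp[OF Idt_in[OF P] \<rho> flip(1) Idt_in[of \<I>]] times_arr_comp[OF flip(1) Idt_in[of \<I>] Idt_in[OF P] \<rho>] P
    by (simp add: in_hom[OF \<rho>] in_hom[OF flip(1)])
  have "?e \<cdot> cyl (flip \<cdot> flip) = (?e \<cdot> cyl flip) \<cdot> cyl flip"
    by (simp add: cyl_comp in_hom[OF flip(1)] Y)
  also have "\<dots> = ?e \<cdot> (R \<cdot> cyl flip)" unfolding flip(2) by (simp add: in_hom[OF flip(1)] s)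
  also have "\<dots> = (?e \<cdot> cyl flip) \<cdot> R" unfolding commute by (simp add: in_hom[OF flip(1)] s)
  also have "\<dots> = ?e \<cdot> (R \<cdot> R)" unfolding flip(2) by (simp add: s)
  finally have ff: "flip \<cdot> flip = Idt C ?P"
    by (intro path_eqI[OF Comp_in[OF flip(1) flip(1)] Idt_in[OF P] Y]) (simp add: RR s)
  show ?thesis
    unfolding rlp_def mem_Collect_eq k gen_cof_def
  proof (intro conjI ballI, goal_cases)
    case 1
    show ?case using Y by simp
  next
    case (2 i)
    then obtain n where i: "i = inc n" by blast
    have ev: "ev l Y \<in> hom C ?P Y" if "l = 0 \<or> l = 1" for l using Y that by (simp add: hom_def)
    from inc_in ev[of 1] show ?case unfolding i
    proof (rule has_liftI)
      fix u v assume u: "u \<in> hom C (\<S> n) ?P" and v: "v \<in> hom C (\<D> n) Y" and uv: "ev 1 Y \<cdot> u = v \<cdot> inc n"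
      \<comment> \<open>The reversed square lies over \<open>ev 0 Y\<close>; its lift is reversed
        back, which works because \<open>flip\<close> is an involution.\<close>
      have "ev 0 Y \<cdot> (flip \<cdot> u) = v \<cdot> inc n"
        using Comp_assoc[OF u flip(1) ev[of 0]] ev_flip[of 0] uv by simp
      then obtain h where h: "h \<in> hom C (\<D> n) ?P" "h \<cdot> inc n = flip \<cdot> u" "ev 0 Y \<cdot> h = v"
        using ev_0_Fib\<^sub>I[OF Y] has_liftD[OF _ inc_in ev[of 0] Comp_in[OF u flip(1)] v]
        unfolding rlp_def gen_cof_def by blast
      have "(flip \<cdot> h) \<cdot> inc n = u"
        using Comp_assoc[OF inc_in h(1) flip(1)] h(2) Comp_assoc[OF u flip(1) flip(1)] ff u by simp
      moreover have "ev 1 Y \<cdot> (flip \<cdot> h) = v"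
        using Comp_assoc[OF h(1) flip(1) ev[of 1]] ev_flip[of 1] h(3) by simp
      ultimately show "\<exists>h\<in>hom C (\<D> n) ?P. h \<cdot> inc n = u \<and> ev 1 Y \<cdot> h = v" using Comp_in[OF h(1) flip(1)] by blast
    qed simp
  qed
qed

lemma lift_inc:
  assumes "p \<in> Fib\<^sub>I" "p \<in> hom C E F" "u \<in> hom C (\<S> n) E" "v \<in> hom C (\<D> n) F" "p \<cdot> u = v \<cdot> inc n"
  obtains h where "h \<in> hom C (\<D> n) E" "h \<cdot> inc n = u" "p \<cdot> h = v"
proof -
  have "has_lift C (inc n) p" using assms(1) unfolding rlp_def gen_cof_def by blast
  from has_liftD[OF this inc_in assms(2-5)] that show ?thesis by blast
qed

text \<open>The whole boundary of the prism is prescribed. By the coproduct axiom the two lids form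
  one map on the product with the boundary of the interval, and the pushout product of
  \<open>inc n\<close> with \<open>inc 1\<close> is a cofibration.\<close>

lemma lift_square:
  assumes q: "q \<in> Fib\<^sub>I" "q \<in> hom C E F" and c: "c0 \<in> hom C (\<D> n) E" "c1 \<in> hom C (\<D> n) E"
    and d: "d \<in> hom C (Cyl (\<S> n)) E" and G: "G \<in> hom C (Cyl (\<D> n)) F"
    and dc: "d \<cdot> end_at 0 (\<S> n) = c0 \<cdot> inc n" "d \<cdot> end_at 1 (\<S> n) = c1 \<cdot> inc n"
    and Gc: "G \<cdot> end_at 0 (\<D> n) = q \<cdot> c0" "G \<cdot> end_at 1 (\<D> n) = q \<cdot> c1" and Gd: "G \<cdot> cyl (inc n) = q \<cdot> d"
  obtains M where "M \<in> hom C (Cyl (\<D> n)) E" "M \<cdot> end_at 0 (\<D> n) = c0" "M \<cdot> end_at 1 (\<D> n) = c1"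
    "M \<cdot> cyl (inc n) = d" "q \<cdot> M = G"
proof -
  \<comment> \<open>The inclusions of the coproduct axiom are indexed by the real numbers 0 and 1,
    so the lids become a family over the reals.\<close>
  define c where "c = (\<lambda>k :: real. if k = 0 then c0 else c1)"
  let ?b = "\<lambda>k X. at_endpoint C \<iota> k (cube_boundary 1) X"
  have ch: "c k \<in> hom C (\<D> n) E" for k using c by (simp add: c_def)
  have dck: "d \<cdot> end_at k (\<S> n) = c k \<cdot> inc n" and Gck: "G \<cdot> end_at k (\<D> n) = q \<cdot> c k" if "k = 0 \<or> k = 1" for k
    using that dc Gc by (auto simp: c_def)
  obtain a where a: "a \<in> hom C (times_ob C (\<D> n) (\<S> 1)) E" "\<And>k. k \<in> {0, 1} \<Longrightarrow> a \<cdot> ?b k (\<D> n) = c k"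
    using coproduct_mediating[OF coproduct_\<S>1[OF \<iota>_Ob(1)] Ob_of_hom(2)[OF c(1)], of c] ch by blast
  have b: "?b k X \<in> hom C X (times_ob C X (\<S> 1))" if "k \<in> {0, 1}" "X \<in> Ob C" for k X
    using at_boundary_in that by blast
  have lift: "has_lift C h q" if "is_pushout_product C (inc n) (inc 1) h" for h
  proof -
    have "h \<in> pushout_products C (gen_cof \<iota>) (gen_cof \<iota>)"
      using that unfolding pushout_products_def gen_cof_def by blast
    with Q3(1) q(1) show ?thesis by (blast intro: has_lift_Cof)
  qed
  note f1 = times_arr_in[OF inc_in Idt_in[of "\<S> 1"], of n] and f2 = times_arr_in[OF Idt_in[of "\<S> n"] inc_in[of 1]]
    and f3 = times_arr_in[OF Idt_in[of "\<D> n"] inc_in[of 1]]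
  have 1: "a \<cdot> times_arr C (inc n) (Idt C (\<S> 1)) = d \<cdot> times_arr C (Idt C (\<S> n)) (inc 1)"
  proof (rule coproduct_eqI[OF coproduct_\<S>1[of "\<S> n"]])
    fix k :: real assume k: "k \<in> {0, 1}"
    have "(a \<cdot> times_arr C (inc n) (Idt C (\<S> 1))) \<cdot> ?b k (\<S> n) = a \<cdot> (times_arr C (inc n) (Idt C (\<S> 1)) \<cdot> ?b k (\<S> n))"
      using Comp_assoc[OF b[OF k] f1 a(1)] by simp
    also have "\<dots> = (a \<cdot> ?b k (\<D> n)) \<cdot> inc n"
      using times_arr_point_section[OF endpoint_in(2) inc_in, of k n] k Comp_assoc[OF inc_in b[OF k] a(1)]
      by (simp add: at_endpoint_eq)
    also have "\<dots> = d \<cdot> (times_arr C (Idt C (\<S> n)) (inc 1) \<cdot> ?b k (\<S> n))"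
      using a(2)[OF k] dck k inc_end_at[of k "\<S> n"] by simp
    also have "\<dots> = (d \<cdot> times_arr C (Idt C (\<S> n)) (inc 1)) \<cdot> ?b k (\<S> n)"
      using Comp_assoc[OF b[OF k] f2 d] by simp
    finally show "(a \<cdot> times_arr C (inc n) (Idt C (\<S> 1))) \<cdot> ?b k (\<S> n) =
        (d \<cdot> times_arr C (Idt C (\<S> n)) (inc 1)) \<cdot> ?b k (\<S> n)" .
  qed (use Comp_in[OF f1 a(1)] Comp_in[OF f2 d] in simp_all)
  have 2: "q \<cdot> a = G \<cdot> times_arr C (Idt C (\<D> n)) (inc 1)"
  proof (rule coproduct_eqI[OF coproduct_\<S>1[of "\<D> n"]])
    fix k :: real assume k: "k \<in> {0, 1}"
    have "(q \<cdot> a) \<cdot> ?b k (\<D> n) = q \<cdot> c k" using Comp_assoc[OF b[OF k] a(1) q(2)] a(2)[OF k] by simp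
    also have "\<dots> = G \<cdot> (times_arr C (Idt C (\<D> n)) (inc 1) \<cdot> ?b k (\<D> n))"
      using Gck k inc_end_at[of k "\<D> n"] by simp
    also have "\<dots> = (G \<cdot> times_arr C (Idt C (\<D> n)) (inc 1)) \<cdot> ?b k (\<D> n)"
      using Comp_assoc[OF b[OF k] f3 G] by simp
    finally show "(q \<cdot> a) \<cdot> ?b k (\<D> n) = (G \<cdot> times_arr C (Idt C (\<D> n)) (inc 1)) \<cdot> ?b k (\<D> n)" .
  qed (use Comp_in[OF a(1) q(2)] Comp_in[OF f3 G] in simp_all)
  obtain M where M: "M \<in> hom C (Cyl (\<D> n)) E" "M \<cdot> times_arr C (Idt C (\<D> n)) (inc 1) = a"
    "M \<cdot> cyl (inc n) = d" "q \<cdot> M = G"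
    using pushout_product_lift[OF lift inc_in inc_in q(2) a(1) d G 1 2 Gd[symmetric]] by blast
  have "M \<cdot> end_at k (\<D> n) = c k" if k: "k \<in> {0, 1}" for k
    using inc_end_at[of k "\<D> n"] k Comp_assoc[OF b[OF k] f3 M(1)] M(2) a(2)[OF k] by simp
  from this[of 0] this[of 1] M that show ?thesis by (simp add: c_def)
qed

text \<open>Box filling takes the place of concatenating and reversing homotopies.\<close>

lemma box_filling:
  assumes Y: "Y \<in> Ob C" and kl: "k = 0 \<or> k = 1" "l = 0 \<or> l = 1"
    and \<gamma>: "\<gamma>0 \<in> hom C (\<D> n) (Path Y)" "\<gamma>1 \<in> hom C (\<D> n) (Path Y)" and \<delta>: "\<delta> \<in> hom C (Cyl (\<S> n)) (Path Y)"
    and G: "G \<in> hom C (Cyl (\<D> n)) Y"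
    and \<delta>\<gamma>: "\<delta> \<cdot> end_at 0 (\<S> n) = \<gamma>0 \<cdot> inc n" "\<delta> \<cdot> end_at 1 (\<S> n) = \<gamma>1 \<cdot> inc n"
    and G\<gamma>: "G \<cdot> end_at 0 (\<D> n) = ev k Y \<cdot> \<gamma>0" "G \<cdot> end_at 1 (\<D> n) = ev k Y \<cdot> \<gamma>1"
    and G\<delta>: "G \<cdot> cyl (inc n) = ev k Y \<cdot> \<delta>"
  obtains N where "N \<in> hom C (Cyl (\<D> n)) Y" "N \<cdot> end_at 0 (\<D> n) = ev l Y \<cdot> \<gamma>0"
    "N \<cdot> end_at 1 (\<D> n) = ev l Y \<cdot> \<gamma>1" "N \<cdot> cyl (inc n) = ev l Y \<cdot> \<delta>"
proof -
  have ev: "ev k Y \<in> hom C (Path Y) Y" using Y kl by (simp add: hom_def)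
  \<comment> \<open>The faces given are those lying over \<open>ev k Y\<close> together with the
    sides; the missing face is the image of the filler under \<open>ev l Y\<close>.\<close>
  obtain M where M: "M \<in> hom C (Cyl (\<D> n)) (Path Y)" "M \<cdot> end_at 0 (\<D> n) = \<gamma>0" "M \<cdot> end_at 1 (\<D> n) = \<gamma>1"
    "M \<cdot> cyl (inc n) = \<delta>"
    by (rule lift_square[OF ev_Fib\<^sub>I[OF Y kl(1)] ev \<gamma> \<delta> G \<delta>\<gamma> G\<gamma> G\<delta>]) blast
  show ?thesis
    by (rule that[of "ev l Y \<cdot> M"]) (use M kl Y in_hom[OF M(1)] in \<open>simp_all add: hom_def\<close>)
qed

subsection \<open>Weak equivalences\<close>

lemma homotopic_rel_iff:
  assumes f: "f \<in> hom C X Y" and g: "g \<in> hom C X Y" and i: "i \<in> hom C A X"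
  shows "homotopic_rel C \<iota> i f g \<longleftrightarrow> f \<cdot> i = g \<cdot> i \<and>
    (\<exists>H\<in>hom C (Cyl X) Y. H \<cdot> end_at 0 X = f \<and> H \<cdot> end_at 1 X = g \<and> H \<cdot> cyl i = (f \<cdot> i) \<cdot> proj A)"
  using assms unfolding homotopic_rel_def by (auto simp: hom_def)

definition weq :: "'m set" where "weq = {f \<in> Arr C. \<forall>n. n_connected C \<iota> n f}"

lemma weq_iff: "f \<in> weq \<longleftrightarrow> f \<in> Arr C \<and> (\<forall>n. n_compressible C \<iota> n f)"
  unfolding weq_def n_connected_def by blast

lemma weqD:
  assumes "f \<in> weq" and f: "f \<in> hom C X Y" and u: "u \<in> hom C (\<S> n) X" and v: "v \<in> hom C (\<D> n) Y"
    and uv: "f \<cdot> u = v \<cdot> inc n"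
  obtains h H where "h \<in> hom C (\<D> n) X" "h \<cdot> inc n = u" "H \<in> hom C (Cyl (\<D> n)) Y"
    "H \<cdot> end_at 0 (\<D> n) = f \<cdot> h" "H \<cdot> end_at 1 (\<D> n) = v" "H \<cdot> cyl (inc n) = (v \<cdot> inc n) \<cdot> proj (\<S> n)"
proof -
  have "n_compressible C \<iota> n f" using assms(1) unfolding weq_iff by blast
  then obtain h where h: "h \<in> hom C (\<D> n) X" "h \<cdot> inc n = u" "homotopic_rel C \<iota> (inc n) (f \<cdot> h) v"
    using u v uv unfolding n_compressible_def in_hom[OF f] by blast
  show ?thesis
    using that h homotopic_rel_iff[OF Comp_in[OF h(1) f] v inc_in] by metis
qed

lemma weqI:
  assumes f: "f \<in> hom C X Y"
    and "\<And>n u v. u \<in> hom C (\<S> n) X \<Longrightarrow> v \<in> hom C (\<D> n) Y \<Longrightarrow> f \<cdot> u = v \<cdot> inc n \<Longrightarrow>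
      \<exists>h\<in>hom C (\<D> n) X. h \<cdot> inc n = u \<and> (\<exists>H\<in>hom C (Cyl (\<D> n)) Y. H \<cdot> end_at 0 (\<D> n) = f \<cdot> h \<and>
        H \<cdot> end_at 1 (\<D> n) = v \<and> H \<cdot> cyl (inc n) = (v \<cdot> inc n) \<cdot> proj (\<S> n))"
  shows "f \<in> weq"
  unfolding weq_iff n_compressible_def in_hom[OF f]
proof (intro conjI allI ballI impI)
  show "f \<in> Arr C" "f \<in> Arr C" using in_hom[OF f] by blast+
  fix n u v assume u: "u \<in> hom C (\<S> n) X" and v: "v \<in> hom C (\<D> n) Y" and uv: "f \<cdot> u = v \<cdot> inc n"
  obtain h H where h: "h \<in> hom C (\<D> n) X" "h \<cdot> inc n = u" and H: "H \<in> hom C (Cyl (\<D> n)) Y"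
    "H \<cdot> end_at 0 (\<D> n) = f \<cdot> h" "H \<cdot> end_at 1 (\<D> n) = v" "H \<cdot> cyl (inc n) = (v \<cdot> inc n) \<cdot> proj (\<S> n)"
    using assms(2)[OF u v uv] by blast
  have "(f \<cdot> h) \<cdot> inc n = v \<cdot> inc n" using Comp_assoc[OF inc_in h(1) f] h(2) uv by simp
  with H have "homotopic_rel C \<iota> (inc n) (f \<cdot> h) v"
    unfolding homotopic_rel_iff[OF Comp_in[OF h(1) f] v inc_in] by auto
  with h show "\<exists>h\<in>hom C (\<D> n) X. h \<cdot> inc n = u \<and> homotopic_rel C \<iota> (inc n) (f \<cdot> h) v" by blast
qed

text \<open>A strict lift compresses with the constant homotopy.\<close>

lemma Fib\<^sub>I_subset_weq: "Fib\<^sub>I \<subseteq> weq"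
proof
  fix p assume p: "p \<in> Fib\<^sub>I"
  then have ph: "p \<in> hom C (Dom C p) (Cod C p)" by (simp add: rlp_def hom_def)
  show "p \<in> weq"
  proof (rule weqI[OF ph])
    fix n u v assume u: "u \<in> hom C (\<S> n) (Dom C p)" and v: "v \<in> hom C (\<D> n) (Cod C p)" and uv: "p \<cdot> u = v \<cdot> inc n"
    obtain h where h: "h \<in> hom C (\<D> n) (Dom C p)" "h \<cdot> inc n = u" "p \<cdot> h = v" by (rule lift_inc[OF p ph u v uv]) blast
    have "v \<cdot> proj (\<D> n) \<in> hom C (Cyl (\<D> n)) (Cod C p)" "(v \<cdot> proj (\<D> n)) \<cdot> end_at 0 (\<D> n) = v"
      "(v \<cdot> proj (\<D> n)) \<cdot> end_at 1 (\<D> n) = v" "(v \<cdot> proj (\<D> n)) \<cdot> cyl (inc n) = (v \<cdot> inc n) \<cdot> proj (\<S> n)"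
      by (simp_all add: hom_def in_hom[OF v])
    with h show "\<exists>h\<in>hom C (\<D> n) (Dom C p). h \<cdot> inc n = u \<and> (\<exists>H\<in>hom C (Cyl (\<D> n)) (Cod C p). H \<cdot> end_at 0 (\<D> n) = p \<cdot> h \<and>
        H \<cdot> end_at 1 (\<D> n) = v \<and> H \<cdot> cyl (inc n) = (v \<cdot> inc n) \<cdot> proj (\<S> n))"
      by metis
  qed
qed

text \<open>The compressing homotopy starts at \<open>p \<cdot> h\<close> and ends at
  \<open>v\<close>. Lifted through the fibration from \<open>h\<close> on, constantly over the
  sphere, it ends at a strict lift of \<open>v\<close>.\<close>

lemma Fib_weq_subset_Fib\<^sub>I: "Fib \<inter> weq \<subseteq> Fib\<^sub>I"
proof
  fix p assume p: "p \<in> Fib \<inter> weq"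
  then have ph: "p \<in> hom C (Dom C p) (Cod C p)" by (simp add: rlp_def hom_def)
  have "has_lift C (inc n) p" for n
  proof (rule has_liftI[OF inc_in ph])
    fix u v assume u: "u \<in> hom C (\<S> n) (Dom C p)" and v: "v \<in> hom C (\<D> n) (Cod C p)" and uv: "p \<cdot> u = v \<cdot> inc n"
    obtain h H where h: "h \<in> hom C (\<D> n) (Dom C p)" "h \<cdot> inc n = u" and H: "H \<in> hom C (Cyl (\<D> n)) (Cod C p)"
      "H \<cdot> end_at 0 (\<D> n) = p \<cdot> h" "H \<cdot> end_at 1 (\<D> n) = v" "H \<cdot> cyl (inc n) = (v \<cdot> inc n) \<cdot> proj (\<S> n)"
      using weqD[OF _ ph u v uv] p by blast
    note s = in_hom[OF u] in_hom[OF v] in_hom[OF h(1)] in_hom[OF H(1)] in_hom(1)[OF ph]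
    have "H \<cdot> cyl (inc n) = p \<cdot> (u \<cdot> proj (\<S> n))"
      unfolding H(4) uv[symmetric] by (simp add: s)
    then obtain K where K: "K \<in> hom C (Cyl (\<D> n)) (Dom C p)" "K \<cdot> cyl (inc n) = u \<cdot> proj (\<S> n)" "p \<cdot> K = H"
      using lift_cylinder[of p "Dom C p" "Cod C p" h n "u \<cdot> proj (\<S> n)" H] p ph h H by (auto simp: s hom_def)
    have "(K \<cdot> end_at 1 (\<D> n)) \<cdot> inc n = (K \<cdot> cyl (inc n)) \<cdot> end_at 1 (\<S> n)"
      by (simp add: in_hom[OF K(1)])
    also have "\<dots> = u" unfolding K(2) by (simp add: s)
    finally have "(K \<cdot> end_at 1 (\<D> n)) \<cdot> inc n = u" .
    moreover have "p \<cdot> (K \<cdot> end_at 1 (\<D> n)) = (p \<cdot> K) \<cdot> end_at 1 (\<D> n)" by (simp add: in_hom[OF K(1)] s)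
    moreover have "K \<cdot> end_at 1 (\<D> n) \<in> hom C (\<D> n) (Dom C p)" by (simp add: in_hom[OF K(1)] hom_def)
    ultimately show "\<exists>h\<in>hom C (\<D> n) (Dom C p). h \<cdot> inc n = u \<and> p \<cdot> h = v"
      using K(3) H(3) by auto
  qed
  with in_hom(1)[OF ph] show "p \<in> Fib\<^sub>I" unfolding rlp_def gen_cof_def by blast
qed

text \<open>
  The mapping path space of \<open>f\<close> consists of the pairs of a point \<open>x\<close> and a path starting at \<open>f x\<close>; compressibility
  of \<open>f\<close> becomes the lifting property of the map taking the endpoint of the path.
\<close>

lemma weq_mapping_path_space:
  assumes w: "f \<in> weq" and f: "f \<in> hom C X Y"
  obtains P a b where "a \<in> hom C P X" "b \<in> hom C P (Path Y)" "f \<cdot> a = ev 0 Y \<cdot> b"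
    "\<And>A x g. x \<in> hom C A X \<Longrightarrow> g \<in> hom C A (Path Y) \<Longrightarrow> f \<cdot> x = ev 0 Y \<cdot> g \<Longrightarrow>
       \<exists>h\<in>hom C A P. a \<cdot> h = x \<and> b \<cdot> h = g"
    "ev 1 Y \<cdot> b \<in> Fib\<^sub>I"
proof -
  have Y: "Y \<in> Ob C" using f by (rule Ob_of_hom)
  have ev: "ev k Y \<in> hom C (Path Y) Y" if "k = 0 \<or> k = 1" for k using that Y by (simp add: hom_def)
  obtain P a b where a: "a \<in> hom C P X" and b: "b \<in> hom C P (Path Y)" and ab: "f \<cdot> a = ev 0 Y \<cdot> b"
    and univ: "\<And>A x g. x \<in> hom C A X \<Longrightarrow> g \<in> hom C A (Path Y) \<Longrightarrow> f \<cdot> x = ev 0 Y \<cdot> g \<Longrightarrow>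
       \<exists>!h. h \<in> hom C A P \<and> a \<cdot> h = x \<and> b \<cdot> h = g"
    by (rule pullback_exists[OF f ev[of 0]]) (simp, blast)
  have "has_lift C (inc n) (ev 1 Y \<cdot> b)" for n
  proof (rule has_liftI[OF inc_in Comp_in[OF b ev[of 1]]])
    fix u v assume u: "u \<in> hom C (\<S> n) P" and v: "v \<in> hom C (\<D> n) Y" and "(ev 1 Y \<cdot> b) \<cdot> u = v \<cdot> inc n"
    then have uv: "ev 1 Y \<cdot> (b \<cdot> u) = v \<cdot> inc n" using Comp_assoc[OF u b ev[of 1]] by simp
    note au = Comp_in[OF u a] and bu = Comp_in[OF u b]
    \<comment> \<open>The boundary paths are extended over the disk backwards from \<open>v\<close>.
      The start of this extension comes from \<open>X\<close> only on the sphere, so it is next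
      compressed into \<open>X\<close>.\<close>
    obtain \<kappa>' where \<kappa>': "\<kappa>' \<in> hom C (\<D> n) (Path Y)" "\<kappa>' \<cdot> inc n = b \<cdot> u" "ev 1 Y \<cdot> \<kappa>' = v"
      using lift_inc[OF ev_Fib\<^sub>I[OF Y] ev[of 1] bu v uv] by auto
    note s = in_hom[OF f] in_hom[OF u] in_hom[OF v] in_hom[OF a] in_hom[OF b] in_hom[OF \<kappa>'(1)] Y
    have 1: "ev 0 Y \<cdot> (b \<cdot> u) = f \<cdot> (a \<cdot> u)"
      using Comp_assoc[OF u b ev[of 0]] Comp_assoc[OF u a f] ab by simp
    then have fau: "f \<cdot> (a \<cdot> u) = (ev 0 Y \<cdot> \<kappa>') \<cdot> inc n"
      using Comp_assoc[OF inc_in \<kappa>'(1) ev[of 0]] \<kappa>'(2) by simp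
    obtain h L where h: "h \<in> hom C (\<D> n) X" "h \<cdot> inc n = a \<cdot> u" and L: "L \<in> hom C (Cyl (\<D> n)) Y"
      "L \<cdot> end_at 0 (\<D> n) = f \<cdot> h" "L \<cdot> end_at 1 (\<D> n) = ev 0 Y \<cdot> \<kappa>'"
      "L \<cdot> cyl (inc n) = ((ev 0 Y \<cdot> \<kappa>') \<cdot> inc n) \<cdot> proj (\<S> n)"
      by (rule weqD[OF w f au Comp_in[OF \<kappa>'(1) ev[of 0]] fau]) auto
    note s' = s in_hom[OF h(1)] in_hom[OF L(1)]
    \<comment> \<open>The box has \<open>\<kappa>'\<close> as its bottom; its sides are
      \<open>L\<close> read as paths, constant paths at \<open>v\<close>, and constant paths along
      the given paths on the sphere. The missing face runs through \<open>L\<close> and then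
      \<open>\<kappa>'\<close>, yet equals the given paths on the sphere with no constant stretch
      inserted, so it lifts the square strictly.\<close>
    define \<delta> where "\<delta> = const_path Y \<cdot> (path_eval Y \<cdot> cyl (b \<cdot> u))"
    define \<gamma> where "\<gamma> = path_of (\<D> n) Y L"
    have \<gamma>: "\<gamma> \<in> hom C (\<D> n) (Path Y)" "ev 0 Y \<cdot> \<gamma> = f \<cdot> h" "ev 1 Y \<cdot> \<gamma> = ev 0 Y \<cdot> \<kappa>'"
      unfolding \<gamma>_def by (simp_all add: s' hom_def L)
    have \<gamma>_inc: "\<gamma> \<cdot> inc n = const_path Y \<cdot> (f \<cdot> (a \<cdot> u))"
      unfolding \<gamma>_def using path_of_comp[of L "\<D> n" Y "inc n" "\<S> n"] L(4) fau
        path_of_proj[of "f \<cdot> (a \<cdot> u)" Y "\<S> n"] by (simp add: s')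
    obtain N where N: "N \<in> hom C (Cyl (\<D> n)) Y" "N \<cdot> end_at 0 (\<D> n) = ev 0 Y \<cdot> \<gamma>"
      "N \<cdot> end_at 1 (\<D> n) = ev 0 Y \<cdot> (const_path Y \<cdot> v)" "N \<cdot> cyl (inc n) = ev 0 Y \<cdot> \<delta>"
    proof (rule box_filling[OF Y, of 1 0 \<gamma> n "const_path Y \<cdot> v" \<delta> "path_eval Y \<cdot> cyl \<kappa>'"])
      show "\<delta> \<cdot> end_at 0 (\<S> n) = \<gamma> \<cdot> inc n" unfolding \<gamma>_inc \<delta>_def by (simp add: s' 1)
      show "\<delta> \<cdot> end_at 1 (\<S> n) = (const_path Y \<cdot> v) \<cdot> inc n" unfolding \<delta>_def by (simp add: s' uv)
      show "(path_eval Y \<cdot> cyl \<kappa>') \<cdot> end_at 0 (\<D> n) = ev 1 Y \<cdot> \<gamma>"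
        using \<gamma>(3) by (simp add: s')
    qed (use \<gamma> \<kappa>' in \<open>simp_all add: s' \<delta>_def hom_def cyl_comp[symmetric]\<close>)
    define \<kappa> where "\<kappa> = path_of (\<D> n) Y N"
    have \<kappa>: "\<kappa> \<in> hom C (\<D> n) (Path Y)" "ev 0 Y \<cdot> \<kappa> = f \<cdot> h" "ev 1 Y \<cdot> \<kappa> = v"
      unfolding \<kappa>_def by (simp_all add: s' in_hom[OF N(1)] hom_def N \<gamma>(2))
    have "\<kappa> \<cdot> inc n = b \<cdot> u"
      unfolding \<kappa>_def by (simp add: path_of_comp in_hom[OF N(1)] N(4) \<delta>_def s')
    moreover obtain l where l: "l \<in> hom C (\<D> n) P" "a \<cdot> l = h" "b \<cdot> l = \<kappa>"
      using univ[OF h(1) \<kappa>(1) \<kappa>(2)[symmetric]] by blast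
    ultimately have "a \<cdot> (l \<cdot> inc n) = a \<cdot> u" "b \<cdot> (l \<cdot> inc n) = b \<cdot> u"
      using Comp_assoc[OF inc_in l(1) a] Comp_assoc[OF inc_in l(1) b] h(2) by simp_all
    moreover have "f \<cdot> (a \<cdot> u) = ev 0 Y \<cdot> (b \<cdot> u)" using 1 by simp
    \<comment> \<open>Both maps have the same two components, and maps into the pullback are
      determined by these.\<close>
    ultimately have "l \<cdot> inc n = u" using univ[OF au bu] u Comp_in[OF inc_in l(1)] by blast
    moreover have "(ev 1 Y \<cdot> b) \<cdot> l = v" using Comp_assoc[OF l(1) b ev[of 1]] l(3) \<kappa>(3) by simp
    ultimately show "\<exists>h\<in>hom C (\<D> n) P. h \<cdot> inc n = u \<and> (ev 1 Y \<cdot> b) \<cdot> h = v" using l(1) by blast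
  qed simp_all
  then have "ev 1 Y \<cdot> b \<in> Fib\<^sub>I" using in_hom(1)[OF Comp_in[OF b ev[of 1]]] unfolding rlp_def gen_cof_def by auto
  with a b ab univ show ?thesis by (intro that[of a P b]) blast+
qed

text \<open>\<open>v\<close> is compressed through \<open>g\<close> and the result through
  \<open>f\<close>. The two homotopies are faces of a box whose other given faces are constant, and
  the missing face joins them.\<close>

lemma weq_comp:
  assumes f: "f \<in> weq" "f \<in> hom C X Y" and g: "g \<in> weq" "g \<in> hom C Y Z"
  shows "g \<cdot> f \<in> weq"
proof (rule weqI[OF Comp_in[OF f(2) g(2)]])
  fix n u v assume u: "u \<in> hom C (\<S> n) X" and v: "v \<in> hom C (\<D> n) Z" and "(g \<cdot> f) \<cdot> u = v \<cdot> inc n"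
  then have uv: "g \<cdot> (f \<cdot> u) = v \<cdot> inc n" using Comp_assoc[OF u f(2) g(2)] by simp
  obtain h K where h: "h \<in> hom C (\<D> n) Y" "h \<cdot> inc n = f \<cdot> u" and K: "K \<in> hom C (Cyl (\<D> n)) Z"
    "K \<cdot> end_at 0 (\<D> n) = g \<cdot> h" "K \<cdot> end_at 1 (\<D> n) = v" "K \<cdot> cyl (inc n) = (v \<cdot> inc n) \<cdot> proj (\<S> n)"
    by (rule weqD[OF g Comp_in[OF u f(2)] v uv]) blast
  obtain l L where l: "l \<in> hom C (\<D> n) X" "l \<cdot> inc n = u" and L: "L \<in> hom C (Cyl (\<D> n)) Y"
    "L \<cdot> end_at 0 (\<D> n) = f \<cdot> l" "L \<cdot> end_at 1 (\<D> n) = h" "L \<cdot> cyl (inc n) = (h \<cdot> inc n) \<cdot> proj (\<S> n)"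
    by (rule weqD[OF f u h(1) h(2)[symmetric]]) blast
  have Z: "Z \<in> Ob C" using v by (rule Ob_of_hom)
  note s = in_hom[OF f(2)] in_hom[OF g(2)] in_hom[OF u] in_hom[OF v] in_hom[OF h(1)] in_hom[OF K(1)]
    in_hom[OF l(1)] in_hom[OF L(1)] Z
  define \<gamma> where "\<gamma> = path_of (\<D> n) Z (g \<cdot> L)"
  define \<delta> where "\<delta> = const_path Z \<cdot> ((v \<cdot> inc n) \<cdot> proj (\<S> n))"
  have \<gamma>: "\<gamma> \<in> hom C (\<D> n) (Path Z)" "ev 0 Z \<cdot> \<gamma> = (g \<cdot> f) \<cdot> l" "ev 1 Z \<cdot> \<gamma> = g \<cdot> h"
    unfolding \<gamma>_def by (simp_all add: s hom_def L)
  have "(g \<cdot> L) \<cdot> cyl (inc n) = (v \<cdot> inc n) \<cdot> proj (\<S> n)"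
    using L(4) h(2) by (simp add: s uv[symmetric])
  then have \<gamma>_inc: "\<gamma> \<cdot> inc n = const_path Z \<cdot> (v \<cdot> inc n)"
    unfolding \<gamma>_def using path_of_comp[of "g \<cdot> L" "\<D> n" Z "inc n" "\<S> n"] path_of_proj[of "v \<cdot> inc n" Z "\<S> n"]
    by (simp add: s)
  obtain N where N: "N \<in> hom C (Cyl (\<D> n)) Z" "N \<cdot> end_at 0 (\<D> n) = ev 0 Z \<cdot> \<gamma>"
      "N \<cdot> end_at 1 (\<D> n) = ev 0 Z \<cdot> (const_path Z \<cdot> v)" "N \<cdot> cyl (inc n) = ev 0 Z \<cdot> \<delta>"
    by (rule box_filling[OF Z, of 1 0 \<gamma> n "const_path Z \<cdot> v" \<delta> K])
      (use \<gamma> \<gamma>_inc K in \<open>simp_all add: s \<delta>_def hom_def\<close>)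
  with l \<gamma>(2) show "\<exists>h\<in>hom C (\<D> n) X. h \<cdot> inc n = u \<and> (\<exists>H\<in>hom C (Cyl (\<D> n)) Z. H \<cdot> end_at 0 (\<D> n) = (g \<cdot> f) \<cdot> h \<and>
        H \<cdot> end_at 1 (\<D> n) = v \<and> H \<cdot> cyl (inc n) = (v \<cdot> inc n) \<cdot> proj (\<S> n))"
    by (intro bexI[of _ l] conjI bexI[of _ N]) (simp_all add: s \<delta>_def)
qed

text \<open>Compressing the image of \<open>v\<close> through \<open>g \<cdot> f\<close> gives a
  homotopy in \<open>Z\<close> only. With its lids and its values on the sphere prescribed it lifts
  to the mapping path space of \<open>g\<close>, and the projection to \<open>Y\<close> is the
  homotopy wanted.\<close>

lemma weq_left_cancel:
  assumes f: "f \<in> hom C X Y" and g: "g \<in> weq" "g \<in> hom C Y Z" and gf: "g \<cdot> f \<in> weq"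
  shows "f \<in> weq"
proof (rule weqI[OF f])
  fix n u v assume u: "u \<in> hom C (\<S> n) X" and v: "v \<in> hom C (\<D> n) Y" and uv: "f \<cdot> u = v \<cdot> inc n"
  have Z: "Z \<in> Ob C" and Y: "Y \<in> Ob C" using g(2) by (rule Ob_of_hom)+
  note gfh = Comp_in[OF f g(2)]
  have "(g \<cdot> f) \<cdot> u = (g \<cdot> v) \<cdot> inc n" using Comp_assoc[OF u f g(2)] Comp_assoc[OF inc_in v g(2)] uv by simp
  then obtain h G where h: "h \<in> hom C (\<D> n) X" "h \<cdot> inc n = u" and G: "G \<in> hom C (Cyl (\<D> n)) Z"
    "G \<cdot> end_at 0 (\<D> n) = (g \<cdot> f) \<cdot> h" "G \<cdot> end_at 1 (\<D> n) = g \<cdot> v"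
    "G \<cdot> cyl (inc n) = ((g \<cdot> v) \<cdot> inc n) \<cdot> proj (\<S> n)"
    using weqD[OF gf gfh u Comp_in[OF v g(2)]] by blast
  obtain P a b where a: "a \<in> hom C P Y" and b: "b \<in> hom C P (Path Z)"
    and univ: "\<And>A x k. x \<in> hom C A Y \<Longrightarrow> k \<in> hom C A (Path Z) \<Longrightarrow> g \<cdot> x = ev 0 Z \<cdot> k \<Longrightarrow>
       \<exists>h\<in>hom C A P. a \<cdot> h = x \<and> b \<cdot> h = k"
    and q: "ev 1 Z \<cdot> b \<in> Fib\<^sub>I"
    by (rule weq_mapping_path_space[OF g]) blast
  note s = in_hom[OF f] in_hom[OF g(2)] in_hom[OF u] in_hom[OF v] in_hom[OF h(1)] in_hom[OF G(1)] in_hom[OF a] in_hom[OF b] Z Y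
  \<comment> \<open>Constant paths embed \<open>Y\<close> in the mapping path space as a section of
    \<open>a\<close>, on which the endpoint map is \<open>g\<close>.\<close>
  obtain c where c: "c \<in> hom C Y P" "a \<cdot> c = Idt C Y" "b \<cdot> c = const_path Z \<cdot> g"
    using univ[OF Idt_in[OF Y], of "const_path Z \<cdot> g"] by (auto simp: s hom_def)
  note s' = s in_hom[OF c(1)]
  have qc: "(ev 1 Z \<cdot> b) \<cdot> (c \<cdot> w) = g \<cdot> w" and ac: "a \<cdot> (c \<cdot> w) = w" if "w \<in> hom C A Y" for w A
  proof -
    note w = in_hom[OF that]
    have "(ev 1 Z \<cdot> b) \<cdot> (c \<cdot> w) = ev 1 Z \<cdot> ((b \<cdot> c) \<cdot> w)" by (simp add: s' w)
    then show "(ev 1 Z \<cdot> b) \<cdot> (c \<cdot> w) = g \<cdot> w" unfolding c(3) by (simp add: s' w)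
    have "a \<cdot> (c \<cdot> w) = (a \<cdot> c) \<cdot> w" by (simp add: s' w)
    then show "a \<cdot> (c \<cdot> w) = w" unfolding c(2) by (simp add: s' w)
  qed
  have d: "(v \<cdot> inc n) \<cdot> proj (\<S> n) \<in> hom C (Cyl (\<S> n)) Y" by (simp add: s hom_def)
  have fhi: "(f \<cdot> h) \<cdot> inc n = v \<cdot> inc n" using Comp_assoc[OF inc_in h(1) f] h(2) uv by simp
  obtain M where M: "M \<in> hom C (Cyl (\<D> n)) P" "M \<cdot> end_at 0 (\<D> n) = c \<cdot> (f \<cdot> h)" "M \<cdot> end_at 1 (\<D> n) = c \<cdot> v"
    "M \<cdot> cyl (inc n) = c \<cdot> ((v \<cdot> inc n) \<cdot> proj (\<S> n))"
  proof (rule lift_square[OF q, of P Z "c \<cdot> (f \<cdot> h)" n "c \<cdot> v" "c \<cdot> ((v \<cdot> inc n) \<cdot> proj (\<S> n))" G])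
    show "G \<cdot> end_at 0 (\<D> n) = (ev 1 Z \<cdot> b) \<cdot> (c \<cdot> (f \<cdot> h))"
      using qc[OF Comp_in[OF h(1) f]] G(2) by (simp add: s)
    show "G \<cdot> end_at 1 (\<D> n) = (ev 1 Z \<cdot> b) \<cdot> (c \<cdot> v)" using qc[OF v] G(3) by simp
    show "G \<cdot> cyl (inc n) = (ev 1 Z \<cdot> b) \<cdot> (c \<cdot> ((v \<cdot> inc n) \<cdot> proj (\<S> n)))"
      using qc[OF d] G(4) by (simp add: s)
    show "(c \<cdot> ((v \<cdot> inc n) \<cdot> proj (\<S> n))) \<cdot> end_at 0 (\<S> n) = (c \<cdot> (f \<cdot> h)) \<cdot> inc n"
      using fhi by (simp add: s')
  qed (use G(1) in \<open>simp_all add: s' hom_def\<close>)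
  have aM: "a \<cdot> M \<in> hom C (Cyl (\<D> n)) Y" using M(1) a by (rule Comp_in)
  have "(a \<cdot> M) \<cdot> end_at 0 (\<D> n) = f \<cdot> h" "(a \<cdot> M) \<cdot> end_at 1 (\<D> n) = v"
    "(a \<cdot> M) \<cdot> cyl (inc n) = (v \<cdot> inc n) \<cdot> proj (\<S> n)"
    using ac[OF Comp_in[OF h(1) f]] ac[OF v] ac[OF d] by (simp_all add: in_hom[OF M(1)] in_hom[OF a] M(2-4))
  with h aM show "\<exists>h\<in>hom C (\<D> n) X. h \<cdot> inc n = u \<and> (\<exists>H\<in>hom C (Cyl (\<D> n)) Y. H \<cdot> end_at 0 (\<D> n) = f \<cdot> h \<and>
        H \<cdot> end_at 1 (\<D> n) = v \<and> H \<cdot> cyl (inc n) = (v \<cdot> inc n) \<cdot> proj (\<S> n))"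
    by blast
qed

text \<open>Since \<open>u\<close> lies in the middle object, it is first moved into the image of
  \<open>X\<close> along paths \<open>\<eta>\<close>; a disk is found in \<open>X\<close>, and its
  image is moved back along an extension of these paths.\<close>

lemma weq_right_cancel:
  assumes f: "f \<in> weq" "f \<in> hom C X Y" and g: "g \<in> hom C Y Z" and gf: "g \<cdot> f \<in> weq"
  shows "g \<in> weq"
proof (rule weqI[OF g])
  fix n u v assume u: "u \<in> hom C (\<S> n) Y" and v: "v \<in> hom C (\<D> n) Z" and uv: "g \<cdot> u = v \<cdot> inc n"
  have Z: "Z \<in> Ob C" and Y: "Y \<in> Ob C" using g by (rule Ob_of_hom)+
  have ev: "ev k W \<in> hom C (Path W) W" if "k = 0 \<or> k = 1" "W \<in> Ob C" for k W using that by (simp add: hom_def)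
  obtain P a b where a: "a \<in> hom C P X" and b: "b \<in> hom C P (Path Y)" and ab: "f \<cdot> a = ev 0 Y \<cdot> b"
    and q: "ev 1 Y \<cdot> b \<in> Fib\<^sub>I"
    by (rule weq_mapping_path_space[OF f]) blast
  obtain P' a' b' where a': "a' \<in> hom C P' X" and b': "b' \<in> hom C P' (Path Z)" and ab': "(g \<cdot> f) \<cdot> a' = ev 0 Z \<cdot> b'"
    and univ: "\<And>A x k. x \<in> hom C A X \<Longrightarrow> k \<in> hom C A (Path Z) \<Longrightarrow> (g \<cdot> f) \<cdot> x = ev 0 Z \<cdot> k \<Longrightarrow>
       \<exists>h\<in>hom C A P'. a' \<cdot> h = x \<and> b' \<cdot> h = k"
    and q': "ev 1 Z \<cdot> b' \<in> Fib\<^sub>I"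
    by (rule weq_mapping_path_space[OF gf Comp_in[OF f(2) g]]) blast
  note s = in_hom[OF f(2)] in_hom[OF g] in_hom[OF u] in_hom[OF v] in_hom[OF a] in_hom[OF b] in_hom[OF a'] in_hom[OF b'] Z Y
  have qh: "ev 1 Y \<cdot> b \<in> hom C P Y" and q'h: "ev 1 Z \<cdot> b' \<in> hom C P' Z" by (simp_all add: s hom_def)
  \<comment> \<open>The sphere is cofibrant, so \<open>u\<close> itself lifts to the mapping path
    space of \<open>f\<close>; the lift is a family of paths that start in the image of
    \<open>X\<close> and end at \<open>u\<close>.\<close>
  define z where "z = onArr \<iota> (inclusion (cube_boundary 0) (cube_boundary n))"
  have z: "z \<in> hom C (\<S> 0) (\<S> n)" "z \<in> Cof" unfolding z_def using \<iota>_hom[OF inclusion_in_Box(3)] Q4(2) by blast+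
  have init: "\<exists>!k. k \<in> hom C (\<S> 0) W" if "W \<in> Ob C" for W using initial that unfolding is_initial_def by blast
  obtain o0 where o0: "o0 \<in> hom C (\<S> 0) P" using init[of P] Ob_of_hom[OF a] by blast
  have "(ev 1 Y \<cdot> b) \<cdot> o0 = u \<cdot> z"
    using init[OF Y] Comp_in[OF o0 qh] Comp_in[OF z(1) u] by blast
  then obtain w where w: "w \<in> hom C (\<S> n) P" "(ev 1 Y \<cdot> b) \<cdot> w = u"
    using has_liftD[OF has_lift_Cof[OF z(2) q] z(1) qh o0 u] by blast
  define \<eta> where "\<eta> = b \<cdot> w"
  have \<eta>: "\<eta> \<in> hom C (\<S> n) (Path Y)" unfolding \<eta>_def using w(1) b by (rule Comp_in)
  have \<eta>1: "ev 1 Y \<cdot> \<eta> = u" using Comp_assoc[OF w(1) b ev[of 1 Y]] w(2) Y by (simp add: \<eta>_def)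
  have \<eta>0: "ev 0 Y \<cdot> \<eta> = f \<cdot> (a \<cdot> w)"
    using Comp_assoc[OF w(1) b ev[of 0 Y]] Comp_assoc[OF w(1) a f(2)] ab Y by (simp add: \<eta>_def)
  note s1 = s in_hom[OF w(1)] in_hom[OF \<eta>]
  have g\<eta>: "map_path g \<cdot> \<eta> \<in> hom C (\<S> n) (Path Z)" by (simp add: s1 hom_def)
  \<comment> \<open>Carried along \<open>g\<close>, these paths end on the boundary of
    \<open>v\<close> and pose a lifting problem for the mapping path space of
    \<open>g \<cdot> f\<close>.\<close>
  obtain w' where w': "w' \<in> hom C (\<S> n) P'" "a' \<cdot> w' = a \<cdot> w" "b' \<cdot> w' = map_path g \<cdot> \<eta>"
    using univ[OF Comp_in[OF w(1) a] g\<eta>] \<eta>0 by (auto simp: s1)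
  have "(ev 1 Z \<cdot> b') \<cdot> w' = v \<cdot> inc n"
    using Comp_assoc[OF w'(1) b' ev[of 1 Z]] w'(3) \<eta>1 uv Z by (simp add: s1)
  then obtain l where l: "l \<in> hom C (\<D> n) P'" "l \<cdot> inc n = w'" "(ev 1 Z \<cdot> b') \<cdot> l = v"
    by (rule lift_inc[OF q' q'h w'(1) v]) blast
  define \<mu> where "\<mu> = b' \<cdot> l"
  define h where "h = a' \<cdot> l"
  have h: "h \<in> hom C (\<D> n) X" "h \<cdot> inc n = a \<cdot> w"
    unfolding h_def using Comp_in[OF l(1) a'] Comp_assoc[OF inc_in l(1) a'] l(2) w'(2) by auto
  have \<mu>: "\<mu> \<in> hom C (\<D> n) (Path Z)" "\<mu> \<cdot> inc n = map_path g \<cdot> \<eta>" "ev 1 Z \<cdot> \<mu> = v" "ev 0 Z \<cdot> \<mu> = (g \<cdot> f) \<cdot> h"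
    unfolding \<mu>_def h_def using Comp_in[OF l(1) b'] Comp_assoc[OF inc_in l(1) b'] l(2,3) w'(3)
      Comp_assoc[OF l(1) b' ev[of 1 Z]] Comp_assoc[OF l(1) b' ev[of 0 Z]] Comp_assoc[OF l(1) a' Comp_in[OF f(2) g]] ab' Z by auto
  have "ev 0 Y \<cdot> \<eta> = (f \<cdot> h) \<cdot> inc n" using Comp_assoc[OF inc_in h(1) f(2)] h(2) \<eta>0 by simp
  \<comment> \<open>The paths \<open>\<eta>\<close> are extended over the disk
    \<open>f \<cdot> h\<close>; the ends of the extended paths form the disk in \<open>Y\<close>
    with boundary \<open>u\<close>.\<close>
  then obtain \<nu> where \<nu>: "\<nu> \<in> hom C (\<D> n) (Path Y)" "\<nu> \<cdot> inc n = \<eta>" "ev 0 Y \<cdot> \<nu> = f \<cdot> h"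
    using lift_inc[OF ev_Fib\<^sub>I[OF Y, of 0] ev[of 0 Y] \<eta> Comp_in[OF h(1) f(2)]] Y by auto
  note s2 = s1 in_hom[OF h(1)] in_hom[OF \<mu>(1)] in_hom[OF \<nu>(1)]
  have "(ev 1 Y \<cdot> \<nu>) \<cdot> inc n = u" using \<nu>(2) \<eta>1 by (simp add: s2)
  \<comment> \<open>The paths \<open>map_path g \<cdot> \<nu>\<close> and \<open>\<mu>\<close> have
    the same start and agree on the sphere. The face joining their ends is the homotopy from the
    image of the new disk to \<open>v\<close>.\<close>
  moreover obtain N where N: "N \<in> hom C (Cyl (\<D> n)) Z" "N \<cdot> end_at 0 (\<D> n) = ev 1 Z \<cdot> (map_path g \<cdot> \<nu>)"
      "N \<cdot> end_at 1 (\<D> n) = ev 1 Z \<cdot> \<mu>" "N \<cdot> cyl (inc n) = ev 1 Z \<cdot> ((map_path g \<cdot> \<eta>) \<cdot> proj (\<S> n))"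
    by (rule box_filling[OF Z, of 0 1 "map_path g \<cdot> \<nu>" n \<mu> "(map_path g \<cdot> \<eta>) \<cdot> proj (\<S> n)" "(g \<cdot> (f \<cdot> h)) \<cdot> proj (\<D> n)"])
      (use \<mu> \<nu> h(2) \<eta>0 Comp_reassoc[OF h(2), of "proj (\<S> n)"] Comp_reassoc[OF \<eta>0, of "proj (\<S> n)"] in \<open>simp_all add: s2 hom_def\<close>)
  have "N \<cdot> end_at 0 (\<D> n) = g \<cdot> (ev 1 Y \<cdot> \<nu>)" "N \<cdot> end_at 1 (\<D> n) = v" using N(2,3) \<mu>(3) by (simp_all add: s2)
  moreover have "N \<cdot> cyl (inc n) = (v \<cdot> inc n) \<cdot> proj (\<S> n)"
    unfolding N(4) uv[symmetric] using Comp_reassoc[OF \<eta>1] by (simp add: s2)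
  moreover have "ev 1 Y \<cdot> \<nu> \<in> hom C (\<D> n) Y" by (simp add: s2 hom_def)
  ultimately show "\<exists>h\<in>hom C (\<D> n) Y. h \<cdot> inc n = u \<and> (\<exists>H\<in>hom C (Cyl (\<D> n)) Z. H \<cdot> end_at 0 (\<D> n) = g \<cdot> h \<and>
        H \<cdot> end_at 1 (\<D> n) = v \<and> H \<cdot> cyl (inc n) = (v \<cdot> inc n) \<cdot> proj (\<S> n))"
    using N(1) by blast
qed

text \<open>The square is carried along \<open>s\<close> and \<open>s'\<close>; the disk and the
  homotopy come back along \<open>r\<close> and \<open>r'\<close>.\<close>

lemma weq_retract:
  assumes "is_retract C f g" and w: "g \<in> weq"
  shows "f \<in> weq"
proof -
  obtain s r s' r' where f: "f \<in> hom C (Dom C f) (Cod C f)" and g: "g \<in> hom C (Dom C g) (Cod C g)"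
    and s: "s \<in> hom C (Dom C f) (Dom C g)" and r: "r \<in> hom C (Dom C g) (Dom C f)"
    and s': "s' \<in> hom C (Cod C f) (Cod C g)" and r': "r' \<in> hom C (Cod C g) (Cod C f)"
    and eq: "r \<cdot> s = Idt C (Dom C f)" "r' \<cdot> s' = Idt C (Cod C f)" "g \<cdot> s = s' \<cdot> f" "f \<cdot> r = r' \<cdot> g"
    using assms(1) unfolding is_retract_def by (auto simp: hom_def)
  show ?thesis
  proof (rule weqI[OF f])
    fix n u v assume u: "u \<in> hom C (\<S> n) (Dom C f)" and v: "v \<in> hom C (\<D> n) (Cod C f)" and uv: "f \<cdot> u = v \<cdot> inc n"
    have "g \<cdot> (s \<cdot> u) = (s' \<cdot> v) \<cdot> inc n"
      using Comp_assoc[OF u s g] Comp_assoc[OF u f s'] Comp_assoc[OF inc_in v s'] uv eq(3) by simp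
    then obtain h H where h: "h \<in> hom C (\<D> n) (Dom C g)" "h \<cdot> inc n = s \<cdot> u" and H: "H \<in> hom C (Cyl (\<D> n)) (Cod C g)"
      "H \<cdot> end_at 0 (\<D> n) = g \<cdot> h" "H \<cdot> end_at 1 (\<D> n) = s' \<cdot> v"
      "H \<cdot> cyl (inc n) = ((s' \<cdot> v) \<cdot> inc n) \<cdot> proj (\<S> n)"
      by (rule weqD[OF w g Comp_in[OF u s] Comp_in[OF v s']]) blast
    note hs = in_hom(1)[OF f] in_hom(1)[OF g] in_hom[OF s] in_hom[OF r] in_hom[OF s'] in_hom[OF r'] in_hom[OF u] in_hom[OF v]
      in_hom[OF h(1)] in_hom[OF H(1)]
    have r's': "r' \<cdot> (s' \<cdot> w) = w" if "w \<in> Arr C" "Cod C w = Cod C f" for w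
      using Comp_reassoc[OF eq(2), of w] that by (simp add: hs)
    have rs: "r \<cdot> (s \<cdot> u) = u" using Comp_reassoc[OF eq(1), of u] by (simp add: hs)
    have "r \<cdot> h \<in> hom C (\<D> n) (Dom C f)" "(r \<cdot> h) \<cdot> inc n = u" "r' \<cdot> H \<in> hom C (Cyl (\<D> n)) (Cod C f)"
      "(r' \<cdot> H) \<cdot> end_at 0 (\<D> n) = f \<cdot> (r \<cdot> h)" "(r' \<cdot> H) \<cdot> end_at 1 (\<D> n) = v"
      "(r' \<cdot> H) \<cdot> cyl (inc n) = (v \<cdot> inc n) \<cdot> proj (\<S> n)"
      using h(2) H(2-4) rs Comp_reassoc[OF eq(4), of h] by (simp_all add: hs hom_def r's')
    then show "\<exists>h\<in>hom C (\<D> n) (Dom C f). h \<cdot> inc n = u \<and> (\<exists>H\<in>hom C (Cyl (\<D> n)) (Cod C f). H \<cdot> end_at 0 (\<D> n) = f \<cdot> h \<and>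
        H \<cdot> end_at 1 (\<D> n) = v \<and> H \<cdot> cyl (inc n) = (v \<cdot> inc n) \<cdot> proj (\<S> n))"
      by blast
  qed
qed

text \<open>Transposed, a lift against \<open>j\<close> extends a map given on the cylinder of the
  smaller cube and on both ends of the cylinder of the larger one. The pushout product of
  \<open>inc 1\<close> with \<open>j\<close> provides this because \<open>B\<close> is
  fibrant.\<close>

lemma ends_Fib:
  assumes B: "B \<in> Ob C"
  shows "pairing C (ev 0 B) (ev 1 B) \<in> Fib"
proof -
  have ev: "ev k B \<in> hom C (Path B) B" if "k = 0 \<or> k = 1" for k using that B by (simp add: hom_def)
  let ?p = "pairing C (ev 0 B) (ev 1 B)"
  have p: "?p \<in> hom C (Path B) (times_ob C B B)" by (intro pairing_in ev) simp_all
  let ?b = "\<lambda>k X. at_endpoint C \<iota> k (cube_boundary 1) X"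
  have b: "?b k X \<in> hom C X (times_ob C X (\<S> 1))" if "k \<in> {0, 1}" "X \<in> Ob C" for k X
    using at_boundary_in that by blast
  have "has_lift C j ?p" if jJ: "j \<in> gen_triv_cof \<iota>" for j
  proof -
    obtain m where m: "j = onArr \<iota> (inclusion (cube m) (cube (Suc m)))" using jJ unfolding gen_triv_cof_def by blast
    let ?D = "\<D> m" and ?D' = "\<D> (Suc m)"
    have j: "j \<in> hom C ?D ?D'" unfolding m by (rule gen_triv_cof_in)
    show ?thesis
    proof (rule has_liftI[OF j p])
      fix u v assume u: "u \<in> hom C ?D (Path B)" and v: "v \<in> hom C ?D' (times_ob C B B)" and uv: "?p \<cdot> u = v \<cdot> j"
      define w where "w = (\<lambda>k :: real. if k = 0 then pr1 C B B \<cdot> v else pr2 C B B \<cdot> v)"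
      have w: "w k \<in> hom C ?D' B" for k
        unfolding w_def using Comp_in[OF v pr1_in[OF B B]] Comp_in[OF v pr2_in[OF B B]] by simp
      have pp: "pr1 C B B \<cdot> ?p = ev 0 B" "pr2 C B B \<cdot> ?p = ev 1 B"
        by (simp_all add: pr1_pairing[OF ev[of 0] ev[of 1]] pr2_pairing[OF ev[of 0] ev[of 1]])
      have wj: "ev k B \<cdot> u = w k \<cdot> j" if "k \<in> {0, 1}" for k
        using that Comp_assoc[OF u p pr1_in[OF B B]] Comp_assoc[OF u p pr2_in[OF B B]]
          Comp_assoc[OF j v pr1_in[OF B B]] Comp_assoc[OF j v pr2_in[OF B B]] uv pp by (auto simp: w_def)
      \<comment> \<open>The components of \<open>v\<close> are the values prescribed at the two
        ends; the coproduct axiom joins them into one map.\<close>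
      obtain b0 where b0: "b0 \<in> hom C (times_ob C ?D' (\<S> 1)) B" "\<And>k. k \<in> {0, 1} \<Longrightarrow> b0 \<cdot> ?b k ?D' = w k"
        using coproduct_mediating[OF coproduct_\<S>1[OF \<iota>_Ob(1)] B, of w] w by blast
      define e where "e = path_eval B \<cdot> cyl u"
      have e: "e \<in> hom C (Cyl ?D) B" unfolding e_def using B in_hom[OF u] by (simp add: hom_def)
      note sw = swap_in[OF \<iota>_Ob(1) \<iota>_Ob(1)] swap_in[OF \<iota>_Ob(2) \<iota>_Ob(1)] swap_in[OF \<iota>_Ob(1) \<iota>_Ob(2)]
      note s = in_hom[OF j] in_hom[OF u] in_hom[OF b0(1)] in_hom[OF e] in_hom[OF sw(1)] in_hom[OF sw(2)] in_hom[OF sw(3)] B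
      note f1 = times_arr_in[OF Idt_in[of ?D] inc_in[of 1]] and f2 = times_arr_in[OF j Idt_in[of "\<S> 1"]]
      have key: "e \<cdot> times_arr C (Idt C ?D) (inc 1) = b0 \<cdot> times_arr C j (Idt C (\<S> 1))"
      proof (rule coproduct_eqI[OF coproduct_\<S>1[of ?D]])
        fix k :: real assume k: "k \<in> {0, 1}"
        then have k': "k = 0 \<or> k = 1" by simp
        have "(e \<cdot> times_arr C (Idt C ?D) (inc 1)) \<cdot> ?b k ?D = e \<cdot> end_at k ?D"
          using Comp_assoc[OF b[OF k] f1 e] inc_end_at[OF k', of ?D] by simp
        also have "\<dots> = w k \<cdot> j" using wj[OF k] k' unfolding e_def by (simp add: s)
        also have "\<dots> = b0 \<cdot> (?b k ?D' \<cdot> j)" using Comp_assoc[OF j b[OF k] b0(1)] b0(2)[OF k] by simp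
        also have "\<dots> = (b0 \<cdot> times_arr C j (Idt C (\<S> 1))) \<cdot> ?b k ?D"
          using Comp_assoc[OF b[OF k] f2 b0(1)] times_arr_point_section[OF endpoint_in(2)[OF k'] j]
          by (simp add: at_endpoint_eq)
        finally show "(e \<cdot> times_arr C (Idt C ?D) (inc 1)) \<cdot> ?b k ?D = (b0 \<cdot> times_arr C j (Idt C (\<S> 1))) \<cdot> ?b k ?D" .
      qed (use Comp_in[OF f1 e] Comp_in[OF f2 b0(1)] in simp_all)
      have lift: "has_lift C h (bang B)" if "is_pushout_product C (inc 1) j h" for h
      proof -
        have "h \<in> pushout_products C (gen_cof \<iota>) (gen_triv_cof \<iota>)"
          using that jJ unfolding pushout_products_def gen_cof_def by blast
        with Q3(2) bang_Fib[OF B] show ?thesis by (blast intro: has_lift_Cof\<^sub>J)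
      qed
      have 1: "(e \<cdot> swap \<I> ?D) \<cdot> times_arr C (inc 1) (Idt C ?D) = (b0 \<cdot> swap (\<S> 1) ?D') \<cdot> times_arr C (Idt C (\<S> 1)) j"
      proof -
        have "(e \<cdot> swap \<I> ?D) \<cdot> times_arr C (inc 1) (Idt C ?D) = (e \<cdot> times_arr C (Idt C ?D) (inc 1)) \<cdot> swap (\<S> 1) ?D"
          using swap_times_arr[OF inc_in[of 1] Idt_in[of ?D]] by (simp add: s)
        also have "\<dots> = (b0 \<cdot> swap (\<S> 1) ?D') \<cdot> times_arr C (Idt C (\<S> 1)) j"
          unfolding key using swap_times_arr[OF Idt_in[of "\<S> 1"] j] by (simp add: s)
        finally show ?thesis .
      qed
      have o: "times_ob C \<I> ?D' \<in> Ob C" "times_ob C \<I> ?D \<in> Ob C" "times_ob C (\<S> 1) ?D' \<in> Ob C" by simp_all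
      obtain M where M: "M \<in> hom C (times_ob C \<I> ?D') B" "M \<cdot> times_arr C (Idt C \<I>) j = e \<cdot> swap \<I> ?D"
        "M \<cdot> times_arr C (inc 1) (Idt C ?D') = b0 \<cdot> swap (\<S> 1) ?D'"
        by (rule pushout_product_lift[OF lift inc_in j bang_in[OF B] Comp_in[OF sw(1) e] Comp_in[OF sw(2) b0(1)] bang_in[OF o(1)] 1])
          (simp_all add: s)
      define h where "h = path_of ?D' B (M \<cdot> swap ?D' \<I>)"
      note s' = s in_hom[OF M(1)]
      have h: "h \<in> hom C ?D' (Path B)" unfolding h_def by (simp add: s' hom_def)
      have "(M \<cdot> swap ?D' \<I>) \<cdot> cyl j = (M \<cdot> times_arr C (Idt C \<I>) j) \<cdot> swap ?D \<I>"
        using swap_times_arr[OF j Idt_in[of \<I>]] by (simp add: s')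
      also have "\<dots> = e" unfolding M(2) using swap_swap[of ?D \<I>] by (simp add: s')
      finally have "h \<cdot> j = u" unfolding h_def by (simp add: path_of_comp s' e_def)
      moreover have "ev k B \<cdot> h = w k" if k: "k \<in> {0, 1}" for k
      proof -
        have k': "k = 0 \<or> k = 1" using k by simp
        note f3 = times_arr_in[OF Idt_in[of ?D'] inc_in[of 1]]
        have "ev k B \<cdot> h = (M \<cdot> swap ?D' \<I>) \<cdot> end_at k ?D'" unfolding h_def using k' by (simp add: s')
        also have "\<dots> = (M \<cdot> swap ?D' \<I>) \<cdot> (times_arr C (Idt C ?D') (inc 1) \<cdot> ?b k ?D')"
          using inc_end_at[OF k', of ?D'] by simp
        also have "\<dots> = M \<cdot> ((swap ?D' \<I> \<cdot> times_arr C (Idt C ?D') (inc 1)) \<cdot> ?b k ?D')"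
          using in_hom[OF b[OF k, of ?D']] by (simp add: s')
        also have "\<dots> = ((M \<cdot> times_arr C (inc 1) (Idt C ?D')) \<cdot> swap ?D' (\<S> 1)) \<cdot> ?b k ?D'"
          unfolding swap_times_arr[OF Idt_in[OF \<iota>_Ob(1)] inc_in[of 1]]
          using in_hom[OF b[OF k, of ?D']] by (simp add: s')
        also have "\<dots> = b0 \<cdot> ((swap (\<S> 1) ?D' \<cdot> swap ?D' (\<S> 1)) \<cdot> ?b k ?D')"
          unfolding M(3) using in_hom[OF b[OF k, of ?D']] by (simp add: s')
        also have "\<dots> = w k"
          unfolding swap_swap[OF \<iota>_Ob] using in_hom[OF b[OF k, of ?D']] b0(2)[OF k] by simp
        finally show ?thesis .
      qed
      then have "pr1 C B B \<cdot> (?p \<cdot> h) = pr1 C B B \<cdot> v" "pr2 C B B \<cdot> (?p \<cdot> h) = pr2 C B B \<cdot> v"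
        using Comp_assoc[OF h p pr1_in[OF B B]] Comp_assoc[OF h p pr2_in[OF B B]] pp by (auto simp: w_def)
      then have "?p \<cdot> h = v" by (rule product_eqI[OF B B Comp_in[OF h p] v])
      ultimately show "\<exists>h\<in>hom C ?D' (Path B). h \<cdot> j = u \<and> ?p \<cdot> h = v" using h by blast
    qed
  qed
  with in_hom(1)[OF p] show ?thesis unfolding rlp_def by blast
qed

text \<open>All objects being fibrant, a map in \<open>Cof\<^sub>J\<close> is the inclusion of a strong deformation retract.\<close>

lemma Cof\<^sub>J_subset_weq: "Cof\<^sub>J \<subseteq> weq"
proof
  fix j assume j': "j \<in> Cof\<^sub>J"
  define A B where "A = Dom C j" and "B = Cod C j"
  have j: "j \<in> hom C A B" using j' unfolding cof_def is_retract_def A_def B_def by (auto simp: hom_def)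
  have A: "A \<in> Ob C" and B: "B \<in> Ob C" using j by (rule Ob_of_hom)+
  have ev: "ev k B \<in> hom C (Path B) B" if "k = 0 \<or> k = 1" for k using that B by (simp add: hom_def)
  \<comment> \<open>The retraction is an extension of the identity along \<open>j\<close>, available
    because \<open>A\<close> is fibrant.\<close>
  obtain r where r: "r \<in> hom C B A" "r \<cdot> j = Idt C A"
    by (rule has_liftD[OF has_lift_Cof\<^sub>J[OF j' bang_Fib[OF A]] j bang_in[OF A] Idt_in[OF A] bang_in[OF B]])
      (use A B in \<open>auto simp: in_hom[OF j]\<close>)
  note s = in_hom[OF j] in_hom[OF r(1)] A B
  let ?p = "pairing C (ev 0 B) (ev 1 B)"
  have p: "?p \<in> hom C (Path B) (times_ob C B B)" by (intro pairing_in ev) simp_all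
  have pp: "pr1 C B B \<cdot> ?p = ev 0 B" "pr2 C B B \<cdot> ?p = ev 1 B" by (simp_all add: pr1_pairing[OF ev[of 0] ev[of 1]] pr2_pairing[OF ev[of 0] ev[of 1]])
  have jr: "j \<cdot> r \<in> hom C B B" using r(1) j by (rule Comp_in)
  have cj: "const_path B \<cdot> j \<in> hom C A (Path B)" by (simp add: s hom_def)
  \<comment> \<open>The deformation \<open>K\<close> from \<open>j \<cdot> r\<close> to the identity
    arises by lifting \<open>j\<close> against the pair of evaluations. Prescribing constant paths
    on \<open>A\<close> keeps it stationary there.\<close>
  have "?p \<cdot> (const_path B \<cdot> j) = pairing C j j"
    using pairing_comp[OF ev[of 0] ev[of 1] cj] by (simp add: s)
  also have "\<dots> = pairing C (j \<cdot> r) (Idt C B) \<cdot> j"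
    using pairing_comp[OF jr Idt_in[OF B] j] r(2) by (simp add: s)
  finally obtain K where K: "K \<in> hom C B (Path B)" "K \<cdot> j = const_path B \<cdot> j" "?p \<cdot> K = pairing C (j \<cdot> r) (Idt C B)"
    by (rule has_liftD[OF has_lift_Cof\<^sub>J[OF j' ends_Fib[OF B]] j p cj pairing_in[OF jr Idt_in[OF B]]]) blast
  have K0: "ev 0 B \<cdot> K = j \<cdot> r" and K1: "ev 1 B \<cdot> K = Idt C B"
    using Comp_assoc[OF K(1) p pr1_in[OF B B]] Comp_assoc[OF K(1) p pr2_in[OF B B]] pp K(3)
      pr1_pairing[OF jr Idt_in[OF B]] pr2_pairing[OF jr Idt_in[OF B]] by simp_all
  show "j \<in> weq"
  proof (rule weqI[OF j])
    fix n u v assume u: "u \<in> hom C (\<S> n) A" and v: "v \<in> hom C (\<D> n) B" and uv: "j \<cdot> u = v \<cdot> inc n"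
    note s' = s in_hom[OF u] in_hom[OF v] in_hom[OF K(1)]
    have "(r \<cdot> v) \<cdot> inc n = r \<cdot> (j \<cdot> u)" unfolding uv by (simp add: s')
    then have ru: "(r \<cdot> v) \<cdot> inc n = u" using Comp_reassoc[OF r(2), of u] by (simp add: s')
    \<comment> \<open>\<open>K\<close> deforms \<open>j \<cdot> (r \<cdot> v)\<close> into
      \<open>v\<close>. On the sphere \<open>v\<close> comes from \<open>A\<close>, where
      \<open>K\<close> is constant, so the homotopy is relative.\<close>
    define H where "H = path_eval B \<cdot> cyl (K \<cdot> v)"
    have "H \<cdot> end_at 0 (\<D> n) = j \<cdot> (r \<cdot> v)" "H \<cdot> end_at 1 (\<D> n) = v"
      unfolding H_def using Comp_reassoc[OF K0, of v] Comp_reassoc[OF K1, of v] by (simp_all add: s')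
    moreover have "H \<cdot> cyl (inc n) = (v \<cdot> inc n) \<cdot> proj (\<S> n)"
    proof -
      have "H \<cdot> cyl (inc n) = path_eval B \<cdot> cyl (K \<cdot> (j \<cdot> u))"
        unfolding H_def uv by (simp add: s' cyl_comp)
      also have "K \<cdot> (j \<cdot> u) = path_of (\<S> n) B ((j \<cdot> u) \<cdot> proj (\<S> n))"
        using Comp_reassoc[OF K(2), of u] path_of_proj[of "j \<cdot> u" B "\<S> n"] by (simp add: s')
      also have "path_eval B \<cdot> cyl \<dots> = (j \<cdot> u) \<cdot> proj (\<S> n)" by (simp add: s')
      finally show ?thesis unfolding uv .
    qed
    moreover have "H \<in> hom C (Cyl (\<D> n)) B" unfolding H_def by (simp add: s' hom_def)
    ultimately show "\<exists>h\<in>hom C (\<D> n) A. h \<cdot> inc n = u \<and> (\<exists>H\<in>hom C (Cyl (\<D> n)) B. H \<cdot> end_at 0 (\<D> n) = j \<cdot> h \<and>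
        H \<cdot> end_at 1 (\<D> n) = v \<and> H \<cdot> cyl (inc n) = (v \<cdot> inc n) \<cdot> proj (\<S> n))"
      using ru Comp_in[OF v r(1)] by blast
  qed
qed

text \<open>In a factorization of \<open>i\<close> into \<open>j\<close> and a fibration
  \<open>q\<close>, right cancellation makes \<open>q\<close> a weak equivalence, hence a member of
  \<open>Fib\<^sub>I\<close>. So \<open>i\<close> lifts against \<open>q\<close>, is a retract of
  \<open>j\<close>, and inherits its lifting against all fibrations.\<close>

lemma Cof_weq_lift:
  assumes i: "i \<in> Cof" "i \<in> weq" and p: "p \<in> Fib"
  shows "has_lift C i p"
proof -
  have ih: "i \<in> hom C (Dom C i) (Cod C i)" using i(2) unfolding weq_def by (simp add: hom_def)
  have ph: "p \<in> hom C (Dom C p) (Cod C p)" using p by (simp add: rlp_def hom_def)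
  obtain j q Z where j: "j \<in> Cof\<^sub>J" "j \<in> hom C (Dom C i) Z" and q: "q \<in> Fib" "q \<in> hom C Z (Cod C i)" and qj: "i = q \<cdot> j"
    by (rule factor_Cof\<^sub>J[OF ih]) blast
  have "q \<in> weq" using weq_right_cancel[OF _ j(2) q(2)] j(1) Cof\<^sub>J_subset_weq i(2) qj by blast
  then have "q \<in> Fib\<^sub>I" using q(1) Fib_weq_subset_Fib\<^sub>I by blast
  then have "has_lift C (q \<cdot> j) q" using has_lift_Cof[OF i(1)] qj by simp
  then have "is_retract C i j" using retract_of_factorization[OF j(2) q(2)] qj by simp
  then show ?thesis by (rule has_lift_retract[OF _ has_lift_Cof\<^sub>J[OF j(1) p] ph])
qed

section \<open>Verification of the model category axioms\<close>

lemma model_structure: "model_structure C weq Cof Fib"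
  unfolding model_structure_def
proof (intro conjI ballI allI impI)
  show "weq \<subseteq> Arr C" "Cof \<subseteq> Arr C" "Fib \<subseteq> Arr C"
    by (auto simp: weq_def cof_def is_retract_def rlp_def)
next
  fix f g assume f: "f \<in> Arr C" and g: "g \<in> Arr C" and fg: "Dom C g = Cod C f"
  have fh: "f \<in> hom C (Dom C f) (Cod C f)" and gh: "g \<in> hom C (Cod C f) (Cod C g)" using f g fg by (simp_all add: hom_def)
  show "g \<cdot> f \<in> weq" if "f \<in> weq \<and> g \<in> weq" using weq_comp[OF _ fh _ gh] that by blast
  show "g \<in> weq" if "f \<in> weq \<and> g \<cdot> f \<in> weq" using weq_right_cancel[OF _ fh gh] that by blast
  show "f \<in> weq" if "g \<in> weq \<and> g \<cdot> f \<in> weq" using weq_left_cancel[OF fh _ gh] that by blast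
next
  fix f g assume fg: "is_retract C f g"
  show "f \<in> weq" if "g \<in> weq" using weq_retract[OF fg that] .
  show "f \<in> Fib" if "g \<in> Fib" using rlp_retract[OF fg that gen_triv_cof_Arr] .
  assume g: "g \<in> Cof"
  \<comment> \<open>Membership of the retract in \<open>Cof\<close> is read off from its lifting
    property.\<close>
  have "has_lift C f p" if "p \<in> Fib\<^sub>I" for p
    using has_lift_retract[OF fg has_lift_Cof[OF g that], of "Dom C p" "Cod C p"] that by (simp add: rlp_def hom_def)
  then show "f \<in> Cof" using fg by (intro Cof_I) (auto simp: is_retract_def)
next
  fix i p assume "i \<in> Cof" "p \<in> Fib" "i \<in> weq \<or> p \<in> weq"
  then show "has_lift C i p" using Cof_weq_lift has_lift_Cof Fib_weq_subset_Fib\<^sub>I by blast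
next
  fix f assume f: "f \<in> Arr C"
  obtain i p Z where "i \<in> Cof" "p \<in> Fib\<^sub>I" "i \<in> hom C (Dom C f) Z" "p \<in> hom C Z (Cod C f)" "f = p \<cdot> i"
    by (rule factor_Cof[OF Arr_hom[OF f]]) blast
  then show "\<exists>i\<in>Cof. \<exists>p\<in>Fib \<inter> weq. Dom C p = Cod C i \<and> f = p \<cdot> i"
    using Fib\<^sub>I_subset_Fib Fib\<^sub>I_subset_weq in_hom by fast
next
  fix f assume f: "f \<in> Arr C"
  obtain i p Z where "i \<in> Cof\<^sub>J" "p \<in> Fib" "i \<in> hom C (Dom C f) Z" "p \<in> hom C Z (Cod C f)" "f = p \<cdot> i"
    by (rule factor_Cof\<^sub>J[OF Arr_hom[OF f]]) blast
  then show "\<exists>i\<in>Cof \<inter> weq. \<exists>p\<in>Fib. Dom C p = Cod C i \<and> f = p \<cdot> i"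
    using Cof\<^sub>J_subset_Cof Cof\<^sub>J_subset_weq in_hom by fast
qed

end

theorem theorem2p6:
  fixes C :: "('o, 'm) category"
    and \<iota> :: "(box_ob, box_arr, 'o, 'm) ftor"
  assumes "grothendieck_universe TYPE('u)"
    and "Q_structure TYPE('u) C \<iota>"
  shows "model_structure C
           {f \<in> Arr C. \<forall>n. n_connected C \<iota> n f}
           (cof TYPE('u) C (gen_cof \<iota>))
           (rlp C (gen_triv_cof \<iota>))"
proof -
  interpret q_structure C \<iota> "TYPE('u)" using assms by (rule q_structure.intro)
  show ?thesis using model_structure unfolding weq_def .
qed

end
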